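(* Let $n\ge2$, $1\le k \le n-1$, $\rho=(k-1)/2$, $\sigma=(n-k)/2-1$, and let $\{Y^n_{j,\lambda}\}$ ($j=0,1,2,\dots$; $\lambda=1,\dots,d_n(j)$) be an orthonormal basis of (real) spherical harmonics in $L^2(S^n)$, $Y^n_{j,\lambda}$ having degree $j$. For $j\in\{0,2,4,\ldots\}$ let $$\hat Y_{j, \lambda} (v) = \varkappa_j \sqrt {d_n(j)} \int_{S^n} Y^n_{j, \lambda} (x)\, R_{j/2}^{(\rho, \sigma )}(2|x^T v|^2 - 1)\, d_*x,\qquad v\in V_{n+1,n-k}.$$ Then the set $\{\hat Y_{j, \lambda}:\ j=0, 2,4,\ldots;\ \lambda =1,2, \ldots, d_n(j) \}$ is orthonormal, that is, $$\int_{V_{n+1, n-k}} \hat Y_{j, \lambda} (v)\, \hat Y_{j', \lambda'} (v)\, d_*v =\begin{cases} 1 & \text{if } j = j' \text{ and } \lambda = \lambda',\\ 0 & \text{otherwise}.\end{cases}$$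
   Context: $S^n\subset\mathbb{R}^{n+1}$ is the unit sphere, $d_*x$ its normalized (probability) surface measure; orthonormality in $L^2(S^n)$ is with respect to $d_*x$. $\sigma_m=2\pi^{(m+1)/2}/\Gamma((m+1)/2)$ is the area of $S^m$ (so $\sigma_0=2$; note $\sigma$ without index is a real parameter). $V_{n+1,n-k}$ is the Stiefel manifold of real $(n+1)\times(n-k)$ matrices $v$ with $v^Tv=I_{n-k}$, and $d_*v$ is its left $O(n+1)$- and right $O(n-k)$-invariant probability measure. For $x\in S^n$ (a column vector), $|x^Tv|$ is the Euclidean norm of the row vector $x^Tv$. Constants and polynomials: $d_n(j)=(n+2j-1)\dfrac{\Gamma(n+j-1)}{\Gamma(j+1)\Gamma(n)}$ is the dimension of the space of spherical harmonics of degree $j$ on $S^n$; $R^{(\rho,\sigma)}_m(t)=P^{(\rho,\sigma)}_m(t)/P^{(\rho,\sigma)}_m(1)$ is the normalized Jacobi polynomial; for $j$ even, $$\varkappa_j=\left[\frac{\sigma_n\,(2j+n-1)\,\Gamma\left(\frac{j+k+1}{2}\right)\Gamma\left(\frac{j+n-1}{2}\right)}{\sigma_{n-k-1}\sigma_k\,\Gamma^2\left(\frac{k+1}{2}\right)\Gamma\left(\frac j2+1\right)\Gamma\left(\frac{j+n-k}{2}\right)}\right]^{1/2}.$$ *)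

theory Defs
  imports "HOL-Probability.Probability"
begin

section \<open>Measures on the sphere and on the Stiefel manifold\<close>

text \<open>Surface measure as cone measure: the measure of \<open>A\<close> is the fraction of the volume of the unit
  ball taken up by the cone over \<open>A\<close> with apex the origin. Here \<^term>\<open>sgn x\<close> is \<open>x / \<bar>x\<bar>\<close>, and
  \<open>sgn 0 = 0\<close> is a null event. The space of the measure is the sphere itself, so values
  of functions off the sphere play no role.\<close>

definition sphere_measure :: "'a::euclidean_space measure" where
  "sphere_measure =
     restrict_space (distr (uniform_measure lborel (ball 0 1)) borel sgn) (sphere 0 1)"

lemma space_sphere_measure [simp]: "space sphere_measure = sphere 0 1"
  by (simp add: sphere_measure_def space_restrict_space)

lemma sets_sphere_measure:
  "sets (sphere_measure :: 'a::euclidean_space measure) = sets (restrict_space borel (sphere 0 1))"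
  by (simp add: sphere_measure_def sets_restrict_space)

lemma borel_measurable_sgn_euclidean: "(sgn :: 'a::euclidean_space \<Rightarrow> 'a) \<in> borel_measurable borel"
  unfolding sgn_div_norm by measurable

lemma prob_space_sphere_measure: "prob_space (sphere_measure :: 'a::euclidean_space measure)"
proof -
  let ?U = "uniform_measure lborel (ball 0 1) :: 'a measure"
  let ?D = "distr ?U borel sgn"
  have e: "emeasure lborel (ball 0 1 :: 'a set) \<noteq> 0" "emeasure lborel (ball 0 1 :: 'a set) \<noteq> \<infinity>"
    by (simp_all add: emeasure_ball unit_ball_vol_pos less_imp_neq[symmetric])
  interpret U: prob_space ?U
    by (rule prob_space_uniform_measure[OF e])
  have m: "sgn \<in> measurable ?U (borel :: 'a measure)"
    using borel_measurable_sgn_euclidean by simp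
  interpret D: prob_space ?D by (rule U.prob_space_distr[OF m])
  have "AE x in lborel. x \<noteq> (0::'a)" by (rule AE_lborel_singleton)
  then have "AE x in ?U. x \<noteq> 0"
    by (intro AE_uniform_measureI) auto
  then have "AE x in ?U. sgn x \<in> sphere 0 1"
    by eventually_elim (simp add: norm_sgn)
  then have "AE x in ?D. x \<in> sphere 0 1"
    by (subst AE_distr_iff[OF m]) auto
  then have "emeasure ?D (sphere 0 1) = 1"
    by (intro D.emeasure_eq_1_AE) auto
  then have "emeasure sphere_measure (space (sphere_measure :: 'a measure)) = 1"
    unfolding space_sphere_measure sphere_measure_def
    by (subst emeasure_restrict_space) auto
  then show ?thesis by (rule prob_spaceI)
qed

definition stiefel :: "(real^'m^'p) set" where
  "stiefel = {v. transpose v ** v = mat 1}"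

text \<open>The invariant probability measure on the Stiefel manifold, given by its characterising
  properties (they determine it uniquely, since the left action is transitive).\<close>

definition stiefel_invariant_prob :: "(real^'m^'p) measure \<Rightarrow> bool" where
  "stiefel_invariant_prob \<mu> \<longleftrightarrow>
     prob_space \<mu> \<and>
     space \<mu> = stiefel \<and> sets \<mu> = sets (restrict_space borel stiefel) \<and>
     (\<forall>g :: real^'p^'p. orthogonal_matrix g \<longrightarrow> distr \<mu> \<mu> (\<lambda>v. g ** v) = \<mu>) \<and>
     (\<forall>h :: real^'m^'m. orthogonal_matrix h \<longrightarrow> distr \<mu> \<mu> (\<lambda>v. v ** h) = \<mu>)"


section \<open>Orthonormal families in real \<open>L\<^sup>2\<close> spaces\<close>

definition square_integrable :: "'a measure \<Rightarrow> ('a \<Rightarrow> real) \<Rightarrow> bool" where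
  "square_integrable M f \<longleftrightarrow> f \<in> borel_measurable M \<and> integrable M (\<lambda>x. (f x)\<^sup>2)"

definition orthonormal_family :: "'a measure \<Rightarrow> 'i set \<Rightarrow> ('i \<Rightarrow> 'a \<Rightarrow> real) \<Rightarrow> bool" where
  "orthonormal_family M I e \<longleftrightarrow>
     (\<forall>i\<in>I. square_integrable M (e i)) \<and>
     (\<forall>i\<in>I. \<forall>i'\<in>I. (\<integral>x. e i x * e i' x \<partial>M) = (if i = i' then 1 else 0))"

definition orthonormal_basis :: "'a measure \<Rightarrow> 'i set \<Rightarrow> ('i \<Rightarrow> 'a \<Rightarrow> real) \<Rightarrow> bool" where
  "orthonormal_basis M I e \<longleftrightarrow>
     orthonormal_family M I e \<and>
     (\<forall>f. square_integrable M f \<longrightarrow>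
        (\<forall>\<epsilon>>0. \<exists>F c. finite F \<and> F \<subseteq> I \<and> (\<integral>x. (f x - (\<Sum>i\<in>F. c i * e i x))\<^sup>2 \<partial>M) < \<epsilon>))"


section \<open>Spherical harmonics\<close>

definition laplacian :: "('a::euclidean_space \<Rightarrow> real) \<Rightarrow> 'a \<Rightarrow> real" where
  "laplacian f x = (\<Sum>b\<in>Basis. (deriv ^^ 2) (\<lambda>t. f (x + t *\<^sub>R b)) 0)"

text \<open>Only the values of \<open>Y\<close> on the unit sphere matter.\<close>

definition spherical_harmonic :: "nat \<Rightarrow> ('a::euclidean_space \<Rightarrow> real) \<Rightarrow> bool" where
  "spherical_harmonic j Y \<longleftrightarrow>
     (\<exists>p. real_polynomial_function p \<and>
          (\<forall>c x. p (c *\<^sub>R x) = c ^ j * p x) \<and>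
          (\<forall>x. laplacian p x = 0) \<and>
          (\<forall>x\<in>sphere 0 1. Y x = p x))"

text \<open>The dimension \<open>d\<^sub>n(j)\<close> of the space of spherical harmonics of degree \<open>j\<close> on \<open>S\<^sup>n\<close>
  (an integer when \<open>n \<ge> 2\<close>), by its closed formula.\<close>

definition harm_dim :: "nat \<Rightarrow> nat \<Rightarrow> real" where
  "harm_dim n j =
     (real n + 2 * real j - 1) * (Gamma (real n + real j - 1) / (Gamma (real j + 1) * Gamma (real n)))"

definition harm_index :: "nat \<Rightarrow> (nat \<times> nat) set" where
  "harm_index n = {(j, l). 1 \<le> l \<and> real l \<le> harm_dim n j}"


section \<open>Jacobi polynomials and constants\<close>

text \<open>Szego's explicit form of \<open>P\<^sub>m\<close> with parameters \<open>\<alpha>, \<beta>\<close>; it is Rodrigues' formula expanded by the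
  Leibniz rule. In particular \<open>P\<^sub>m(1) = (m + \<alpha> gchoose m)\<close>.\<close>

definition jacobi_poly :: "real \<Rightarrow> real \<Rightarrow> nat \<Rightarrow> real \<Rightarrow> real" where
  "jacobi_poly \<alpha> \<beta> m t =
     (\<Sum>s\<le>m. ((real m + \<alpha>) gchoose (m - s)) * ((real m + \<beta>) gchoose s)
              * ((t - 1) / 2) ^ s * ((t + 1) / 2) ^ (m - s))"

definition jacobi_normalized :: "real \<Rightarrow> real \<Rightarrow> nat \<Rightarrow> real \<Rightarrow> real" where
  "jacobi_normalized \<alpha> \<beta> m t = jacobi_poly \<alpha> \<beta> m t / jacobi_poly \<alpha> \<beta> m 1"

definition sphere_area :: "nat \<Rightarrow> real" where
  "sphere_area m = 2 * pi powr ((real m + 1) / 2) / Gamma ((real m + 1) / 2)"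

definition varkappa :: "nat \<Rightarrow> nat \<Rightarrow> nat \<Rightarrow> real" where
  "varkappa n k j = sqrt (
     (sphere_area n * (2 * real j + real n - 1)
        * Gamma ((real j + real k + 1) / 2) * Gamma ((real j + real n - 1) / 2))
     / (sphere_area (n - k - 1) * sphere_area k * (Gamma ((real k + 1) / 2))\<^sup>2
        * Gamma (real j / 2 + 1) * Gamma ((real j + real n - real k) / 2)))"

text \<open>Meaningful for even \<open>j\<close> only: the Jacobi degree is \<open>j div 2\<close>.\<close>

definition Y_hat :: "nat \<Rightarrow> nat \<Rightarrow> nat \<Rightarrow> (real^'p \<Rightarrow> real) \<Rightarrow> real^'m^'p \<Rightarrow> real" where
  "Y_hat n k j Y v =
     varkappa n k j * sqrt (harm_dim n j) *
     (\<integral>x. Y x * jacobi_normalized ((real k - 1) / 2) ((real n - real k) / 2 - 1) (j div 2)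
                  (2 * (norm (x v* v))\<^sup>2 - 1) \<partial>sphere_measure)"

end

theory Submission
  imports Defs
begin

text \<open>
  Write \<open>K(x,v)\<close> for the normalized Jacobi polynomial of degree \<open>j/2\<close> in \<open>2|x\<^sup>T v|\<^sup>2 - 1\<close>. The proof rests on two facts.

  \<^item> For fixed \<open>v\<close>, the function \<open>x \<mapsto> K(x,v)\<close> is a spherical harmonic of degree \<open>j\<close>. Indeed Szego's
    formula homogenizes to \<open>\<Sum> c\<^sub>s p\<^sup>i\<^sup>-\<^sup>s (-q)\<^sup>s\<close>, where \<open>i = j/2\<close> and \<open>p\<close> and \<open>q\<close> are the squared lengths of the
    projections of \<open>x\<close> to the column space of \<open>v\<close> and to its orthogonal complement, and the recurrence of the \<open>c\<^sub>s\<close> makes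
    this polynomial harmonic (\<open>laplacian_jacobi_harmonic\<close>).

  \<^item> A zonal harmonic of even degree that vanishes at its pole is zero (\<open>zonal_harmonic_eq_0\<close>). Hence a
    rotation invariant kernel that is a harmonic in \<open>x\<close> is a multiple of the reproducing kernel
    (\<open>invariant_kernel_coefficients\<close>); this is Schur's lemma without representation theory.

  Consequently \<open>K(x,v) = \<Sum> a\<^sub>\<lambda>(v) Y\<^sub>\<lambda>(x)\<close>, where \<open>a\<^sub>\<lambda>\<close> is the transform of \<open>Y\<^sub>\<lambda>\<close> up to a constant. The inner products
  of the transforms are therefore the coefficients of the kernel \<open>\<integral> K(x,v) K'(y,v) dv\<close>, which is invariant because
  the measure on the Stiefel manifold is. So they form a scalar matrix in equal degrees and vanish in different degrees
  (\<open>transform_inner_products\<close>). The scalar is the trace divided by the dimension, and the trace is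
  \<open>\<integral> K(x,v)\<^sup>2 dx\<close>, which does not depend on \<open>v\<close>. That norm of a Jacobi polynomial is computed
  in \<open>integral_jacobi_harmonic_square\<close>, and \<open>varkappa_square\<close> compares it with the given constant.

  All integrals over the sphere are found without coordinates. Invariance under the rotations in the coordinate
  planes, differentiated at the identity, gives integration by parts, hence Green's identities
  (\<open>integral_sphere_second_green\<close>). These yield the orthogonality of harmonics of different degrees, the
  moments of \<open>p\<close> and \<open>q\<close> by recursion, and with them the norm.
\<close>

section \<open>Partial derivatives of polynomial functions\<close>

text \<open>Directional derivative of \<open>f\<close> along \<open>b\<close>; for a basis vector \<open>b\<close> this is the partial
  derivative. Names with the prefix \<open>rpf\<close> are closure properties of real polynomial functions.\<close>

definition pd :: "'a::euclidean_space \<Rightarrow> ('a \<Rightarrow> real) \<Rightarrow> 'a \<Rightarrow> real" where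
  "pd b f x = deriv (\<lambda>t. f (x + t *\<^sub>R b)) 0"

lemma pd_eqI: "((\<lambda>t. f (x + t *\<^sub>R b)) has_real_derivative D) (at 0) \<Longrightarrow> pd b f x = D"
  unfolding pd_def by (rule DERIV_imp_deriv)

lemmas rpf_linear = real_polynomial_function.intros(1)
  and rpf_const = real_polynomial_function.intros(2)
  and rpf_add = real_polynomial_function.intros(3)
  and rpf_mult = real_polynomial_function.intros(4)

lemma rpf_inner [intro]: "real_polynomial_function (\<lambda>x::'a::euclidean_space. x \<bullet> c)"
  by (intro rpf_linear bounded_linear_inner_left)

text \<open>Polynomial functions are differentiable, so the derivative is the linear map determined by its
  values on the basis. All product, sum and chain rules below are read off from one-dimensional
  derivatives along lines.\<close>

lemma rpf_has_frechet:
  fixes f :: "'a::euclidean_space \<Rightarrow> real"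
  assumes "real_polynomial_function f"
  shows "(f has_derivative (\<lambda>h. \<Sum>b\<in>Basis. (h \<bullet> b) * pd b f x)) (at x)"
proof -
  obtain D where D: "(f has_derivative D) (at x)"
    using differentiable_at_real_polynomial_function[OF assms] unfolding differentiable_def by blast
  have lin: "linear D" using has_derivative_linear[OF D] .
  have "pd b f x = D b" for b
  proof (rule pd_eqI)
    have "((\<lambda>t. x + t *\<^sub>R b) has_derivative (\<lambda>t. t *\<^sub>R b)) (at 0)"
      by (auto intro!: derivative_eq_intros)
    moreover have "(f has_derivative D) (at (x + 0 *\<^sub>R b))" using D by simp
    ultimately have "((\<lambda>t. f (x + t *\<^sub>R b)) has_derivative (\<lambda>t. D (t *\<^sub>R b))) (at 0)"
      by (rule has_derivative_compose)
    then show "((\<lambda>t. f (x + t *\<^sub>R b)) has_real_derivative D b) (at 0)"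
      by (simp add: has_field_derivative_def linear_scale[OF lin] mult.commute[of _ "D b"])
  qed
  moreover have "D h = (\<Sum>b\<in>Basis. (h \<bullet> b) * D b)" for h
    by (subst euclidean_representation[of h, symmetric])
      (simp only: linear_sum[OF lin] linear_scale[OF lin] real_scaleR_def)
  ultimately show ?thesis using D by (metis (no_types, lifting) has_derivative_eq_rhs ext)
qed

lemma rpf_has_line_derivative:
  fixes f :: "'a::euclidean_space \<Rightarrow> real"
  assumes "real_polynomial_function f" "(g has_vector_derivative g') (at t within S)"
  shows "((\<lambda>t. f (g t)) has_real_derivative (\<Sum>b\<in>Basis. (g' \<bullet> b) * pd b f (g t))) (at t within S)"
proof -
  have "((\<lambda>t. f (g t)) has_derivative (\<lambda>s. \<Sum>b\<in>Basis. ((s *\<^sub>R g') \<bullet> b) * pd b f (g t))) (at t within S)"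
    using has_derivative_compose[OF assms(2)[unfolded has_vector_derivative_def] rpf_has_frechet[OF assms(1)]] .
  then show ?thesis
    by (rule has_derivative_imp_has_field_derivative) (simp add: sum_distrib_left mult_ac)
qed

lemma pd_has_derivative:
  fixes f :: "'a::euclidean_space \<Rightarrow> real"
  assumes "real_polynomial_function f"
  shows "((\<lambda>t. f (x + t *\<^sub>R b)) has_real_derivative pd b f (x + t *\<^sub>R b)) (at t)"
proof -
  have "((\<lambda>t. x + t *\<^sub>R b) has_vector_derivative b) (at s)" for s
    by (auto intro!: derivative_eq_intros)
  note * = rpf_has_line_derivative[OF assms this]
  have "pd b f (x + t *\<^sub>R b) = (\<Sum>c\<in>Basis. (b \<bullet> c) * pd c f (x + t *\<^sub>R b))"
  proof (rule pd_eqI)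
    have "((\<lambda>s. (x + t *\<^sub>R b) + s *\<^sub>R b) has_vector_derivative b) (at 0)"
      by (auto intro!: derivative_eq_intros)
    from rpf_has_line_derivative[OF assms this]
    show "((\<lambda>s. f (x + t *\<^sub>R b + s *\<^sub>R b)) has_real_derivative
        (\<Sum>c\<in>Basis. (b \<bullet> c) * pd c f (x + t *\<^sub>R b))) (at 0)" by simp
  qed
  with * show ?thesis by simp
qed

lemma pd_const [simp]: "pd b (\<lambda>x. c) = (\<lambda>x. 0)"
  by (auto simp: pd_def fun_eq_iff)

lemma pd_bounded_linear: "bounded_linear f \<Longrightarrow> pd b f = (\<lambda>x. f b)"
  by (rule ext, rule pd_eqI)
     (auto intro!: derivative_eq_intros simp: linear_add linear_scale bounded_linear.linear)

lemma pd_inner [simp]: "pd b (\<lambda>x. x \<bullet> c) = (\<lambda>x. b \<bullet> c)"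
  by (rule pd_bounded_linear, rule bounded_linear_inner_left)

lemma pd_add:
  assumes "real_polynomial_function f" "real_polynomial_function g"
  shows "pd b (\<lambda>x. f x + g x) = (\<lambda>x. pd b f x + pd b g x)"
  by (rule ext, rule pd_eqI)
     (use pd_has_derivative[OF assms(1), of _ b 0] pd_has_derivative[OF assms(2), of _ b 0] in
       \<open>auto intro!: derivative_eq_intros\<close>)

lemma pd_mult:
  assumes "real_polynomial_function f" "real_polynomial_function g"
  shows "pd b (\<lambda>x. f x * g x) = (\<lambda>x. pd b f x * g x + f x * pd b g x)"
  by (rule ext, rule pd_eqI)
     (use pd_has_derivative[OF assms(1), of _ b 0] pd_has_derivative[OF assms(2), of _ b 0] in
       \<open>auto intro!: derivative_eq_intros\<close>)

lemma pd_cmult: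
  assumes "real_polynomial_function f"
  shows "pd b (\<lambda>x. c * f x) = (\<lambda>x. c * pd b f x)"
  by (subst pd_mult) (use assms in auto)

lemma pd_sum:
  assumes "\<And>i. i \<in> I \<Longrightarrow> real_polynomial_function (f i)"
  shows "pd b (\<lambda>x. \<Sum>i\<in>I. f i x) = (\<lambda>x. \<Sum>i\<in>I. pd b (f i) x)"
proof (cases "finite I")
  case True
  then show ?thesis using assms
    by (induction I) (simp_all add: pd_add real_polynomial_function_sum)
qed simp

lemma pd_power:
  assumes "real_polynomial_function f"
  shows "pd b (\<lambda>x. f x ^ n) = (\<lambda>x. real n * f x ^ (n - 1) * pd b f x)"
  by (rule ext, rule pd_eqI)
     (use pd_has_derivative[OF assms(1), of _ b 0] in \<open>auto intro!: derivative_eq_intros\<close>)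

lemma rpf_pd [intro]:
  assumes "real_polynomial_function f"
  shows "real_polynomial_function (pd b f)"
  using assms
proof induction
  case (linear f)
  then show ?case by (simp add: pd_bounded_linear rpf_const)
next
  case (const c)
  then show ?case by (simp add: rpf_const)
next
  case (add f g)
  then show ?case by (simp add: pd_add rpf_add)
next
  case (mult f g)
  then show ?case by (simp add: pd_mult rpf_add rpf_mult)
qed

lemma laplacian_eq_sum_pd:
  assumes "real_polynomial_function f"
  shows "laplacian f x = (\<Sum>b\<in>Basis. pd b (pd b f) x)"
proof -
  have "(deriv ^^ 2) (\<lambda>t. f (x + t *\<^sub>R b)) 0 = pd b (pd b f) x" for b
  proof -
    have "deriv (\<lambda>t. f (x + t *\<^sub>R b)) = (\<lambda>t. pd b f (x + t *\<^sub>R b))"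
      by (rule ext, rule DERIV_imp_deriv, rule pd_has_derivative[OF assms])
    then show ?thesis
      by (simp add: numeral_2_eq_2 pd_def)
  qed
  then show ?thesis unfolding laplacian_def by simp
qed

lemma rpf_laplacian [intro]:
  "real_polynomial_function f \<Longrightarrow> real_polynomial_function (laplacian f)"
  by (subst laplacian_eq_sum_pd[THEN ext]) (auto intro!: real_polynomial_function_sum)

lemma laplacian_sum:
  assumes "finite I" "\<And>i. i \<in> I \<Longrightarrow> real_polynomial_function (f i)"
  shows "laplacian (\<lambda>x. \<Sum>i\<in>I. c i * f i x) x = (\<Sum>i\<in>I. c i * laplacian (f i) x)"
proof -
  have "laplacian (\<lambda>x. \<Sum>i\<in>I. c i * f i x) x = (\<Sum>b\<in>Basis. \<Sum>i\<in>I. c i * pd b (pd b (f i)) x)"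
    using assms
    by (subst laplacian_eq_sum_pd)
      (auto intro!: real_polynomial_function_sum sum.cong rpf_mult
        simp: pd_sum pd_cmult rpf_const rpf_mult rpf_pd)
  also have "\<dots> = (\<Sum>i\<in>I. c i * laplacian (f i) x)"
    by (subst sum.swap) (auto intro!: sum.cong simp: assms laplacian_eq_sum_pd sum_distrib_left)
  finally show ?thesis .
qed

lemma rpf_linear_comp:
  assumes "real_polynomial_function (f :: 'b::euclidean_space \<Rightarrow> real)" "linear (g :: 'a::euclidean_space \<Rightarrow> 'b)"
  shows "real_polynomial_function (\<lambda>x. f (g x))"
  using real_polynomial_function_compose[OF polynomial_function_bounded_linear assms(1), of g] assms(2)
  by (simp add: o_def linear_linear)

lemma pd_linear_comp:
  fixes g :: "'a::euclidean_space \<Rightarrow> 'a"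
  assumes "real_polynomial_function f" "linear g"
  shows "pd b (\<lambda>x. f (g x)) = (\<lambda>x. \<Sum>c\<in>Basis. (g b \<bullet> c) * pd c f (g x))"
proof (rule ext, rule pd_eqI)
  fix x
  have "((\<lambda>t. g (x + t *\<^sub>R b)) has_vector_derivative g b) (at 0)"
    by (auto intro!: derivative_eq_intros simp: linear_add[OF assms(2)] linear_scale[OF assms(2)])
  from rpf_has_line_derivative[OF assms(1) this]
  show "((\<lambda>t. f (g (x + t *\<^sub>R b))) has_real_derivative (\<Sum>c\<in>Basis. (g b \<bullet> c) * pd c f (g x))) (at 0)"
    by simp
qed

text \<open>Twice the chain rule gives the Hessian contracted with \<open>g\<close> and its adjoint; orthogonality of \<open>g\<close>
  turns the contraction into the trace. This makes the space of harmonics rotation invariant.\<close>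

lemma laplacian_orthogonal_comp:
  fixes g :: "'a::euclidean_space \<Rightarrow> 'a"
  assumes f: "real_polynomial_function f" and g: "orthogonal_transformation g"
  shows "laplacian (\<lambda>x. f (g x)) x = laplacian f (g x)"
proof -
  have lin: "linear g" using g by (simp add: orthogonal_transformation_linear)
  note [intro] = rpf_linear_comp[OF _ lin]
  define h where "h = inv g"
  have h: "orthogonal_transformation h" and gh: "g (h y) = y" for y
    unfolding h_def using g by (auto simp: orthogonal_transformation_inv orthogonal_transformation_surj surj_f_inv_f)
  have adj: "g b \<bullet> c = b \<bullet> h c" for b c
    using g gh[of c] unfolding orthogonal_transformation_def by metis
  have "laplacian (\<lambda>x. f (g x)) x =
    (\<Sum>b\<in>Basis. \<Sum>c\<in>Basis. \<Sum>d\<in>Basis. (g b \<bullet> c) * (g b \<bullet> d) * pd d (pd c f) (g x))"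
  proof (subst laplacian_eq_sum_pd)
    show "real_polynomial_function (\<lambda>x. f (g x))" using f by auto
    show "(\<Sum>b\<in>Basis. pd b (pd b (\<lambda>x. f (g x))) x) = (\<Sum>b\<in>Basis. \<Sum>c\<in>Basis. \<Sum>d\<in>Basis. (g b \<bullet> c) * (g b \<bullet> d) * pd d (pd c f) (g x))"
    proof (intro sum.cong refl)
      fix b :: 'a
      have "pd b (pd b (\<lambda>x. f (g x))) x = (\<Sum>c\<in>Basis. (g b \<bullet> c) * pd b (\<lambda>x. pd c f (g x)) x)"
        using f by (simp add: pd_linear_comp[OF f lin])
          (subst pd_sum, auto simp: pd_cmult rpf_pd rpf_linear_comp[OF _ lin] intro!: rpf_mult)
      then show "pd b (pd b (\<lambda>x. f (g x))) x = (\<Sum>c\<in>Basis. \<Sum>d\<in>Basis. (g b \<bullet> c) * (g b \<bullet> d) * pd d (pd c f) (g x))"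
        using f by (simp add: pd_linear_comp[OF _ lin] rpf_pd sum_distrib_left mult.assoc)
    qed
  qed
  also have "\<dots> = (\<Sum>c\<in>Basis. \<Sum>d\<in>Basis. \<Sum>b\<in>Basis. (g b \<bullet> c) * (g b \<bullet> d) * pd d (pd c f) (g x))"
    by (subst sum.swap) (intro sum.cong refl sum.swap)
  also have "\<dots> = (\<Sum>c\<in>Basis. \<Sum>d\<in>Basis. (c \<bullet> d) * pd d (pd c f) (g x))"
  proof (intro sum.cong refl)
    fix c d :: 'a
    have "(\<Sum>b\<in>Basis. (g b \<bullet> c) * (g b \<bullet> d)) = h c \<bullet> h d"
      unfolding adj by (subst euclidean_inner[of "h c"]) (simp add: inner_commute)
    also have "\<dots> = c \<bullet> d" using h by (simp add: orthogonal_transformation_def)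
    finally show "(\<Sum>b\<in>Basis. (g b \<bullet> c) * (g b \<bullet> d) * pd d (pd c f) (g x)) = (c \<bullet> d) * pd d (pd c f) (g x)"
      by (simp add: sum_distrib_right[symmetric])
  qed
  also have "\<dots> = (\<Sum>c\<in>Basis. \<Sum>d\<in>Basis. (if d = c then pd d (pd c f) (g x) else 0))"
    by (intro sum.cong refl) (auto simp: inner_Basis)
  also have "\<dots> = laplacian f (g x)"
    by (simp add: laplacian_eq_sum_pd[OF f])
  finally show ?thesis .
qed

text \<open>Homogeneity under positive dilations only: this is what Euler's relation needs, and
  it is inherited by partial derivatives without a case distinction at \<open>c = 0\<close>.\<close>

definition homog :: "nat \<Rightarrow> ('a::real_vector \<Rightarrow> real) \<Rightarrow> bool" where
  "homog d f \<longleftrightarrow> (\<forall>c>0. \<forall>x. f (c *\<^sub>R x) = c ^ d * f x)"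

definition euler :: "('a::euclidean_space \<Rightarrow> real) \<Rightarrow> 'a \<Rightarrow> real" where
  "euler f x = (\<Sum>b\<in>Basis. (x \<bullet> b) * pd b f x)"

lemma euler_eqI:
  fixes f :: "'a::euclidean_space \<Rightarrow> real"
  assumes "real_polynomial_function f" "((\<lambda>t. f (t *\<^sub>R x)) has_real_derivative D) (at 1)"
  shows "euler f x = D"
proof -
  have "((\<lambda>t. t *\<^sub>R x) has_vector_derivative x) (at 1)"
    by (auto intro!: derivative_eq_intros)
  from rpf_has_line_derivative[OF assms(1) this] assms(2)
  show ?thesis unfolding euler_def by (auto dest: DERIV_unique)
qed

lemma euler_homog:
  fixes f :: "'a::euclidean_space \<Rightarrow> real"
  assumes "real_polynomial_function f" "homog d f"
  shows "euler f x = d * f x"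
proof (rule euler_eqI[OF assms(1)])
  have "((\<lambda>t. t ^ d * f x) has_real_derivative d * f x) (at 1)"
    by (auto intro!: derivative_eq_intros)
  then show "((\<lambda>t. f (t *\<^sub>R x)) has_real_derivative d * f x) (at 1)"
    by (rule has_field_derivative_transform_within[where d = 1])
      (use assms(2) in \<open>auto simp: homog_def dist_real_def\<close>)
qed

lemma homog_pd:
  fixes f :: "'a::euclidean_space \<Rightarrow> real"
  assumes "real_polynomial_function f" "homog d f" "c > 0"
  shows "c * pd b f (c *\<^sub>R x) = c ^ d * pd b f x"
proof -
  have "((\<lambda>t. f (c *\<^sub>R x + (c * t) *\<^sub>R b)) has_real_derivative c * pd b f (c *\<^sub>R x)) (at 0)"
  proof -
    have "((\<lambda>t. c * t) has_real_derivative c) (at 0)"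
      by (auto intro!: derivative_eq_intros)
    from DERIV_chain2[where f = "\<lambda>s. f (c *\<^sub>R x + s *\<^sub>R b)", OF pd_has_derivative[OF assms(1)] this]
    show ?thesis by (simp add: mult.commute)
  qed
  moreover have "f (c *\<^sub>R x + (c * t) *\<^sub>R b) = c ^ d * f (x + t *\<^sub>R b)" for t
    using assms(2,3) by (simp add: homog_def scaleR_add_right[symmetric] flip: scaleR_scaleR)
  ultimately have "((\<lambda>t. c ^ d * f (x + t *\<^sub>R b)) has_real_derivative c * pd b f (c *\<^sub>R x)) (at 0)"
    by simp
  moreover have "((\<lambda>t. c ^ d * f (x + t *\<^sub>R b)) has_real_derivative c ^ d * pd b f x) (at 0)"
    using pd_has_derivative[OF assms(1), of x b 0] by (auto intro!: derivative_eq_intros)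
  ultimately show ?thesis by (rule DERIV_unique)
qed

text \<open>A partial derivative of a homogeneous function of degree \<open>d\<close> is homogeneous of degree \<open>d - 1\<close>; stated
  through the Euler operator with a real \<open>d - 1\<close>, the degree \<open>d = 0\<close> needs no exception.\<close>

lemma euler_pd:
  fixes f :: "'a::euclidean_space \<Rightarrow> real"
  assumes "real_polynomial_function f" "homog d f"
  shows "euler (pd b f) x = (real d - 1) * pd b f x"
proof (rule euler_eqI)
  have "((\<lambda>t. t ^ d / t * pd b f x) has_real_derivative (real d - 1) * pd b f x) (at 1)"
    by (auto intro!: derivative_eq_intros simp: algebra_simps)
  then show "((\<lambda>t. pd b f (t *\<^sub>R x)) has_real_derivative (real d - 1) * pd b f x) (at 1)"
  proof (rule has_field_derivative_transform_within[where d = 1])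
    fix t :: real assume "dist t 1 < 1"
    then have "t > 0" by (auto simp: dist_real_def)
    then show "t ^ d / t * pd b f x = pd b f (t *\<^sub>R x)"
      using homog_pd[OF assms, of t b x] by (simp add: field_simps)
  qed auto
qed (use assms in auto)

lemma euler_mult:
  assumes "real_polynomial_function f" "real_polynomial_function g"
  shows "euler (\<lambda>x. f x * g x) x = euler f x * g x + f x * euler g x"
  unfolding euler_def pd_mult[OF assms]
  by (simp add: algebra_simps sum.distrib sum_distrib_left)

section \<open>Integration over the sphere\<close>

text \<open>By Vitali's covering theorem an open set is, up to a null set, a disjoint union of balls, and the
  preimage of a ball under an orthogonal map is a ball of the same radius. Comparing volumes gives one
  inequality; applying it to the inverse map gives equality.\<close>

lemma emeasure_open_le_orthogonal_vimage:
  fixes h :: "'a::euclidean_space \<Rightarrow> 'a"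
  assumes h: "orthogonal_transformation h" and B: "open B"
  shows "emeasure lborel B \<le> emeasure lborel (h -` B)"
proof -
  define g where "g = inv h"
  have hg: "h (g y) = y" for y
    unfolding g_def using h by (simp add: orthogonal_transformation_surj surj_f_inv_f)
  have lin: "linear h" using h by (simp add: orthogonal_transformation_linear)
  have conth: "continuous_on UNIV h"
    using lin by (simp add: linear_continuous_on linear_linear)
  have vim: "h -` ball c r = ball (g c) r" for c r
  proof -
    have "dist c (h x) = dist (g c) x" for x
      using orthogonal_transformation_norm[OF h, of "g c - x"]
      by (simp add: dist_norm linear_diff[OF lin] hg)
    then show ?thesis by auto
  qed
  have eqb: "emeasure lborel (h -` ball c r) = emeasure lborel (ball c r)" for c r
  proof (cases "r \<ge> 0")
    case True then show ?thesis by (simp add: vim emeasure_ball)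
  next
    case False then show ?thesis by (simp add: ball_empty)
  qed
  \<comment> \<open>Centres and radii of the balls inside B, from which Vitali's theorem selects a disjoint family.\<close>
  define K where "K = {p :: 'a \<times> real. snd p > 0 \<and> ball (fst p) (snd p) \<subseteq> B}"
  have *: "\<exists>i. i \<in> K \<and> x \<in> ball (fst i) (snd i) \<and> snd i < d" if "x \<in> B" "0 < d" for x d
  proof -
    obtain e where e: "e > 0" "ball x e \<subseteq> B" using B \<open>x \<in> B\<close> open_contains_ball by blast
    have "(x, min (d/2) e) \<in> K" using e \<open>0 < d\<close> unfolding K_def by auto
    moreover have "x \<in> ball x (min (d/2) e)" using e that by simp
    moreover have "min (d/2) e < d" using that by linarith
    ultimately show ?thesis by (intro exI[of _ "(x, min (d/2) e)"]) auto
  qed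
  obtain C where C: "countable C" "C \<subseteq> K"
     "pairwise (\<lambda>i j. disjnt (ball (fst i) (snd i)) (ball (fst j) (snd j))) C"
     "negligible (B - (\<Union>i\<in>C. ball (fst i) (snd i)))"
    by (rule Vitali_covering_theorem_balls[of B K fst snd, OF *])
  let ?U = "\<Union>i\<in>C. ball (fst i) (snd i)"
  have disj: "disjoint_family_on (\<lambda>i. ball (fst i) (snd i)) C"
    using C(3) by (auto simp: disjoint_family_on_def pairwise_def disjnt_def)
  have [measurable]: "B \<in> sets borel" "?U \<in> sets borel"
    using B by (auto intro!: borel_open)
  have "emeasure lborel B \<le> emeasure lborel (?U \<union> (B - ?U))"
    by (intro emeasure_mono) auto
  also have "\<dots> \<le> emeasure lborel ?U + emeasure lborel (B - ?U)"
    by (intro emeasure_subadditive) auto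
  also have "emeasure lborel (B - ?U) = 0"
  proof -
    have "B - ?U \<in> sets borel" by measurable
    then show ?thesis using C(4) by (simp add: negligible_iff_null_sets null_sets_def emeasure_completion)
  qed
  also have "emeasure lborel ?U = (\<integral>\<^sup>+i. emeasure lborel (ball (fst i) (snd i)) \<partial>count_space C)"
    using disj C(1) by (intro emeasure_UN_countable) auto
  also have "\<dots> = (\<integral>\<^sup>+i. emeasure lborel (h -` ball (fst i) (snd i)) \<partial>count_space C)"
    by (simp add: eqb)
  also have "\<dots> = emeasure lborel (\<Union>i\<in>C. h -` ball (fst i) (snd i))"
  proof (intro emeasure_UN_countable[symmetric])
    show "disjoint_family_on (\<lambda>i. h -` ball (fst i) (snd i)) C"
      using disj unfolding disjoint_family_on_def vimage_Int[symmetric] by simp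
  qed (use C(1) in \<open>auto simp: vim\<close>)
  also have "\<dots> \<le> emeasure lborel (h -` B)"
    using C(2) B conth by (intro emeasure_mono) (auto simp: K_def open_vimage)
  finally show ?thesis by simp
qed

lemma distr_lborel_orthogonal:
  fixes h :: "'a::euclidean_space \<Rightarrow> 'a"
  assumes h: "orthogonal_transformation h"
  shows "distr lborel borel h = lborel"
proof (rule lborel_eqI[symmetric])
  have lin: "linear h" using h by (simp add: orthogonal_transformation_linear)
  have conth: "continuous_on UNIV h"
    using lin by (simp add: linear_continuous_on linear_linear)
  then have [measurable]: "h \<in> borel_measurable borel" by (simp add: borel_measurable_continuous_onI)
  fix l u :: 'a assume lu: "\<And>b. b \<in> Basis \<Longrightarrow> l \<bullet> b \<le> u \<bullet> b"
  have "h (inv h x) = x" for x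
    using h by (simp add: orthogonal_transformation_surj surj_f_inv_f)
  then have "inv h -` (h -` box l u) = box l u" by auto
  then have "emeasure lborel (h -` box l u) \<le> emeasure lborel (box l u)"
    using emeasure_open_le_orthogonal_vimage[OF orthogonal_transformation_inv[OF h], of "h -` box l u"]
      open_vimage[OF open_box conth] by simp
  then have "emeasure lborel (h -` box l u) = emeasure lborel (box l u)"
    using emeasure_open_le_orthogonal_vimage[OF h, of "box l u"] by (intro antisym) auto
  then show "emeasure (distr lborel borel h) (box l u) = (\<Prod>b\<in>Basis. (u - l) \<bullet> b)"
    using lu by (subst emeasure_distr) simp_all
qed simp

lemma integrable_sphere_measure:
  fixes f :: "'a::euclidean_space \<Rightarrow> real"
  assumes "continuous_on UNIV f"
  shows "integrable sphere_measure f"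
proof -
  interpret prob_space "sphere_measure :: 'a measure" by (rule prob_space_sphere_measure)
  have "bounded (f ` sphere 0 1)"
    by (intro compact_imp_bounded compact_continuous_image continuous_on_subset[OF assms]) auto
  then obtain C where C: "\<forall>x\<in>sphere 0 1. \<bar>f x\<bar> \<le> C"
    by (auto simp: bounded_iff)
  show ?thesis
  proof (rule integrable_const_bound[of _ C])
    have "f \<in> borel_measurable borel" using assms by (rule borel_measurable_continuous_onI)
    then show "f \<in> borel_measurable sphere_measure"
      by (subst measurable_cong_sets[OF sets_sphere_measure refl]) (rule measurable_restrict_space1)
    show "AE x in sphere_measure. norm (f x) \<le> C"
      by (rule AE_I2) (use C in simp)
  qed
qed

lemma integral_sphere_measure_eq_ball:
  fixes f :: "'a::euclidean_space \<Rightarrow> real"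
  assumes [measurable]: "f \<in> borel_measurable borel"
  shows "integral\<^sup>L sphere_measure f
    = (\<integral>x. indicator (sphere 0 1) (sgn x) * f (sgn x) \<partial>uniform_measure lborel (ball 0 1))"
proof -
  have m[measurable]: "sgn \<in> measurable (uniform_measure lborel (ball 0 1)) (borel :: 'a measure)"
    using borel_measurable_sgn_euclidean by simp
  have [measurable]: "sphere 0 1 \<in> sets (borel :: 'a measure)" by simp
  have "integral\<^sup>L sphere_measure f
    = (\<integral>x. indicator (sphere 0 1) x * f x \<partial>distr (uniform_measure lborel (ball 0 1)) borel sgn)"
    unfolding sphere_measure_def by (subst integral_restrict_space) auto
  also have "\<dots> = (\<integral>x. indicator (sphere 0 1) (sgn x) * f (sgn x) \<partial>uniform_measure lborel (ball 0 1))"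
    by (rule integral_distr[OF m]) measurable
  finally show ?thesis .
qed

lemma integral_sphere_measure_orthogonal:
  fixes f :: "'a::euclidean_space \<Rightarrow> real"
  assumes h: "orthogonal_transformation (h :: 'a \<Rightarrow> 'a)" and f[measurable]: "f \<in> borel_measurable borel"
  shows "(\<integral>x. f (h x) \<partial>sphere_measure) = (\<integral>x. f x \<partial>sphere_measure)"
proof -
  have lin: "linear h" using h by (simp add: orthogonal_transformation_linear)
  have [measurable]: "h \<in> borel_measurable borel"
    using lin by (simp add: borel_measurable_continuous_onI linear_continuous_on linear_linear)
  have [measurable]: "(sgn :: 'a \<Rightarrow> 'a) \<in> borel_measurable borel"
    by (rule borel_measurable_sgn_euclidean)
  have [measurable]: "sphere 0 1 \<in> sets (borel :: 'a measure)" by simp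
  let ?U = "uniform_measure lborel (ball 0 1) :: 'a measure"
  have U: "distr ?U borel h = ?U"
  proof (rule measure_eqI)
    fix A assume "A \<in> sets (distr ?U borel h)"
    then have A[measurable]: "A \<in> sets borel" by simp
    have *: "ball 0 1 \<inter> h -` A = h -` (ball 0 1 \<inter> A)"
      using orthogonal_transformation_norm[OF h] by auto
    have "emeasure lborel (h -` (ball 0 1 \<inter> A)) = emeasure (distr lborel borel h) (ball 0 1 \<inter> A)"
      by (subst emeasure_distr) auto
    then have "emeasure lborel (ball 0 1 \<inter> h -` A) = emeasure lborel (ball 0 1 \<inter> A)"
      by (simp add: * distr_lborel_orthogonal[OF h])
    moreover have "h -` A \<in> sets borel"
      using measurable_sets[of h borel borel A] by simp
    ultimately show "emeasure (distr ?U borel h) A = emeasure ?U A"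
      by (simp add: emeasure_distr)
  qed simp
  have hU: "h \<in> measurable ?U borel" by simp
  have sg: "sgn (h x) = h (sgn x)" for x
    by (simp add: sgn_div_norm orthogonal_transformation_norm[OF h] linear_scale[OF lin])
  have "(\<integral>x. f x \<partial>sphere_measure) = (\<integral>x. indicator (sphere 0 1) (sgn x) * f (sgn x) \<partial>distr ?U borel h)"
    by (simp add: U integral_sphere_measure_eq_ball)
  also have "\<dots> = (\<integral>x. indicator (sphere 0 1) (sgn (h x)) * f (sgn (h x)) \<partial>?U)"
    using hU by (rule integral_distr) measurable
  also have "\<dots> = (\<integral>x. indicator (sphere 0 1) (sgn x) * f (h (sgn x)) \<partial>?U)"
    by (intro Bochner_Integration.integral_cong refl)
      (simp only: sg indicator_def mem_sphere_0 orthogonal_transformation_norm[OF h])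
  also have "\<dots> = (\<integral>x. f (h x) \<partial>sphere_measure)"
  proof (rule integral_sphere_measure_eq_ball[symmetric])
    show "(\<lambda>x. f (h x)) \<in> borel_measurable borel" by measurable
  qed
  finally show ?thesis by simp
qed

text \<open>The sphere measure charges every open set: the cone over the set where \<open>f\<close> does not vanish is open,
  and it would be a Lebesgue null set.\<close>

lemma integral_square_sphere_eq_0D:
  fixes f :: "'a::euclidean_space \<Rightarrow> real"
  assumes f: "continuous_on UNIV f" and 0: "(\<integral>x. (f x)\<^sup>2 \<partial>sphere_measure) = 0" and y: "y \<in> sphere 0 1"
  shows "f y = 0"
proof (rule ccontr)
  assume "f y \<noteq> 0"
  let ?U = "uniform_measure lborel (ball 0 1) :: 'a measure"
  have [measurable]: "f \<in> borel_measurable borel" using f by (rule borel_measurable_continuous_onI)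
  have [measurable]: "(sgn :: 'a \<Rightarrow> 'a) \<in> borel_measurable borel"
    by (rule borel_measurable_sgn_euclidean)
  have int: "integrable sphere_measure (\<lambda>x. (f x)\<^sup>2)"
    by (intro integrable_sphere_measure continuous_intros f)
  have "AE x in sphere_measure. (f x)\<^sup>2 = 0"
    using 0 int by (subst (asm) integral_nonneg_eq_0_iff_AE) auto
  then have "AE x in distr ?U borel sgn. x \<in> sphere 0 1 \<longrightarrow> f x = 0"
    unfolding sphere_measure_def by (subst (asm) AE_restrict_space_iff) auto
  then have "AE x in ?U. sgn x \<in> sphere 0 1 \<longrightarrow> f (sgn x) = 0"
    by (subst (asm) AE_distr_iff) auto
  then have ae: "AE x in lborel. x \<in> ball 0 1 \<longrightarrow> sgn x \<in> sphere 0 1 \<longrightarrow> f (sgn x) = 0"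
    by (subst (asm) AE_uniform_measure)
      (auto simp: emeasure_ball unit_ball_vol_pos less_imp_neq[symmetric])
  let ?A = "{x \<in> ball 0 1 - {0}. f (sgn x) \<noteq> 0}"
  have cont: "continuous_on (ball 0 1 - {0}) (\<lambda>x::'a. f (sgn x))"
    unfolding sgn_div_norm
    by (intro continuous_on_compose2[OF f] continuous_intros) auto
  have "open ((\<lambda>x. f (sgn x)) -` (- {0}) \<inter> (ball 0 1 - {0}))"
    using continuous_on_open_vimage[of "ball 0 1 - {0}" "\<lambda>x::'a. f (sgn x)"] cont by blast
  moreover have "(\<lambda>x. f (sgn x)) -` (- {0}) \<inter> (ball 0 1 - {0}) = ?A" by auto
  ultimately have op: "open ?A" by simp
  have "negligible ?A"
  proof -
    have "AE x in lborel. x \<notin> ?A"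
      using ae by eventually_elim (auto simp: norm_sgn split: if_splits)
    then have "?A \<in> null_sets lborel"
      using op by (subst (asm) AE_iff_null_sets[symmetric]) auto
    then show ?thesis
      using negligible_iff_null_sets null_sets_completionI by blast
  qed
  moreover have "(1/2) *\<^sub>R y \<in> ?A"
    using y \<open>f y \<noteq> 0\<close> by (auto simp: sgn_scaleR sgn_div_norm)
  ultimately show False using open_not_negligible[OF op] by blast
qed

lemma continuous_on_rpf:
  fixes f :: "'a::euclidean_space \<Rightarrow> real"
  shows "real_polynomial_function f \<Longrightarrow> continuous_on S f"
  by (rule continuous_on_polymonial_function) (simp add: real_polynomial_function_eq)

lemma integrable_sphere_rpf [simp, intro]:
  "real_polynomial_function f \<Longrightarrow> integrable sphere_measure f"
  by (rule integrable_sphere_measure, rule continuous_on_rpf)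

section \<open>Green's identities on the sphere\<close>

text \<open>The rotation by the angle \<open>t\<close> in the coordinate plane spanned by the basis vectors \<open>a\<close> and \<open>b\<close>. The
  one-parameter groups of rotations are the source of all integration by parts on the sphere.\<close>

definition plane_rot :: "'a::euclidean_space \<Rightarrow> 'a \<Rightarrow> real \<Rightarrow> 'a \<Rightarrow> 'a" where
  "plane_rot a b t x = x + ((cos t - 1) * (x \<bullet> a) - sin t * (x \<bullet> b)) *\<^sub>R a
                         + ((cos t - 1) * (x \<bullet> b) + sin t * (x \<bullet> a)) *\<^sub>R b"

context
  fixes a b :: "'a::euclidean_space"
  assumes ab: "a \<in> Basis" "b \<in> Basis" "a \<noteq> b"
begin

lemma plane_inner: "a \<bullet> a = 1" "b \<bullet> b = 1" "a \<bullet> b = 0" "b \<bullet> a = 0"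
  using ab by (auto simp: inner_Basis)

lemma plane_rot_inner:
  "plane_rot a b t x \<bullet> a = cos t * (x \<bullet> a) - sin t * (x \<bullet> b)"
  "plane_rot a b t x \<bullet> b = cos t * (x \<bullet> b) + sin t * (x \<bullet> a)"
  by (simp_all add: plane_rot_def inner_add_left plane_inner left_diff_distrib)

lemma orthogonal_transformation_plane_rot: "orthogonal_transformation (plane_rot a b t)"
  unfolding orthogonal_transformation
proof (intro conjI allI)
  have "plane_rot a b t = (\<lambda>x. x + (x \<bullet> ((cos t - 1) *\<^sub>R a - sin t *\<^sub>R b)) *\<^sub>R a
      + (x \<bullet> ((cos t - 1) *\<^sub>R b + sin t *\<^sub>R a)) *\<^sub>R b)"
    by (simp add: plane_rot_def inner_diff_right inner_add_right fun_eq_iff)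
  moreover have "linear (\<lambda>x. x + (x \<bullet> u) *\<^sub>R a + (x \<bullet> w) *\<^sub>R b)" for u w :: 'a
    by (rule linearI) (simp_all add: inner_add_left scaleR_add_left scaleR_add_right)
  ultimately show "linear (plane_rot a b t)" by simp
  fix x
  have "(norm (plane_rot a b t x))\<^sup>2 = plane_rot a b t x \<bullet> plane_rot a b t x"
    by (simp add: power2_norm_eq_inner)
  also have "\<dots> = x \<bullet> x + ((sin t)\<^sup>2 + (cos t)\<^sup>2 - 1) * ((x \<bullet> a)\<^sup>2 + (x \<bullet> b)\<^sup>2)"
  proof -
    have *: "(x + u *\<^sub>R a + v *\<^sub>R b) \<bullet> (x + u *\<^sub>R a + v *\<^sub>R b)
      = x \<bullet> x + 2 * u * (x \<bullet> a) + 2 * v * (x \<bullet> b) + u\<^sup>2 + v\<^sup>2" for u v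
      by (simp add: inner_add_left inner_add_right plane_inner inner_commute[of a x] inner_commute[of b x]
        power2_eq_square distrib_left)
    have "2 * ((c - 1) * p - s * q) * p + 2 * ((c - 1) * q + s * p) * q + ((c - 1) * p - s * q)\<^sup>2
        + ((c - 1) * q + s * p)\<^sup>2 = (s\<^sup>2 + c\<^sup>2 - 1) * (p\<^sup>2 + q\<^sup>2)" for c s p q :: real
      by algebra
    from this[of "cos t" "x \<bullet> a" "sin t" "x \<bullet> b"] show ?thesis
      unfolding plane_rot_def * by linarith
  qed
  finally show "norm (plane_rot a b t x) = norm x"
    by (simp add: power2_norm_eq_inner[symmetric])
qed

lemma plane_rot_has_vector_derivative:
  "((\<lambda>t. plane_rot a b t x) has_vector_derivative
     (plane_rot a b t x \<bullet> a) *\<^sub>R b - (plane_rot a b t x \<bullet> b) *\<^sub>R a) (at t)"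
  unfolding plane_rot_inner unfolding plane_rot_def
  by (auto intro!: derivative_eq_intros simp: scaleR_diff_left scaleR_add_left scaleR_minus_left)

text \<open>Rotation invariance makes \<open>t \<mapsto> \<integral> f (R\<^sub>t x) dx\<close> constant; the derivative at \<open>t = 0\<close> may be taken under
  the integral because, by the mean value theorem, the difference quotients are bounded by the maximum
  of the angular derivative on the sphere.\<close>

lemma integral_sphere_angular_derivative:
  assumes f: "real_polynomial_function f"
  shows "(\<integral>x. (x \<bullet> a) * pd b f x - (x \<bullet> b) * pd a f x \<partial>sphere_measure) = 0"
proof -
  define L where "L x = (x \<bullet> a) * pd b f x - (x \<bullet> b) * pd a f x" for x
  have L: "real_polynomial_function L"
    unfolding L_def using f by (intro real_polynomial_function_diff rpf_mult rpf_inner rpf_pd)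
  have deriv: "((\<lambda>t. f (plane_rot a b t x)) has_real_derivative L (plane_rot a b t x)) (at t)" for x t
  proof -
    have eq: "(((plane_rot a b t x \<bullet> a) *\<^sub>R b - (plane_rot a b t x \<bullet> b) *\<^sub>R a) \<bullet> c) * pd c f y =
       (if c = b then (plane_rot a b t x \<bullet> a) * pd b f y else 0)
        - (if c = a then (plane_rot a b t x \<bullet> b) * pd a f y else 0)" if "c \<in> Basis" for c y
      using ab that by (auto simp: inner_diff_left inner_Basis algebra_simps)
    show ?thesis
      using rpf_has_line_derivative[OF f plane_rot_has_vector_derivative, of x t] ab
      by (simp add: eq sum_subtractf L_def)
  qed
  have norm_rot: "norm (plane_rot a b t x) = norm x" for t x
    using orthogonal_transformation_norm[OF orthogonal_transformation_plane_rot] .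
  have rot0: "plane_rot a b 0 x = x" for x by (simp add: plane_rot_def)
  have "bounded (L ` sphere 0 1)"
    by (intro compact_imp_bounded compact_continuous_image continuous_on_rpf[OF L]) auto
  then obtain C where C: "\<forall>x\<in>sphere 0 1. \<bar>L x\<bar> \<le> C"
    by (auto simp: bounded_iff)
  \<comment> \<open>Difference quotients along the angles 1 / (n + 1); their integrals vanish by invariance.\<close>
  define s where "s n x = (f (plane_rot a b (inverse (real (Suc n))) x) - f x) / inverse (real (Suc n))" for n x
  have lin: "linear (plane_rot a b t)" for t
    using orthogonal_transformation_plane_rot by (simp add: orthogonal_transformation_linear)
  have rp: "real_polynomial_function (\<lambda>x. f (plane_rot a b t x))" for t
    by (rule rpf_linear_comp[OF f lin])
  have si: "integrable sphere_measure (s n)" for n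
    unfolding s_def
    by (intro integrable_sphere_rpf real_polynomial_function_divide real_polynomial_function_diff f rp)
  have s0: "integral\<^sup>L sphere_measure (s n) = 0" for n
    unfolding s_def using rp f
    by (simp add: integral_sphere_measure_orthogonal[OF orthogonal_transformation_plane_rot]
      borel_measurable_continuous_onI continuous_on_rpf)
  have "(\<lambda>n. integral\<^sup>L sphere_measure (s n)) \<longlonglongrightarrow> integral\<^sup>L sphere_measure L"
  proof (rule integral_dominated_convergence)
    interpret prob_space "sphere_measure :: 'a measure" by (rule prob_space_sphere_measure)
    show "integrable (sphere_measure :: 'a measure) (\<lambda>x. C)" by simp
    show "AE x in sphere_measure. (\<lambda>n. s n x) \<longlonglongrightarrow> L x"
    proof (rule AE_I2)
      fix x :: 'a
      have "((\<lambda>t. (f (plane_rot a b t x) - f x) / t) \<longlongrightarrow> L x) (at 0)"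
        using deriv[of x 0] by (simp add: has_field_derivative_iff rot0)
      moreover have "filterlim (\<lambda>n. inverse (real (Suc n))) (at 0) sequentially"
        by (rule filterlim_atI[OF LIMSEQ_inverse_real_of_nat]) auto
      ultimately show "(\<lambda>n. s n x) \<longlonglongrightarrow> L x"
        unfolding s_def by (rule filterlim_compose)
    qed
    show "AE x in sphere_measure. norm (s n x) \<le> C" for n
    proof (rule AE_I2)
      fix x :: 'a assume "x \<in> space sphere_measure"
      then have x: "norm x = 1" by simp
      let ?e = "inverse (real (Suc n))"
      obtain z where "f (plane_rot a b ?e x) - f (plane_rot a b 0 x) = (?e - 0) * L (plane_rot a b z x)"
        using MVT2[of 0 ?e "\<lambda>t. f (plane_rot a b t x)" "\<lambda>t. L (plane_rot a b t x)"] deriv by auto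
      then have "s n x = L (plane_rot a b z x)"
        by (simp add: s_def rot0)
      then show "norm (s n x) \<le> C"
        using C by (simp add: norm_rot x)
    qed
    show "L \<in> borel_measurable sphere_measure"
      by (rule borel_measurable_integrable[OF integrable_sphere_rpf[OF L]])
    show "s n \<in> borel_measurable sphere_measure" for n
      by (rule borel_measurable_integrable[OF si])
  qed
  then have "(\<lambda>n. 0) \<longlonglongrightarrow> integral\<^sup>L sphere_measure L" by (simp add: s0)
  then show ?thesis unfolding L_def by (simp add: LIMSEQ_const_iff)
qed

end

lemma rpf_euler [intro]: "real_polynomial_function f \<Longrightarrow> real_polynomial_function (euler f)"
  unfolding euler_def[abs_def] by (intro real_polynomial_function_sum rpf_mult rpf_inner rpf_pd) auto

text \<open>Integration by parts on the sphere, obtained by summing the vanishing integrals of the angular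
  derivatives of \<open>(x \<bullet> a) f\<close> in the planes \<open>(a, b)\<close> over all basis vectors \<open>a\<close>, and using \<open>\<Sum> (x \<bullet> a)\<^sup>2 = 1\<close>.\<close>

lemma integral_sphere_pd:
  fixes f :: "'a::euclidean_space \<Rightarrow> real"
  assumes f: "real_polynomial_function f" and b: "b \<in> Basis"
  shows "(\<integral>x. pd b f x \<partial>sphere_measure)
    = (\<integral>x. (x \<bullet> b) * ((real DIM('a) - 1) * f x + euler f x) \<partial>sphere_measure)"
proof -
  have rpa: "real_polynomial_function (\<lambda>x. (x \<bullet> a) * f x)" for a
    by (intro rpf_mult rpf_inner f)
  \<comment> \<open>The angular derivative of (x \<bullet> a) f in the plane of a and b; it is identically zero for a = b.\<close>
  let ?L = "\<lambda>a x. (x \<bullet> a) * pd b (\<lambda>x. (x \<bullet> a) * f x) x - (x \<bullet> b) * pd a (\<lambda>x. (x \<bullet> a) * f x) x"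
  have rL: "real_polynomial_function (?L a)" for a
    by (intro real_polynomial_function_diff rpf_mult rpf_inner rpf_pd f)
  have 0: "(\<integral>x. ?L a x \<partial>sphere_measure) = 0" if "a \<in> Basis" for a
  proof (cases "a = b")
    case False
    then show ?thesis using integral_sphere_angular_derivative[OF that b False rpa] by simp
  qed simp
  have "0 = (\<integral>x. (\<Sum>a\<in>Basis. ?L a x) \<partial>sphere_measure)"
    using 0 by (subst Bochner_Integration.integral_sum) (simp_all only: integrable_sphere_rpf[OF rL], simp)
  also have "\<dots> = (\<integral>x. pd b f x - (x \<bullet> b) * ((real DIM('a) - 1) * f x + euler f x) \<partial>sphere_measure)"
  proof (rule Bochner_Integration.integral_cong[OF refl])
    fix x :: 'a assume "x \<in> space sphere_measure"
    then have x: "(\<Sum>a\<in>Basis. (x \<bullet> a) * (x \<bullet> a)) = 1"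
      unfolding euclidean_inner[of x x, symmetric] by (simp add: norm_eq_1)
    have xb: "(\<Sum>a\<in>Basis. (x \<bullet> a) * (b \<bullet> a)) = x \<bullet> b"
      by (rule euclidean_inner[of x b, symmetric])
    have "(\<Sum>a\<in>Basis. ?L a x) = (\<Sum>a\<in>Basis. ((x \<bullet> a) * (b \<bullet> a)) * f x + ((x \<bullet> a) * (x \<bullet> a)) * pd b f x
        - (x \<bullet> b) * f x - (x \<bullet> b) * ((x \<bullet> a) * pd a f x))"
    proof (intro sum.cong refl)
      fix a :: 'a assume a: "a \<in> Basis"
      have "pd c (\<lambda>x. (x \<bullet> a) * f x) x = (c \<bullet> a) * f x + (x \<bullet> a) * pd c f x" for c
        using fun_cong[OF pd_mult[OF rpf_inner[of a] f, of c], of x] by simp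
      then show "?L a x = ((x \<bullet> a) * (b \<bullet> a)) * f x + ((x \<bullet> a) * (x \<bullet> a)) * pd b f x
        - (x \<bullet> b) * f x - (x \<bullet> b) * ((x \<bullet> a) * pd a f x)"
        using a by (simp add: distrib_left mult.assoc)
    qed
    also have "\<dots> = (x \<bullet> b) * f x + pd b f x - DIM('a) * ((x \<bullet> b) * f x) - (x \<bullet> b) * euler f x"
      unfolding sum_subtractf sum.distrib euler_def sum_distrib_left[symmetric] sum_distrib_right[symmetric]
      by (simp add: x xb)
    finally show "(\<Sum>a\<in>Basis. ?L a x) = pd b f x - (x \<bullet> b) * ((real DIM('a) - 1) * f x + euler f x)"
      by (simp add: algebra_simps)
  qed
  also have "\<dots> = (\<integral>x. pd b f x \<partial>sphere_measure)
     - (\<integral>x. (x \<bullet> b) * ((real DIM('a) - 1) * f x + euler f x) \<partial>sphere_measure)"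
    by (intro Bochner_Integration.integral_diff integrable_sphere_rpf rpf_pd f rpf_mult rpf_add rpf_euler rpf_const rpf_inner)
  finally show ?thesis by simp
qed

definition grad_inner :: "('a::euclidean_space \<Rightarrow> real) \<Rightarrow> ('a \<Rightarrow> real) \<Rightarrow> 'a \<Rightarrow> real" where
  "grad_inner p q x = (\<Sum>b\<in>Basis. pd b p x * pd b q x)"

text \<open>The divergence of \<open>p \<nabla>q\<close>, integrated by parts coordinatewise: both factors are eigenfunctions of the
  Euler operator, so the radial term is a multiple of \<open>\<integral> p q\<close>.\<close>

lemma integral_sphere_first_green:
  fixes p q :: "'a::euclidean_space \<Rightarrow> real"
  assumes p: "real_polynomial_function p" "homog j p" and q: "real_polynomial_function q" "homog d q"
  shows "(\<integral>x. grad_inner p q x \<partial>sphere_measure) + (\<integral>x. p x * laplacian q x \<partial>sphere_measure)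
    = (real DIM('a) + j + d - 2) * d * (\<integral>x. p x * q x \<partial>sphere_measure)"
proof -
  note rp = rpf_mult rpf_pd rpf_laplacian rpf_euler rpf_inner real_polynomial_function_sum rpf_add rpf_const p(1) q(1)
  have gi: "real_polynomial_function (grad_inner p q)"
    unfolding grad_inner_def[abs_def] by (intro rp) auto
  have pi: "real_polynomial_function (\<lambda>x. p x * laplacian q x)" by (intro rp)
  have "(\<integral>x. grad_inner p q x \<partial>sphere_measure) + (\<integral>x. p x * laplacian q x \<partial>sphere_measure)
     = (\<integral>x. grad_inner p q x + p x * laplacian q x \<partial>sphere_measure)"
    using gi pi by simp
  also have "\<dots> = (\<integral>x. (\<Sum>b\<in>Basis. pd b (\<lambda>x. p x * pd b q x) x) \<partial>sphere_measure)"
    by (simp add: grad_inner_def pd_mult p q rpf_pd laplacian_eq_sum_pd sum.distrib sum_distrib_left)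
  also have "\<dots> = (\<Sum>b\<in>Basis. (\<integral>x. pd b (\<lambda>x. p x * pd b q x) x \<partial>sphere_measure))"
    by (intro Bochner_Integration.integral_sum integrable_sphere_rpf rp)
  also have "\<dots> = (\<Sum>b\<in>Basis. (\<integral>x. (x \<bullet> b) * ((real DIM('a) - 1) * (p x * pd b q x)
        + euler (\<lambda>x. p x * pd b q x) x) \<partial>sphere_measure))"
    by (intro sum.cong refl integral_sphere_pd rp)
  also have "\<dots> = (\<integral>x. (\<Sum>b\<in>Basis. (x \<bullet> b) * ((real DIM('a) - 1) * (p x * pd b q x)
        + euler (\<lambda>x. p x * pd b q x) x)) \<partial>sphere_measure)"
    by (intro Bochner_Integration.integral_sum[symmetric] integrable_sphere_rpf rp)
  also have "\<dots> = (\<integral>x. (real DIM('a) + j + d - 2) * d * (p x * q x) \<partial>sphere_measure)"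
  proof (rule Bochner_Integration.integral_cong[OF refl])
    fix x :: 'a
    have "(\<Sum>b\<in>Basis. (x \<bullet> b) * ((real DIM('a) - 1) * (p x * pd b q x) + euler (\<lambda>x. p x * pd b q x) x))
       = (\<Sum>b\<in>Basis. (real DIM('a) + j + d - 2) * p x * ((x \<bullet> b) * pd b q x))"
      by (intro sum.cong refl)
        (simp add: euler_mult rp euler_pd[OF q] euler_homog[OF p] algebra_simps)
    also have "\<dots> = (real DIM('a) + j + d - 2) * p x * euler q x"
      unfolding euler_def by (rule sum_distrib_left[symmetric])
    finally show "(\<Sum>b\<in>Basis. (x \<bullet> b) * ((real DIM('a) - 1) * (p x * pd b q x) + euler (\<lambda>x. p x * pd b q x) x))
       = (real DIM('a) + j + d - 2) * d * (p x * q x)"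
      by (simp add: euler_homog[OF q])
  qed
  finally show ?thesis by simp
qed

text \<open>The difference of the first identity for \<open>(p, q)\<close> and for \<open>(q, p)\<close>. For harmonic \<open>p\<close> and \<open>q\<close> it says that
  harmonics of different degrees are orthogonal.\<close>

lemma integral_sphere_second_green:
  fixes p q :: "'a::euclidean_space \<Rightarrow> real"
  assumes p: "real_polynomial_function p" "homog j p" and q: "real_polynomial_function q" "homog d q"
  shows "(\<integral>x. p x * laplacian q x \<partial>sphere_measure) - (\<integral>x. q x * laplacian p x \<partial>sphere_measure)
    = (real DIM('a) + j + d - 2) * (real d - real j) * (\<integral>x. p x * q x \<partial>sphere_measure)"
proof -
  have "grad_inner q p = grad_inner p q" by (simp add: grad_inner_def fun_eq_iff mult.commute)
  moreover have "(\<lambda>x. q x * p x) = (\<lambda>x. p x * q x)" by (simp add: fun_eq_iff mult.commute)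
  ultimately show ?thesis
    using integral_sphere_first_green[OF p q] integral_sphere_first_green[OF q p]
    by (simp add: algebra_simps)
qed

section \<open>Combinatorial identities for Jacobi coefficients\<close>

lemma alternating_binomial_sum_Suc:
  fixes f :: "nat \<Rightarrow> real"
  shows "(\<Sum>s\<le>Suc n. (-1) ^ s * real (Suc n choose s) * f s)
    = (\<Sum>s\<le>n. (-1) ^ s * real (n choose s) * (f s - f (Suc s)))"
proof -
  have "(\<Sum>s\<le>Suc n. (-1) ^ s * real (Suc n choose s) * f s)
     = f 0 + (\<Sum>s\<le>n. (-1) ^ Suc s * real (Suc n choose Suc s) * f (Suc s))"
    by (subst sum.atMost_Suc_shift) simp
  also have "\<dots> = f 0 + (\<Sum>s\<le>n. (-1) ^ Suc s * real (n choose Suc s) * f (Suc s))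
      - (\<Sum>s\<le>n. (-1) ^ s * real (n choose s) * f (Suc s))"
  proof -
    have "(-1) ^ Suc s * real (Suc n choose Suc s) * f (Suc s)
      = (-1) ^ Suc s * real (n choose Suc s) * f (Suc s) - (-1) ^ s * real (n choose s) * f (Suc s)" for s
      by (simp add: algebra_simps)
    then show ?thesis by (simp only: sum_subtractf add_diff_eq)
  qed
  also have "f 0 + (\<Sum>s\<le>n. (-1) ^ Suc s * real (n choose Suc s) * f (Suc s))
      = (\<Sum>s\<le>Suc n. (-1) ^ s * real (n choose s) * f s)"
    by (subst sum.atMost_Suc_shift) simp
  also have "\<dots> = (\<Sum>s\<le>n. (-1) ^ s * real (n choose s) * f s)"
    by simp
  finally show ?thesis by (simp add: sum_subtractf right_diff_distrib)
qed

text \<open>The \<open>n\<close>-th finite difference of a monic polynomial of degree \<open>n\<close> is the constant \<open>n!\<close>; one difference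
  step turns a rising factorial of length \<open>n + 1\<close> into \<open>-(n + 1)\<close> times one of length \<open>n\<close>.\<close>

lemma alternating_binomial_sum_pochhammer:
  fixes x :: real
  shows "(\<Sum>s\<le>n. (-1) ^ s * real (n choose s) * pochhammer (x + real s) n) = (-1) ^ n * fact n"
proof (induction n arbitrary: x)
  case (Suc n)
  have diff: "pochhammer (x + real s) (Suc n) - pochhammer (x + real (Suc s)) (Suc n)
     = - real (Suc n) * pochhammer ((x + 1) + real s) n" for s
  proof -
    define y where "y = x + real s"
    have "pochhammer y (Suc n) = y * pochhammer (y + 1) n" by (rule pochhammer_rec)
    moreover have "pochhammer (y + 1) (Suc n) = pochhammer (y + 1) n * (y + 1 + real n)"
      by (rule pochhammer_Suc)
    ultimately have "pochhammer y (Suc n) - pochhammer (y + 1) (Suc n) = - real (Suc n) * pochhammer (y + 1) n"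
      by (simp add: algebra_simps)
    then show ?thesis by (simp add: y_def add_ac)
  qed
  have "(\<Sum>s\<le>Suc n. (-1) ^ s * real (Suc n choose s) * pochhammer (x + real s) (Suc n))
      = (\<Sum>s\<le>n. (-1) ^ s * real (n choose s) * (- real (Suc n) * pochhammer ((x + 1) + real s) n))"
    unfolding alternating_binomial_sum_Suc diff ..
  also have "\<dots> = - real (Suc n) * (\<Sum>s\<le>n. (-1) ^ s * real (n choose s) * pochhammer ((x + 1) + real s) n)"
    by (simp add: sum_distrib_left mult_ac)
  also have "\<dots> = (-1) ^ Suc n * fact (Suc n)"
    unfolding Suc.IH by (simp add: algebra_simps)
  finally show ?case .
qed simp

text \<open>The coefficients in Szego's formula for the Jacobi polynomial of degree \<open>i\<close>.\<close>

definition jacobi_coeff :: "real \<Rightarrow> real \<Rightarrow> nat \<Rightarrow> nat \<Rightarrow> real" where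
  "jacobi_coeff \<alpha> \<beta> i s = ((real i + \<alpha>) gchoose (i - s)) * ((real i + \<beta>) gchoose s)"

lemma gbinomial_Suc_times: "(a gchoose Suc k) * (real k + 1) = (a gchoose k) * (a - real k)" for a :: real
  using gbinomial_mult_1[of a k] by (simp add: algebra_simps)

text \<open>Both sides move one factor from one generalized binomial coefficient to the other. This two-term
  recurrence is exactly the condition for the homogenized Jacobi polynomial to be harmonic.\<close>

lemma jacobi_coeff_recurrence:
  assumes "s < i"
  shows "jacobi_coeff \<alpha> \<beta> i s * real (i - s) * (real (i - s) + \<beta>)
    = jacobi_coeff \<alpha> \<beta> i (Suc s) * (real s + 1) * (real s + 1 + \<alpha>)"
proof -
  obtain m where i: "i = Suc m" and m: "s \<le> m" using assms by (cases i) auto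
  define r where "r = m - s"
  have ms: "real m = real s + real r" using m by (simp add: r_def)
  have 1: "((real i + \<alpha>) gchoose (Suc r)) * (real r + 1) = ((real i + \<alpha>) gchoose r) * (real s + 1 + \<alpha>)"
    using gbinomial_Suc_times[of "real i + \<alpha>" r] ms by (simp add: i add_ac)
  have 2: "((real i + \<beta>) gchoose (Suc s)) * (real s + 1) = ((real i + \<beta>) gchoose s) * (real r + 1 + \<beta>)"
    using gbinomial_Suc_times[of "real i + \<beta>" s] ms by (simp add: i add_ac)
  have e: "i - s = Suc r" "i - Suc s = r" using m by (auto simp: i r_def)
  have e': "real (Suc r) = real r + 1" by simp
  have "jacobi_coeff \<alpha> \<beta> i s * real (i - s) * (real (i - s) + \<beta>)
     = (((real i + \<alpha>) gchoose (Suc r)) * (real r + 1)) * (((real i + \<beta>) gchoose s) * (real r + 1 + \<beta>))"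
    unfolding jacobi_coeff_def e e' by (simp only: mult_ac)
  also have "\<dots> = (((real i + \<alpha>) gchoose r) * (real s + 1 + \<alpha>)) * (((real i + \<beta>) gchoose (Suc s)) * (real s + 1))"
    unfolding 1 2 ..
  also have "\<dots> = jacobi_coeff \<alpha> \<beta> i (Suc s) * (real s + 1) * (real s + 1 + \<alpha>)"
    unfolding jacobi_coeff_def e by (simp only: mult_ac)
  finally show ?thesis .
qed

lemma sum_jacobi_coeff: "(\<Sum>s\<le>i. jacobi_coeff \<alpha> \<beta> i s) = (2 * real i + \<alpha> + \<beta>) gchoose i"
proof -
  have "(\<Sum>s\<le>i. jacobi_coeff \<alpha> \<beta> i s) = (\<Sum>s=0..i. ((real i + \<beta>) gchoose s) * ((real i + \<alpha>) gchoose (i - s)))"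
    unfolding jacobi_coeff_def atLeast0AtMost by (simp add: mult.commute)
  also have "\<dots> = ((real i + \<beta>) + (real i + \<alpha>)) gchoose i"
    by (rule gbinomial_Vandermonde)
  also have "(real i + \<beta>) + (real i + \<alpha>) = 2 * real i + \<alpha> + \<beta>" by simp
  finally show ?thesis .
qed

text \<open>The rising factorials, which are the moments of the beta distribution, absorb the
  generalized binomial coefficients. What remains is an ordinary binomial coefficient times a rising
  factorial, so that the sum over \<open>s\<close> is a finite difference.\<close>

lemma jacobi_coeff_moment:
  assumes "s \<le> i"
  shows "jacobi_coeff \<alpha> \<beta> i s * (pochhammer (\<beta> + 1) (i - s) * pochhammer (\<alpha> + 1) (s + i))
    = pochhammer (\<alpha> + 1) i * pochhammer (\<beta> + 1) i * (real (i choose s) * pochhammer ((\<alpha> + 1) + real s) i) / fact i"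
proof -
  define r where "r = i - s"
  have i: "i = s + r" using assms by (simp add: r_def)
  have 1: "((real i + \<beta>) gchoose s) * pochhammer (\<beta> + 1) r = pochhammer (\<beta> + 1) i / fact s"
  proof -
    have "real i + \<beta> - real s + 1 = (\<beta> + 1) + real r" by (simp add: i)
    then show ?thesis
      using pochhammer_product'[of "\<beta> + 1" r s]
      by (simp add: gbinomial_pochhammer' i add_ac)
  qed
  have 2: "((real i + \<alpha>) gchoose r) * pochhammer (\<alpha> + 1) s = pochhammer (\<alpha> + 1) i / fact r"
  proof -
    have "real i + \<alpha> - real r + 1 = (\<alpha> + 1) + real s" by (simp add: i)
    then show ?thesis
      using pochhammer_product'[of "\<alpha> + 1" s r]
      by (simp add: gbinomial_pochhammer' i add_ac)
  qed
  have 3: "pochhammer (\<alpha> + 1) (s + i) = pochhammer (\<alpha> + 1) s * pochhammer ((\<alpha> + 1) + real s) i"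
    by (rule pochhammer_product')
  have 4: "real (i choose s) / fact i = 1 / (fact s * fact r)"
    using binomial_fact[of s i, where 'a = real] by (simp add: i)
  have "jacobi_coeff \<alpha> \<beta> i s * (pochhammer (\<beta> + 1) (i - s) * pochhammer (\<alpha> + 1) (s + i))
     = (((real i + \<beta>) gchoose s) * pochhammer (\<beta> + 1) r) * (((real i + \<alpha>) gchoose r) * pochhammer (\<alpha> + 1) s)
        * pochhammer ((\<alpha> + 1) + real s) i"
    unfolding jacobi_coeff_def 3 r_def by (simp only: mult_ac)
  also have "\<dots> = pochhammer (\<alpha> + 1) i * pochhammer (\<beta> + 1) i * pochhammer ((\<alpha> + 1) + real s) i * (1 / (fact s * fact r))"
    unfolding 1 2 by simp
  finally show ?thesis unfolding 4[symmetric] by simp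
qed

lemma sum_jacobi_coeff_moment:
  "(\<Sum>s\<le>i. jacobi_coeff \<alpha> \<beta> i s * (-1) ^ s * (pochhammer (\<beta> + 1) (i - s) * pochhammer (\<alpha> + 1) (s + i)))
    = (-1) ^ i * (pochhammer (\<alpha> + 1) i * pochhammer (\<beta> + 1) i)"
proof -
  have "(\<Sum>s\<le>i. jacobi_coeff \<alpha> \<beta> i s * (-1) ^ s * (pochhammer (\<beta> + 1) (i - s) * pochhammer (\<alpha> + 1) (s + i)))
     = (\<Sum>s\<le>i. (pochhammer (\<alpha> + 1) i * pochhammer (\<beta> + 1) i / fact i)
          * ((-1) ^ s * real (i choose s) * pochhammer ((\<alpha> + 1) + real s) i))"
  proof (intro sum.cong refl)
    fix s assume "s \<in> {..i}"
    then show "jacobi_coeff \<alpha> \<beta> i s * (-1) ^ s * (pochhammer (\<beta> + 1) (i - s) * pochhammer (\<alpha> + 1) (s + i))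
      = (pochhammer (\<alpha> + 1) i * pochhammer (\<beta> + 1) i / fact i)
          * ((-1) ^ s * real (i choose s) * pochhammer ((\<alpha> + 1) + real s) i)"
      using jacobi_coeff_moment[of s i \<alpha> \<beta>] by (simp add: field_simps)
  qed
  also have "\<dots> = (pochhammer (\<alpha> + 1) i * pochhammer (\<beta> + 1) i / fact i) * ((-1) ^ i * fact i)"
    unfolding sum_distrib_left[symmetric] alternating_binomial_sum_pochhammer ..
  finally show ?thesis by simp
qed

section \<open>Jacobi polynomials as harmonic polynomials\<close>

lemma rpf_quadratic:
  fixes B :: "'a::euclidean_space \<Rightarrow> 'a"
  assumes "linear B"
  shows "real_polynomial_function (\<lambda>x. x \<bullet> B x)"
proof -
  have "real_polynomial_function (\<lambda>x. \<Sum>b\<in>Basis. (x \<bullet> b) * (B x \<bullet> b))"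
    by (intro real_polynomial_function_sum rpf_mult rpf_inner rpf_linear_comp[OF rpf_inner assms]) auto
  then show ?thesis by (simp add: euclidean_inner[symmetric])
qed

lemma pd_quadratic:
  fixes B :: "'a::euclidean_space \<Rightarrow> 'a"
  assumes lin: "linear B" and sa: "\<And>x y. B x \<bullet> y = x \<bullet> B y"
  shows "pd b (\<lambda>x. x \<bullet> B x) = (\<lambda>x. 2 * (B x \<bullet> b))"
proof (rule ext, rule pd_eqI)
  fix x
  have eq: "(x + t *\<^sub>R b) \<bullet> B (x + t *\<^sub>R b) = x \<bullet> B x + t * (2 * (B x \<bullet> b)) + t\<^sup>2 * (b \<bullet> B b)" for t
    by (simp add: linear_add[OF lin] linear_scale[OF lin] inner_add_left inner_add_right
        inner_commute[of b "B x"] sa[of x b] power2_eq_square algebra_simps)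
  show "((\<lambda>t. (x + t *\<^sub>R b) \<bullet> B (x + t *\<^sub>R b)) has_real_derivative 2 * (B x \<bullet> b)) (at 0)"
    unfolding eq by (auto intro!: derivative_eq_intros)
qed

text \<open>An orthogonal projection \<open>A\<close> of rank \<open>2\<beta> + 2\<close>, whose complement has rank \<open>2\<alpha> + 2\<close>. The two squared
  lengths \<open>p = |A x|\<^sup>2\<close> and \<open>q = |x - A x|\<^sup>2\<close> generate the polynomials that are invariant under the orthogonal
  groups of the range and of the kernel of \<open>A\<close>. Two instances occur below: the projection onto the
  column space of a Stiefel matrix, and the projection onto a line.\<close>

locale orth_projection =
  fixes A :: "'a::euclidean_space \<Rightarrow> 'a" and \<alpha> \<beta> :: real
  assumes linear_A: "linear A"
    and selfadjoint: "A x \<bullet> y = x \<bullet> A y"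
    and idem: "A (A x) = A x"
    and trace_A: "(\<Sum>b\<in>Basis. A b \<bullet> b) = 2 * (\<beta> + 1)"
    and trace_coA: "real DIM('a) = 2 * (\<alpha> + 1) + 2 * (\<beta> + 1)"
begin

definition p :: "'a \<Rightarrow> real" where "p x = x \<bullet> A x"
definition q :: "'a \<Rightarrow> real" where "q x = x \<bullet> (x - A x)"

lemma linear_coA: "linear (\<lambda>x. x - A x)"
  by (intro linear_compose_sub linear_A linear_id[unfolded id_def])

lemma rpf_p: "real_polynomial_function p" and rpf_q: "real_polynomial_function q"
  unfolding p_def[abs_def] q_def[abs_def]
  using rpf_quadratic[OF linear_A] rpf_quadratic[OF linear_coA] by simp_all

lemma pd_p: "pd b p = (\<lambda>x. 2 * (A x \<bullet> b))"
  unfolding p_def[abs_def] by (rule pd_quadratic[OF linear_A selfadjoint])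

lemma pd_q: "pd b q = (\<lambda>x. 2 * ((x - A x) \<bullet> b))"
  unfolding q_def[abs_def]
  by (rule pd_quadratic[OF linear_coA]) (simp add: inner_diff_left inner_diff_right selfadjoint)

lemma pq_sphere: "norm x = 1 \<Longrightarrow> p x = 1 - q x"
  by (simp add: p_def q_def inner_diff_right norm_eq_1)

lemma p_scale: "p (c *\<^sub>R x) = c\<^sup>2 * p x" and q_scale: "q (c *\<^sub>R x) = c\<^sup>2 * q x"
  by (simp_all add: p_def q_def linear_scale[OF linear_A] power2_eq_square inner_diff_right algebra_simps)

lemma rpf_monomial: "real_polynomial_function (\<lambda>x. p x ^ u * q x ^ s)"
  by (intro rpf_mult real_polynomial_function_power rpf_p rpf_q)

lemma homog_monomial: "homog (2 * (u + s)) (\<lambda>x. p x ^ u * q x ^ s)"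
  by (simp add: homog_def p_scale q_scale power_mult_distrib power_mult[symmetric] power_add algebra_simps)

text \<open>The gradients of \<open>p\<close> and \<open>q\<close> lie in orthogonal subspaces, so the cross terms cancel, and the traces of
  \<open>A\<close> and of its complement contribute the constants \<open>\<beta>\<close> and \<open>\<alpha>\<close>.\<close>

lemma laplacian_monomial:
  "laplacian (\<lambda>x. p x ^ u * q x ^ s) x =
     4 * u * (real u + \<beta>) * (p x ^ (u - 1) * q x ^ s) + 4 * s * (real s + \<alpha>) * (p x ^ u * q x ^ (s - 1))"
proof -
  have rA: "real_polynomial_function (\<lambda>x. A x \<bullet> b)" and rB: "real_polynomial_function (\<lambda>x. (x - A x) \<bullet> b)" for b
    using rpf_linear_comp[OF rpf_inner linear_A] rpf_linear_comp[OF rpf_inner linear_coA] by auto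
  note rp = rpf_mult real_polynomial_function_power rpf_p rpf_q rA rB rpf_const
  have pdA: "pd b (\<lambda>x. A x \<bullet> b) = (\<lambda>x. A b \<bullet> b)" for b
    by (rule pd_bounded_linear)
      (intro bounded_linear_compose[OF bounded_linear_inner_left] linear_conv_bounded_linear[THEN iffD1] linear_A)
  have pdB: "pd b (\<lambda>x. (x - A x) \<bullet> b) = (\<lambda>x. (b - A b) \<bullet> b)" for b
    by (rule pd_bounded_linear)
      (intro bounded_linear_compose[OF bounded_linear_inner_left] linear_conv_bounded_linear[THEN iffD1] linear_coA)
  have pd1: "pd b (\<lambda>x. p x ^ u * q x ^ s) =
      (\<lambda>x. (2 * u) * ((A x \<bullet> b) * (p x ^ (u - 1) * q x ^ s)) + (2 * s) * (((x - A x) \<bullet> b) * (p x ^ u * q x ^ (s - 1))))" for b u s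
    by (rule ext) (simp add: pd_mult[OF real_polynomial_function_power[OF rpf_p] real_polynomial_function_power[OF rpf_q]]
        pd_power[OF rpf_p] pd_power[OF rpf_q] pd_p pd_q mult_ac)
  have pd2: "pd b (pd b (\<lambda>x. p x ^ u * q x ^ s)) x =
      2 * u * ((A b \<bullet> b) * (p x ^ (u - 1) * q x ^ s)
        + (A x \<bullet> b) * ((2 * real (u - 1)) * ((A x \<bullet> b) * (p x ^ (u - 1 - 1) * q x ^ s))
            + (2 * s) * (((x - A x) \<bullet> b) * (p x ^ (u - 1) * q x ^ (s - 1)))))
    + 2 * s * (((b - A b) \<bullet> b) * (p x ^ u * q x ^ (s - 1))
        + ((x - A x) \<bullet> b) * ((2 * u) * ((A x \<bullet> b) * (p x ^ (u - 1) * q x ^ (s - 1)))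
            + (2 * real (s - 1)) * (((x - A x) \<bullet> b) * (p x ^ u * q x ^ (s - 1 - 1)))))" for b
    unfolding pd1
    apply (subst pd_add) apply (intro rp) apply (intro rp)
    apply (subst pd_cmult) apply (intro rp)
    apply (subst pd_cmult) apply (intro rp)
    apply (subst pd_mult[OF rA]) apply (intro rp)
    apply (subst pd_mult[OF rB]) apply (intro rp)
    apply (subst pd1)+
    apply (subst pdA)
    apply (subst pdB)
    apply (simp only: of_nat_mult of_nat_numeral)
    done
  have sA: "(\<Sum>b\<in>Basis. (A x \<bullet> b) * (A x \<bullet> b)) = p x"
    unfolding euclidean_inner[symmetric] p_def by (simp add: selfadjoint idem)
  have sB: "(\<Sum>b\<in>Basis. ((x - A x) \<bullet> b) * ((x - A x) \<bullet> b)) = q x"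
    unfolding euclidean_inner[symmetric] q_def
    by (simp add: inner_diff_left inner_diff_right selfadjoint idem)
  have sAB: "(\<Sum>b\<in>Basis. (A x \<bullet> b) * ((x - A x) \<bullet> b)) = 0"
    unfolding euclidean_inner[symmetric] by (simp add: inner_diff_right selfadjoint idem)
  have tB: "(\<Sum>b\<in>Basis. (b - A b) \<bullet> b) = 2 * (\<alpha> + 1)"
    using trace_A trace_coA by (simp add: inner_diff_left sum_subtractf)
  have "laplacian (\<lambda>x. p x ^ u * q x ^ s) x =
    (\<Sum>b\<in>Basis. (2 * u * (p x ^ (u - 1) * q x ^ s)) * (A b \<bullet> b)
      + (2 * u * (2 * real (u - 1)) * (p x ^ (u - 1 - 1) * q x ^ s)) * ((A x \<bullet> b) * (A x \<bullet> b))
      + (8 * u * s * (p x ^ (u - 1) * q x ^ (s - 1))) * ((A x \<bullet> b) * ((x - A x) \<bullet> b))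
      + (2 * s * (p x ^ u * q x ^ (s - 1))) * ((b - A b) \<bullet> b)
      + (2 * s * (2 * real (s - 1)) * (p x ^ u * q x ^ (s - 1 - 1))) * (((x - A x) \<bullet> b) * ((x - A x) \<bullet> b)))"
    unfolding laplacian_eq_sum_pd[OF rpf_monomial] pd2
    by (intro sum.cong refl, unfold of_nat_mult of_nat_numeral, algebra)
  also have "\<dots> = 2 * u * (p x ^ (u - 1) * q x ^ s) * (2 * (\<beta> + 1))
      + 2 * u * (2 * real (u - 1)) * (p x ^ (u - 1 - 1) * q x ^ s) * p x
      + 2 * s * (p x ^ u * q x ^ (s - 1)) * (2 * (\<alpha> + 1))
      + 2 * s * (2 * real (s - 1)) * (p x ^ u * q x ^ (s - 1 - 1)) * q x"
    unfolding sum.distrib sum_distrib_left[symmetric] sA sB sAB tB trace_A by simp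
  finally have L: "laplacian (\<lambda>x. p x ^ u * q x ^ s) x = 2 * u * (p x ^ (u - 1) * q x ^ s) * (2 * (\<beta> + 1))
      + 2 * u * (2 * real (u - 1)) * (p x ^ (u - 1 - 1) * q x ^ s) * p x
      + 2 * s * (p x ^ u * q x ^ (s - 1)) * (2 * (\<alpha> + 1))
      + 2 * s * (2 * real (s - 1)) * (p x ^ u * q x ^ (s - 1 - 1)) * q x" .
  have aux: "2 * U * (2 * V) * Q * z = 4 * (U * V) * R"
    if "U * V * (Q * z) = U * V * R" for U V Q R z :: real
    using that by algebra
  have "real u * real (u - 1) * ((p x ^ (u - 1 - 1) * q x ^ s) * p x) = real u * real (u - 1) * (p x ^ (u - 1) * q x ^ s)"
    by (cases u; cases "u - 1") auto
  then have e1: "2 * u * (2 * real (u - 1)) * (p x ^ (u - 1 - 1) * q x ^ s) * p x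
      = 4 * (real u * real (u - 1)) * (p x ^ (u - 1) * q x ^ s)"
    unfolding of_nat_mult of_nat_numeral by (rule aux)
  have "real s * real (s - 1) * ((p x ^ u * q x ^ (s - 1 - 1)) * q x) = real s * real (s - 1) * (p x ^ u * q x ^ (s - 1))"
    by (cases s; cases "s - 1") auto
  then have e2: "2 * s * (2 * real (s - 1)) * (p x ^ u * q x ^ (s - 1 - 1)) * q x
      = 4 * (real s * real (s - 1)) * (p x ^ u * q x ^ (s - 1))"
    unfolding of_nat_mult of_nat_numeral by (rule aux)
  have e3: "real u * real (u - 1) = real u * (real u - 1)" for u by (cases u) auto
  show ?thesis unfolding L e1 e2 e3 by (simp add: algebra_simps)
qed

end

context orth_projection
begin

lemma half_DIM: "\<alpha> + \<beta> + 2 = real DIM('a) / 2"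
  using trace_coA by simp

lemma laplacian_monomial_sum:
  "laplacian (\<lambda>x. \<Sum>s\<le>Suc m. c s * (p x ^ (Suc m - s) * q x ^ s)) x
    = (\<Sum>s\<le>m. 4 * (c s * real (Suc m - s) * (real (Suc m - s) + \<beta>)
          + c (Suc s) * (real s + 1) * (real s + 1 + \<alpha>)) * (p x ^ (m - s) * q x ^ s))"
proof -
  let ?i = "Suc m"
  have "laplacian (\<lambda>x. \<Sum>s\<le>?i. c s * (p x ^ (?i - s) * q x ^ s)) x
     = (\<Sum>s\<le>?i. c s * (4 * real (?i - s) * (real (?i - s) + \<beta>) * (p x ^ (?i - s - 1) * q x ^ s)))
     + (\<Sum>s\<le>?i. c s * (4 * real s * (real s + \<alpha>) * (p x ^ (?i - s) * q x ^ (s - 1))))"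
    by (subst laplacian_sum)
      (auto intro: rpf_monomial simp: laplacian_monomial distrib_left sum.distrib simp del: sum.atMost_Suc)
  also have "(\<Sum>s\<le>?i. c s * (4 * real (?i - s) * (real (?i - s) + \<beta>) * (p x ^ (?i - s - 1) * q x ^ s)))
     = (\<Sum>s\<le>m. c s * (4 * real (?i - s) * (real (?i - s) + \<beta>) * (p x ^ (m - s) * q x ^ s)))"
    by simp
  also have "(\<Sum>s\<le>?i. c s * (4 * real s * (real s + \<alpha>) * (p x ^ (?i - s) * q x ^ (s - 1))))
     = (\<Sum>s\<le>m. c (Suc s) * (4 * (real s + 1) * (real s + 1 + \<alpha>) * (p x ^ (m - s) * q x ^ s)))"
    by (subst sum.atMost_Suc_shift) (simp add: add_ac)
  also have "(\<Sum>s\<le>m. c s * (4 * real (?i - s) * (real (?i - s) + \<beta>) * (p x ^ (m - s) * q x ^ s)))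
     + (\<Sum>s\<le>m. c (Suc s) * (4 * (real s + 1) * (real s + 1 + \<alpha>) * (p x ^ (m - s) * q x ^ s)))
    = (\<Sum>s\<le>m. 4 * (c s * real (?i - s) * (real (?i - s) + \<beta>)
          + c (Suc s) * (real s + 1) * (real s + 1 + \<alpha>)) * (p x ^ (m - s) * q x ^ s))"
    unfolding sum.distrib[symmetric]
  proof (intro sum.cong refl)
    fix s
    show "c s * (4 * U * V * M) + c (Suc s) * (4 * (real s + 1) * W * M)
       = 4 * (c s * U * V + c (Suc s) * (real s + 1) * W) * M" for U V W M
      by algebra
  qed
  finally show ?thesis .
qed

text \<open>Green's identity, with a harmonic first factor, applied to a monomial. With \<open>f = 1\<close> it yields the
  moments of the sphere, with \<open>f\<close> of higher degree the orthogonality to lower degree monomials.\<close>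

lemma integral_harmonic_monomial_recurrence:
  fixes f :: "'a \<Rightarrow> real"
  assumes f: "real_polynomial_function f" "homog j f" and h: "\<And>x. laplacian f x = 0"
  shows "(real DIM('a) + real j + 2 * real (u + s) - 2) * (2 * real (u + s) - real j)
      * (\<integral>x. f x * (p x ^ u * q x ^ s) \<partial>sphere_measure)
    = 4 * u * (real u + \<beta>) * (\<integral>x. f x * (p x ^ (u - 1) * q x ^ s) \<partial>sphere_measure)
    + 4 * s * (real s + \<alpha>) * (\<integral>x. f x * (p x ^ u * q x ^ (s - 1)) \<partial>sphere_measure)"
proof -
  have "(\<integral>x. f x * laplacian (\<lambda>x. p x ^ u * q x ^ s) x \<partial>sphere_measure)
    = (\<integral>x. (4 * u * (real u + \<beta>)) * (f x * (p x ^ (u - 1) * q x ^ s))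
        + (4 * s * (real s + \<alpha>)) * (f x * (p x ^ u * q x ^ (s - 1))) \<partial>sphere_measure)"
    unfolding laplacian_monomial by (intro Bochner_Integration.integral_cong refl) (simp add: algebra_simps)
  also have "\<dots> = 4 * u * (real u + \<beta>) * (\<integral>x. f x * (p x ^ (u - 1) * q x ^ s) \<partial>sphere_measure)
    + 4 * s * (real s + \<alpha>) * (\<integral>x. f x * (p x ^ u * q x ^ (s - 1)) \<partial>sphere_measure)"
    by (subst Bochner_Integration.integral_add)
      (auto intro!: integrable_sphere_rpf rpf_mult rpf_const f real_polynomial_function_power rpf_p rpf_q)
  finally have "(\<integral>x. f x * laplacian (\<lambda>x. p x ^ u * q x ^ s) x \<partial>sphere_measure)
    = 4 * u * (real u + \<beta>) * (\<integral>x. f x * (p x ^ (u - 1) * q x ^ s) \<partial>sphere_measure)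
    + 4 * s * (real s + \<alpha>) * (\<integral>x. f x * (p x ^ u * q x ^ (s - 1)) \<partial>sphere_measure)" .
  then show ?thesis
    using integral_sphere_second_green[OF f rpf_monomial homog_monomial, of u s] by (simp add: h)
qed

text \<open>The mixed moments of \<open>p\<close> and \<open>q\<close>: on the sphere \<open>p\<close> follows the beta distribution with parameters
  \<open>\<beta> + 1\<close> and \<open>\<alpha> + 1\<close>. The recurrence replaces any computation of densities.\<close>

lemma integral_sphere_monomial:
  "(\<integral>x. p x ^ u * q x ^ s \<partial>sphere_measure)
    = pochhammer (\<beta> + 1) u * pochhammer (\<alpha> + 1) s / pochhammer (\<alpha> + \<beta> + 2) (u + s)"
proof (induction "u + s" arbitrary: u s)
  case 0
  interpret prob_space "sphere_measure :: 'a measure" by (rule prob_space_sphere_measure)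
  from 0 show ?case using prob_space by simp
next
  case (Suc n)
  let ?I = "\<lambda>u s. \<integral>x. p x ^ u * q x ^ s \<partial>sphere_measure"
  let ?P = "\<lambda>u s. pochhammer (\<beta> + 1) u * pochhammer (\<alpha> + 1) s"
  have "real DIM('a) > 0" by simp
  then have pos: "\<alpha> + \<beta> + 2 > 0" using half_DIM by linarith
  have pn: "pochhammer (\<alpha> + \<beta> + 2) n > 0" using pos by (rule pochhammer_pos)
  have us: "real u + real s = real n + 1" using Suc.hyps(2) by linarith
  have "laplacian (\<lambda>x::'a. 1) x = 0" for x
    by (subst laplacian_eq_sum_pd) (auto simp: rpf_const)
  then have rec: "(real DIM('a) + 2 * real (u + s) - 2) * (2 * real (u + s)) * ?I u s
    = 4 * u * (real u + \<beta>) * ?I (u - 1) s + 4 * s * (real s + \<alpha>) * ?I u (s - 1)"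
    using integral_harmonic_monomial_recurrence[OF rpf_const[of 1], of 0 u s] by (simp add: homog_def)
  have d: "real DIM('a) + 2 * real (u + s) - 2 = 2 * (\<alpha> + \<beta> + 2 + real n)"
    using half_DIM us by simp
  have 1: "4 * u * (real u + \<beta>) * ?I (u - 1) s = 4 * u * (?P u s / pochhammer (\<alpha> + \<beta> + 2) n)"
  proof (cases u)
    case (Suc v)
    have "?I v s = ?P v s / pochhammer (\<alpha> + \<beta> + 2) n"
      using Suc.hyps(1)[of v s] Suc.hyps(2) Suc by simp
    then show ?thesis unfolding Suc by (simp add: pochhammer_Suc add_ac mult_ac)
  qed simp
  have 2: "4 * s * (real s + \<alpha>) * ?I u (s - 1) = 4 * s * (?P u s / pochhammer (\<alpha> + \<beta> + 2) n)"
  proof (cases s)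
    case (Suc v)
    have "?I u v = ?P u v / pochhammer (\<alpha> + \<beta> + 2) n"
      using Suc.hyps(1)[of u v] Suc.hyps(2) Suc by simp
    then show ?thesis unfolding Suc by (simp add: pochhammer_Suc add_ac mult_ac)
  qed simp
  have "4 * (real u + real s) * ((\<alpha> + \<beta> + 2 + real n) * ?I u s) = 4 * (real u + real s) * (?P u s / pochhammer (\<alpha> + \<beta> + 2) n)"
  proof -
    define Q where "Q = ?P u s / pochhammer (\<alpha> + \<beta> + 2) n"
    have "2 * (\<alpha> + \<beta> + 2 + real n) * (2 * (real u + real s)) * ?I u s = 4 * real u * Q + 4 * real s * Q"
      using rec unfolding 1 2 d Q_def[symmetric] by simp
    then have "4 * (real u + real s) * ((\<alpha> + \<beta> + 2 + real n) * ?I u s) = 4 * (real u + real s) * Q"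
      by algebra
    then show ?thesis unfolding Q_def .
  qed
  then have "(\<alpha> + \<beta> + 2 + real n) * ?I u s = ?P u s / pochhammer (\<alpha> + \<beta> + 2) n"
    unfolding us by (simp only: mult_cancel_left) simp
  then have "?I u s = ?P u s / (pochhammer (\<alpha> + \<beta> + 2) n * (\<alpha> + \<beta> + 2 + real n))"
  proof -
    assume *: "(\<alpha> + \<beta> + 2 + real n) * ?I u s = ?P u s / pochhammer (\<alpha> + \<beta> + 2) n"
    have "\<alpha> + \<beta> + 2 + real n \<noteq> 0" using pos by linarith
    then have "?I u s = (\<alpha> + \<beta> + 2 + real n) * ?I u s / (\<alpha> + \<beta> + 2 + real n)" by simp
    then show ?thesis unfolding * by simp
  qed
  then show ?case unfolding Suc.hyps(2)[symmetric] pochhammer_Suc .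
qed

lemma harmonic_orthogonal_monomial:
  assumes f: "real_polynomial_function f" "homog (2 * i) f" "\<And>x. laplacian f x = 0" and us: "u + s < i"
  shows "(\<integral>x. f x * (p x ^ u * q x ^ s) \<partial>sphere_measure) = 0"
  using us
proof (induction "u + s" arbitrary: u s rule: less_induct)
  case less
  have 1: "4 * u * (real u + \<beta>) * (\<integral>x. f x * (p x ^ (u - 1) * q x ^ s) \<partial>sphere_measure) = 0"
    using less.hyps[of "u - 1" s] less.prems by (cases "u = 0") simp_all
  have 2: "4 * s * (real s + \<alpha>) * (\<integral>x. f x * (p x ^ u * q x ^ (s - 1)) \<partial>sphere_measure) = 0"
    using less.hyps[of u "s - 1"] less.prems by (cases "s = 0") simp_all
  have "real DIM('a) > 0" "real (2 * i) \<ge> 2" "2 * real (u + s) < real (2 * i)"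
    using less.prems by auto
  then have "real DIM('a) + real (2 * i) + 2 * real (u + s) - 2 \<noteq> 0" "2 * real (u + s) - real (2 * i) \<noteq> 0"
    by linarith+
  moreover have "(real DIM('a) + real (2 * i) + 2 * real (u + s) - 2) * (2 * real (u + s) - real (2 * i))
      * (\<integral>x. f x * (p x ^ u * q x ^ s) \<partial>sphere_measure) = 0"
    using integral_harmonic_monomial_recurrence[OF f, of u s] 1 2 by linarith
  ultimately show ?case by (simp only: mult_eq_0_iff simp_thms)
qed

text \<open>The homogeneous polynomial of degree \<open>2i\<close> that agrees with the Jacobi polynomial in \<open>2p - 1\<close> on the
  sphere, where \<open>p + q = 1\<close>.\<close>

definition jacobi_harmonic :: "nat \<Rightarrow> 'a \<Rightarrow> real" where
  "jacobi_harmonic i x = (\<Sum>s\<le>i. (jacobi_coeff \<alpha> \<beta> i s * (-1) ^ s) * (p x ^ (i - s) * q x ^ s))"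

lemma rpf_jacobi_harmonic: "real_polynomial_function (jacobi_harmonic i)"
  unfolding jacobi_harmonic_def[abs_def]
  by (intro real_polynomial_function_sum rpf_mult rpf_const real_polynomial_function_power rpf_p rpf_q) auto

lemma homog_jacobi_harmonic: "homog (2 * i) (jacobi_harmonic i)"
  unfolding homog_def
proof (intro allI impI)
  fix c :: real and x :: 'a assume "c > 0"
  have "p (c *\<^sub>R x) ^ (i - s) * q (c *\<^sub>R x) ^ s = c ^ (2 * i) * (p x ^ (i - s) * q x ^ s)" if "s \<le> i" for s
    using homog_monomial[of "i - s" s] \<open>c > 0\<close> that by (simp add: homog_def)
  then show "jacobi_harmonic i (c *\<^sub>R x) = c ^ (2 * i) * jacobi_harmonic i x"
    unfolding jacobi_harmonic_def sum_distrib_left by (intro sum.cong refl) simp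
qed

lemma laplacian_jacobi_harmonic: "laplacian (jacobi_harmonic i) x = 0"
proof (cases i)
  case 0
  then show ?thesis unfolding jacobi_harmonic_def[abs_def]
    by (subst laplacian_eq_sum_pd) (auto simp: rpf_const)
next
  case (Suc m)
  let ?c = "\<lambda>s. jacobi_coeff \<alpha> \<beta> i s * (-1) ^ s"
  have "?c s * real (Suc m - s) * (real (Suc m - s) + \<beta>) + ?c (Suc s) * (real s + 1) * (real s + 1 + \<alpha>) = 0"
    if "s \<le> m" for s
  proof -
    have "s < i" "i = Suc m" using that Suc by simp_all
    then show ?thesis
      using jacobi_coeff_recurrence[OF \<open>s < i\<close>, of \<alpha> \<beta>] by (simp add: mult_ac)
  qed
  then show ?thesis
    unfolding jacobi_harmonic_def[abs_def] Suc laplacian_monomial_sum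
    by (intro sum.neutral ballI) (simp add: Suc)
qed

lemma jacobi_harmonic_eq_jacobi_poly:
  assumes "norm x = 1"
  shows "jacobi_harmonic i x = jacobi_poly \<alpha> \<beta> i (2 * p x - 1)"
proof -
  have "((2 * p x - 1) - 1) / 2 = - q x" "((2 * p x - 1) + 1) / 2 = p x"
    using pq_sphere[OF assms] by simp_all
  then show ?thesis
    unfolding jacobi_harmonic_def jacobi_poly_def jacobi_coeff_def
    by (simp add: power_minus[of "q x"] mult_ac)
qed

text \<open>On the sphere \<open>p = 1 - q\<close>, and the terms of degree less than that of \<open>f\<close> do not contribute; hence every
  factor \<open>p\<close> may be traded for \<open>-q\<close>.\<close>

lemma integral_harmonic_top_monomial:
  assumes f: "real_polynomial_function f" "homog (2 * (u + s)) f" "\<And>x. laplacian f x = 0"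
  shows "(\<integral>x. f x * (p x ^ u * q x ^ s) \<partial>sphere_measure)
    = (-1) ^ u * (\<integral>x. f x * q x ^ (u + s) \<partial>sphere_measure)"
  using f(2)
proof (induction u arbitrary: s)
  case (Suc u)
  have "(\<integral>x. f x * (p x ^ Suc u * q x ^ s) \<partial>sphere_measure)
     = (\<integral>x. f x * (p x ^ u * q x ^ s) - f x * (p x ^ u * q x ^ Suc s) \<partial>sphere_measure)"
    by (intro Bochner_Integration.integral_cong refl) (simp add: pq_sphere algebra_simps)
  also have "\<dots> = (\<integral>x. f x * (p x ^ u * q x ^ s) \<partial>sphere_measure) - (\<integral>x. f x * (p x ^ u * q x ^ Suc s) \<partial>sphere_measure)"
    by (intro Bochner_Integration.integral_diff integrable_sphere_rpf rpf_mult f(1) real_polynomial_function_power rpf_p rpf_q)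
  also have "(\<integral>x. f x * (p x ^ u * q x ^ s) \<partial>sphere_measure) = 0"
    by (rule harmonic_orthogonal_monomial[OF f(1) Suc.prems f(3)]) simp
  also have "(\<integral>x. f x * (p x ^ u * q x ^ Suc s) \<partial>sphere_measure) = (-1) ^ u * (\<integral>x. f x * q x ^ (u + Suc s) \<partial>sphere_measure)"
    by (rule Suc.IH) (use Suc.prems in simp)
  finally show ?case by simp
qed simp

text \<open>One factor may be reduced to its leading term in \<open>q\<close>, whose coefficient is
  the Vandermonde sum \<open>\<Sum> c\<^sub>s\<close> up to sign; the integral of the other factor against
  \<open>q\<^sup>i\<close> is a single sum of moments, evaluated by a finite difference.\<close>

lemma integral_jacobi_harmonic_square:
  "(\<integral>x. (jacobi_harmonic i x)\<^sup>2 \<partial>sphere_measure)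
    = ((2 * real i + \<alpha> + \<beta>) gchoose i) * (pochhammer (\<alpha> + 1) i * pochhammer (\<beta> + 1) i)
        / pochhammer (\<alpha> + \<beta> + 2) (2 * i)"
proof -
  let ?K = "jacobi_harmonic i"
  let ?c = "\<lambda>s. jacobi_coeff \<alpha> \<beta> i s * (-1) ^ s"
  note rp = rpf_mult rpf_const real_polynomial_function_power rpf_p rpf_q rpf_jacobi_harmonic
  have top: "(\<integral>x. ?K x * q x ^ i \<partial>sphere_measure)
    = (-1) ^ i * (pochhammer (\<alpha> + 1) i * pochhammer (\<beta> + 1) i) / pochhammer (\<alpha> + \<beta> + 2) (2 * i)"
  proof -
    have "(\<integral>x. ?K x * q x ^ i \<partial>sphere_measure) = (\<integral>x. (\<Sum>s\<le>i. ?c s * (p x ^ (i - s) * q x ^ (s + i))) \<partial>sphere_measure)"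
      unfolding jacobi_harmonic_def by (intro Bochner_Integration.integral_cong refl)
        (simp add: sum_distrib_left power_add mult_ac)
    also have "\<dots> = (\<Sum>s\<le>i. ?c s * (\<integral>x. p x ^ (i - s) * q x ^ (s + i) \<partial>sphere_measure))"
      by (subst Bochner_Integration.integral_sum) (auto intro!: integrable_sphere_rpf rp)
    also have "\<dots> = (\<Sum>s\<le>i. ?c s * (pochhammer (\<beta> + 1) (i - s) * pochhammer (\<alpha> + 1) (s + i)) / pochhammer (\<alpha> + \<beta> + 2) (2 * i))"
      by (intro sum.cong refl) (simp add: integral_sphere_monomial mult_2)
    also have "\<dots> = (-1) ^ i * (pochhammer (\<alpha> + 1) i * pochhammer (\<beta> + 1) i) / pochhammer (\<alpha> + \<beta> + 2) (2 * i)"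
      unfolding sum_divide_distrib[symmetric] sum_jacobi_coeff_moment ..
    finally show ?thesis .
  qed
  have "(\<integral>x. (?K x)\<^sup>2 \<partial>sphere_measure) = (\<integral>x. (\<Sum>s\<le>i. ?c s * (?K x * (p x ^ (i - s) * q x ^ s))) \<partial>sphere_measure)"
  proof (intro Bochner_Integration.integral_cong refl)
    fix x
    have "(?K x)\<^sup>2 = ?K x * (\<Sum>s\<le>i. ?c s * (p x ^ (i - s) * q x ^ s))"
      by (simp add: power2_eq_square jacobi_harmonic_def)
    then show "(?K x)\<^sup>2 = (\<Sum>s\<le>i. ?c s * (?K x * (p x ^ (i - s) * q x ^ s)))"
      by (simp add: sum_distrib_left mult_ac)
  qed
  also have "\<dots> = (\<Sum>s\<le>i. ?c s * (\<integral>x. ?K x * (p x ^ (i - s) * q x ^ s) \<partial>sphere_measure))"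
    by (subst Bochner_Integration.integral_sum) (auto intro!: integrable_sphere_rpf rp)
  also have "\<dots> = (\<Sum>s\<le>i. jacobi_coeff \<alpha> \<beta> i s * ((-1) ^ i * (\<integral>x. ?K x * q x ^ i \<partial>sphere_measure)))"
  proof (intro sum.cong refl)
    fix s assume "s \<in> {..i}"
    then have s: "i - s + s = i" by simp
    have "(\<integral>x. ?K x * (p x ^ (i - s) * q x ^ s) \<partial>sphere_measure) = (-1) ^ (i - s) * (\<integral>x. ?K x * q x ^ i \<partial>sphere_measure)"
      using integral_harmonic_top_monomial[of ?K "i - s" s] rpf_jacobi_harmonic homog_jacobi_harmonic[of i] laplacian_jacobi_harmonic
      unfolding s by simp
    moreover have "(-1 :: real) ^ s * (-1) ^ (i - s) = (-1) ^ i"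
      using \<open>s \<in> {..i}\<close> by (simp flip: power_add)
    ultimately show "?c s * (\<integral>x. ?K x * (p x ^ (i - s) * q x ^ s) \<partial>sphere_measure)
      = jacobi_coeff \<alpha> \<beta> i s * ((-1) ^ i * (\<integral>x. ?K x * q x ^ i \<partial>sphere_measure))"
      by (simp add: mult_ac)
  qed
  also have "\<dots> = ((2 * real i + \<alpha> + \<beta>) gchoose i) * ((-1) ^ i * (\<integral>x. ?K x * q x ^ i \<partial>sphere_measure))"
    unfolding sum_distrib_right[symmetric] sum_jacobi_coeff ..
  also have "(-1) ^ i * (\<integral>x. ?K x * q x ^ i \<partial>sphere_measure)
      = (pochhammer (\<alpha> + 1) i * pochhammer (\<beta> + 1) i) / pochhammer (\<alpha> + \<beta> + 2) (2 * i)"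
    unfolding top by (simp add: power_add[symmetric] mult_2[symmetric])
  finally show ?thesis by simp
qed

end

section \<open>Uniqueness of zonal harmonics\<close>

lemma real_polynomial_function_imp_poly:
  assumes "real_polynomial_function (g :: real \<Rightarrow> real)"
  obtains P where "g = poly P"
proof -
  obtain a n where g: "g = (\<lambda>x. \<Sum>i\<le>n. a i * x ^ i)"
    using assms real_polynomial_function_iff_sum by blast
  have "g = poly (\<Sum>i\<le>n. monom (a i) i)"
    by (simp add: g fun_eq_iff poly_sum poly_monom)
  then show ?thesis by (rule that)
qed

lemma sum_even_indices:
  fixes g :: "nat \<Rightarrow> real"
  assumes "\<And>l. odd l \<Longrightarrow> g l = 0"
  shows "(\<Sum>l\<le>2 * i. g l) = (\<Sum>l\<le>i. g (2 * l))"
proof (induction i)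
  case (Suc i)
  have "g (Suc (2 * i)) = 0" by (rule assms) simp
  then show ?case by (simp add: Suc)
qed simp

lemma polynomial_sum_eq_0_imp_coeffs_0:
  fixes d :: "nat \<Rightarrow> real"
  assumes "\<And>y. y \<ge> 0 \<Longrightarrow> (\<Sum>s\<le>m. d s * y ^ s) = 0" "s \<le> m"
  shows "d s = 0"
proof -
  define P where "P = (\<Sum>s\<le>m. monom (d s) s)"
  have "poly P y = (\<Sum>s\<le>m. d s * y ^ s)" for y
    by (simp add: P_def poly_sum poly_monom)
  then have "{0..} \<subseteq> {y. poly P y = 0}" using assms(1) by auto
  then have inf: "infinite {y. poly P y = 0}"
    by (rule infinite_super) (rule infinite_Ici)
  have "P = 0"
    by (rule ccontr) (rule notE[OF inf], rule poly_roots_finite)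
  moreover have "coeff P s = d s"
    using assms(2) by (simp add: P_def coeff_sum)
  ultimately show ?thesis by simp
qed

text \<open>If the degree exceeded \<open>j\<close>, then the reversed polynomial would be divisible by the indeterminate,
  although its constant term is the leading coefficient of \<open>P\<close>.\<close>

lemma degree_le_of_reversal:
  fixes P Q :: "real poly"
  assumes "\<And>z. z \<noteq> 0 \<Longrightarrow> poly Q z = z ^ j * poly P (inverse z)"
  shows "degree P \<le> j"
proof (rule ccontr)
  assume "\<not> degree P \<le> j"
  then have dg: "j < degree P" by simp
  then have P0: "P \<noteq> 0" by auto
  let ?k = "degree P - j"
  have refl: "poly (reflect_poly P) z = z ^ ?k * poly Q z" if "z \<noteq> 0" for z
  proof -
    have "z ^ ?k * z ^ j = z ^ degree P" 
      by (simp only: power_add[symmetric] le_add_diff_inverse2[OF less_imp_le[OF dg]])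
    then show ?thesis
      by (simp only: assms[OF that] poly_reflect_poly_nz[OF that] mult.assoc[symmetric])
  qed
  have "poly (reflect_poly P - monom 1 ?k * Q) z = 0" if "z \<noteq> 0" for z
    by (simp only: refl[OF that] poly_diff poly_mult poly_monom mult_1 diff_self)
  then have "- {0} \<subseteq> {z. poly (reflect_poly P - monom 1 ?k * Q) z = 0}" by auto
  moreover have "infinite (- {0::real})"
    by (simp add: infinite_UNIV_char_0 Compl_eq_Diff_UNIV)
  ultimately have inf: "infinite {z. poly (reflect_poly P - monom 1 ?k * Q) z = 0}"
    by (rule infinite_super)
  have "reflect_poly P - monom 1 ?k * Q = 0"
    by (rule ccontr) (rule notE[OF inf], rule poly_roots_finite)
  then have "reflect_poly P = monom 1 ?k * Q" by (rule eq_iff_diff_eq_0[THEN iffD2])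
  then have "poly (reflect_poly P) 0 = 0 ^ ?k * poly Q 0"
    by (simp only: poly_mult poly_monom mult_1)
  also have "(0::real) ^ ?k = 0" using dg by (simp add: power_0_left)
  finally show False using P0 by simp
qed

lemma orth_projection_line:
  fixes e :: "'a::euclidean_space"
  assumes "norm e = 1"
  shows "orth_projection (\<lambda>x. (x \<bullet> e) *\<^sub>R e) ((real DIM('a) - 1) / 2 - 1) (- 1 / 2)"
proof -
  have e: "e \<bullet> e = 1" using assms by (simp add: norm_eq_1)
  have lin: "linear (\<lambda>x. (x \<bullet> e) *\<^sub>R e)"
    by (rule linearI) (simp_all add: inner_add_left scaleR_add_left)
  have "(\<Sum>b\<in>Basis. ((b \<bullet> e) *\<^sub>R e) \<bullet> b) = (\<Sum>b\<in>Basis. (e \<bullet> b) * (e \<bullet> b))"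
    by (intro sum.cong refl) (simp add: inner_commute)
  also have "\<dots> = 1" unfolding euclidean_inner[symmetric] by (rule e)
  finally have tr: "(\<Sum>b\<in>Basis. ((b \<bullet> e) *\<^sub>R e) \<bullet> b) = 2 * (- 1 / 2 + 1)" by simp
  show ?thesis
    by (rule orth_projection.intro[OF lin _ _ tr]) (simp_all add: inner_commute e field_simps)
qed

text \<open>A polynomial that depends only on \<open>x \<bullet> e\<close> and \<open>|x|\<close> and is homogeneous of even degree is a combination of
  the monomials \<open>p\<^sup>i\<^sup>-\<^sup>l q\<^sup>l\<close> for the projection onto the line through \<open>e\<close>. Harmonicity is a two-term recurrence
  for the coefficients with nonvanishing factors, so all of them are determined by the first one,
  which is the value at \<open>e\<close>. This uniqueness takes the place of the irreducibility of the space of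
  harmonics.\<close>

theorem zonal_harmonic_eq_0:
  fixes f :: "'a::euclidean_space \<Rightarrow> real"
  assumes dim: "2 \<le> DIM('a)" and e: "norm e = 1"
    and f: "real_polynomial_function f" and hom: "\<And>c x. f (c *\<^sub>R x) = c ^ (2 * i) * f x"
    and harm: "\<And>x. laplacian f x = 0"
    and zonal: "\<And>x y. norm x = norm y \<Longrightarrow> x \<bullet> e = y \<bullet> e \<Longrightarrow> f x = f y"
    and fe: "f e = 0"
  shows "f x = 0"
proof -
  interpret orth_projection "\<lambda>x. (x \<bullet> e) *\<^sub>R e" "(real DIM('a) - 1) / 2 - 1" "- 1 / 2"
    by (rule orth_projection_line[OF e])
  let ?\<alpha> = "(real DIM('a) - 1) / 2 - 1" and ?\<beta> = "- 1 / 2 :: real"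
  have ee: "e \<bullet> e = 1" using e by (simp add: norm_eq_1)
  obtain w where w: "w \<noteq> 0" "orthogonal e w"
    by (rule orthogonal_to_vector_exists[OF dim])
  define u where "u = sgn w"
  have "norm u = 1" using w by (simp add: u_def norm_sgn)
  moreover have "e \<bullet> u = 0" using w by (simp add: u_def sgn_div_norm orthogonal_def)
  ultimately have u: "norm u = 1" "u \<bullet> u = 1" "u \<bullet> e = 0" "e \<bullet> u = 0"
    by (simp_all add: norm_eq_1 inner_commute)
  have inner: "(a *\<^sub>R e + b *\<^sub>R u) \<bullet> e = a" "(norm (a *\<^sub>R e + b *\<^sub>R u))\<^sup>2 = a\<^sup>2 + b\<^sup>2" for a b
    unfolding power2_norm_eq_inner by (simp_all add: inner_add_left inner_add_right u ee power2_eq_square)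
  have zonal2: "f x = f y" if "(norm x)\<^sup>2 = (norm y)\<^sup>2" "x \<bullet> e = y \<bullet> e" for x y
    by (rule zonal[OF _ that(2)]) (use that(1) in \<open>simp add: power2_eq_iff_nonneg\<close>)
  have line: "real_polynomial_function (\<lambda>z. f (a + z *\<^sub>R b))" for a b
  proof -
    have "polynomial_function (\<lambda>z. a + z *\<^sub>R b)"
      by (intro polynomial_function_add polynomial_function_const polynomial_function_bounded_linear
          bounded_linear_scaleR_left)
    from real_polynomial_function_compose[OF this f] show ?thesis by (simp add: o_def)
  qed
  \<comment> \<open>Restrictions of f to the lines e + z u and u + z e; by homogeneity they are reversals of
    each other up to a power, which bounds the degree of P.\<close>
  obtain P where P: "(\<lambda>z. f (e + z *\<^sub>R u)) = poly P"
    by (rule real_polynomial_function_imp_poly[OF line])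
  obtain Q where Q: "(\<lambda>z. f (u + z *\<^sub>R e)) = poly Q"
    by (rule real_polynomial_function_imp_poly[OF line])
  have degP: "degree P \<le> 2 * i"
  proof (rule degree_le_of_reversal)
    fix z :: real assume "z \<noteq> 0"
    then have eq: "u + z *\<^sub>R e = z *\<^sub>R (e + inverse z *\<^sub>R u)" by (simp add: scaleR_add_right)
    show "poly Q z = z ^ (2 * i) * poly P (inverse z)"
      unfolding P[symmetric] Q[symmetric] eq by (rule hom)
  qed
  \<comment> \<open>The reflection u \<mapsto> -u preserves f, so only even powers occur.\<close>
  have Pz: "poly P z = (\<Sum>l\<le>i. coeff P (2 * l) * (z\<^sup>2) ^ l)" for z
  proof -
    have alt: "poly P z = (\<Sum>l\<le>2 * i. coeff P l * z ^ l)" for z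
      unfolding poly_altdef using degP
      by (intro sum.mono_neutral_left) (auto simp: coeff_eq_0)
    have Pf: "poly P z = f (1 *\<^sub>R e + z *\<^sub>R u)" for z
      using fun_cong[OF P, of z] by simp
    have "poly P (- z) = poly P z"
      unfolding Pf by (rule zonal2) (simp_all only: inner power2_minus)
    then have "poly P z = (poly P z + poly P (- z)) / 2" by (simp only: field_sum_of_halves add_divide_distrib)
    also have "\<dots> = (\<Sum>l\<le>2 * i. coeff P l * ((z ^ l + (- z) ^ l) / 2))"
      unfolding alt sum.distrib[symmetric] sum_divide_distrib
      by (intro sum.cong refl) (simp add: distrib_left)
    also have "\<dots> = (\<Sum>l\<le>i. coeff P (2 * l) * ((z ^ (2 * l) + (- z) ^ (2 * l)) / 2))"
      by (rule sum_even_indices) simp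
    also have "\<dots> = (\<Sum>l\<le>i. coeff P (2 * l) * (z\<^sup>2) ^ l)"
      by (simp add: power_mult)
    finally show ?thesis .
  qed
  define b where "b l = coeff P (2 * l)" for l
  define F where "F x = (\<Sum>l\<le>i. b l * (p x ^ (i - l) * q x ^ l))" for x
  have p: "p x = (x \<bullet> e)\<^sup>2" for x
    by (simp add: p_def power2_eq_square)
  have q: "q x = (norm x)\<^sup>2 - (x \<bullet> e)\<^sup>2" for x
    unfolding q_def inner_diff_right power2_norm_eq_inner[symmetric] by (simp add: power2_eq_square)
  have q0: "q x \<ge> 0" for x
    using Cauchy_Schwarz_ineq[of x e] unfolding q power2_norm_eq_inner ee by simp
  have fF: "f x = F x" if t: "x \<bullet> e \<noteq> 0" for x
  proof -
    let ?t = "x \<bullet> e" and ?s = "sqrt (q x)"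
    have "f x = f (?t *\<^sub>R e + ?s *\<^sub>R u)"
      by (rule zonal2) (simp_all only: inner, simp add: q0, simp add: q)
    also have "?t *\<^sub>R e + ?s *\<^sub>R u = ?t *\<^sub>R (e + (?s / ?t) *\<^sub>R u)"
      using t by (simp add: scaleR_add_right)
    also have "f \<dots> = ?t ^ (2 * i) * poly P (?s / ?t)"
      by (simp only: hom P[symmetric])
    also have "\<dots> = (\<Sum>l\<le>i. b l * (?t ^ (2 * i) * ((?s / ?t)\<^sup>2) ^ l))"
      by (simp add: Pz b_def sum_distrib_left mult_ac)
    also have "\<dots> = F x"
      unfolding F_def
    proof (intro sum.cong refl)
      fix l assume "l \<in> {..i}"
      then have "i - l + l = i" by simp
      then have "p x ^ i = p x ^ (i - l) * p x ^ l" by (simp only: power_add[symmetric])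
      moreover have "((?s / ?t)\<^sup>2) ^ l = q x ^ l / p x ^ l"
        by (simp add: power_divide q0 p)
      moreover have "?t ^ (2 * i) = p x ^ i" by (simp add: p power_mult)
      ultimately show "b l * (?t ^ (2 * i) * ((?s / ?t)\<^sup>2) ^ l) = b l * (p x ^ (i - l) * q x ^ l)"
      proof -
        assume 1: "p x ^ i = p x ^ (i - l) * p x ^ l" and 2: "((?s / ?t)\<^sup>2) ^ l = q x ^ l / p x ^ l"
          and 3: "?t ^ (2 * i) = p x ^ i"
        have "p x ^ l \<noteq> 0" using t unfolding p by simp
        then have "p x ^ l * (q x ^ l / p x ^ l) = q x ^ l" by simp
        then show ?thesis unfolding 2 3 1 by (simp only: mult.assoc)
      qed
    qed
    finally show ?thesis .
  qed
  have rF: "real_polynomial_function F"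
    unfolding F_def[abs_def] by (intro real_polynomial_function_sum rpf_mult rpf_const rpf_monomial) auto
  \<comment> \<open>On the hyperplane orthogonal to e the identity follows by continuity.\<close>
  have fF': "f x = F x" for x
  proof (cases "x \<bullet> e = 0")
    case True
    let ?g = "\<lambda>r. f (x + r *\<^sub>R e) - F (x + r *\<^sub>R e)"
    have "continuous_on UNIV (\<lambda>x. f x - F x)"
      by (intro continuous_on_rpf real_polynomial_function_diff f rF)
    then have "continuous_on UNIV ?g"
      by (rule continuous_on_compose2[where g = "\<lambda>x. f x - F x"]) (auto intro!: continuous_intros)
    then have "isCont ?g 0" by (simp add: continuous_on_eq_continuous_at)
    then have lim: "(?g \<longlongrightarrow> ?g 0) (at 0)" unfolding isCont_def .
    have g0: "?g r = 0" if "r \<noteq> 0" for r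
      using fF[of "x + r *\<^sub>R e"] that True by (simp add: inner_add_left ee)
    have "eventually (\<lambda>r. ?g r = 0) (at 0)"
      unfolding eventually_at by (intro exI[of _ 1] conjI ballI impI g0) simp_all
    then have "(?g \<longlongrightarrow> 0) (at 0)"
      by (rule tendsto_eventually)
    from tendsto_unique[OF _ lim this] show ?thesis by simp
  qed (rule fF)
  have b0: "b 0 = 0"
  proof -
    have "F e = (\<Sum>l\<le>i. b l * 0 ^ l)"
      unfolding F_def by (simp add: p q ee e)
    also have "\<dots> = (\<Sum>l\<le>i. if l = 0 then b 0 else 0)"
      by (intro sum.cong refl) auto
    also have "\<dots> = b 0" by simp
    finally show ?thesis using fF'[of e] fe by simp
  qed
  have bl: "b l = 0" if "l \<le> i" for l
    using that
  proof (induction l)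
    case (Suc l)
    then obtain m where i: "i = Suc m" and l: "l \<le> m" by (cases i) auto
    let ?d = "\<lambda>s. 4 * (b s * real (Suc m - s) * (real (Suc m - s) + ?\<beta>)
          + b (Suc s) * (real s + 1) * (real s + 1 + ?\<alpha>))"
    have "f = (\<lambda>x. \<Sum>l\<le>Suc m. b l * (p x ^ (Suc m - l) * q x ^ l))"
      using fF' unfolding F_def i by (rule ext)
    then have lapF: "(\<Sum>s\<le>m. ?d s * (p x ^ (m - s) * q x ^ s)) = 0" for x
      using harm[of x] unfolding laplacian_monomial_sum[of b m x, symmetric] by (simp only:)
    have dl: "?d l = 0"
    proof (rule polynomial_sum_eq_0_imp_coeffs_0[OF _ l])
      fix y :: real assume "y \<ge> 0"
      have "p (1 *\<^sub>R e + sqrt y *\<^sub>R u) = 1" "q (1 *\<^sub>R e + sqrt y *\<^sub>R u) = y"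
        unfolding p q inner using \<open>y \<ge> 0\<close> by simp_all
      then show "(\<Sum>s\<le>m. ?d s * y ^ s) = 0"
        using lapF[of "1 *\<^sub>R e + sqrt y *\<^sub>R u"] by simp
    qed
    have bl: "b l = 0" by (rule Suc.IH) (rule Suc_leD[OF Suc.prems])
    have aux: "y = 0" if "4 * (0 + y) = 0" for y :: real using that by simp
    have "b (Suc l) * (real l + 1) * (real l + 1 + ?\<alpha>) = 0"
      by (rule aux[OF dl[unfolded bl mult_zero_left]])
    moreover have "real l + 1 + ?\<alpha> \<noteq> 0"
    proof -
      have "real DIM('a) \<ge> 2" using dim by simp
      then have "(real DIM('a) - 1) / 2 > 0" by simp
      then have "real l + (real DIM('a) - 1) / 2 > 0" by (rule add_nonneg_pos[OF of_nat_0_le_iff])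
      then have "real l + 1 + ?\<alpha> > 0" by (simp only: add_diff_eq diff_add_eq add.assoc add_diff_cancel_left' add_diff_cancel_right' algebra_simps)
      then show ?thesis by (rule less_imp_neq[symmetric])
    qed
    moreover have "real l + 1 \<noteq> 0" using of_nat_neq_0[of l] by (simp only: of_nat_Suc add.commute[of 1] simp_thms)
    ultimately show ?case by (simp only: mult_eq_0_iff simp_thms)
  qed (simp add: b0)
  show ?thesis unfolding fF' F_def by (intro sum.neutral ballI) (simp add: bl)
qed

section \<open>Spherical harmonics as functions on the sphere\<close>

text \<open>Functions that agree on the sphere with a polynomial; the values elsewhere are arbitrary, as they are
  for spherical harmonics.\<close>

definition sphere_poly :: "('a::euclidean_space \<Rightarrow> real) \<Rightarrow> bool" where
  "sphere_poly f \<longleftrightarrow> (\<exists>p. real_polynomial_function p \<and> (\<forall>x\<in>sphere 0 1. f x = p x))"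

lemma integral_sphere_cong:
  assumes "\<And>x. x \<in> sphere 0 1 \<Longrightarrow> f x = (g x :: real)"
  shows "integral\<^sup>L sphere_measure f = integral\<^sup>L sphere_measure g"
  using assms by (intro Bochner_Integration.integral_cong refl) simp

lemma integrable_sphere_poly:
  assumes "sphere_poly f"
  shows "integrable sphere_measure f"
proof -
  obtain p where p: "real_polynomial_function p" "\<And>x. x \<in> sphere 0 1 \<Longrightarrow> f x = p x"
    using assms unfolding sphere_poly_def by blast
  have "integrable sphere_measure f \<longleftrightarrow> integrable sphere_measure p"
    using p(2) by (intro Bochner_Integration.integrable_cong refl) simp
  then show ?thesis using integrable_sphere_rpf[OF p(1)] by (simp only:)
qed

lemma sphere_poly_mult:
  assumes "sphere_poly f" "sphere_poly g"
  shows "sphere_poly (\<lambda>x. f x * g x)"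
proof -
  obtain p q where "real_polynomial_function p" "\<forall>x\<in>sphere 0 1. f x = p x"
    "real_polynomial_function q" "\<forall>x\<in>sphere 0 1. g x = q x"
    using assms unfolding sphere_poly_def by blast
  then show ?thesis
    unfolding sphere_poly_def by (intro exI[of _ "\<lambda>x. p x * q x"]) (simp add: rpf_mult)
qed

lemma sphere_poly_sum:
  assumes "finite F" "\<And>i. i \<in> F \<Longrightarrow> sphere_poly (f i)"
  shows "sphere_poly (\<lambda>x. \<Sum>i\<in>F. c i * f i x)"
proof -
  obtain p where p: "\<And>i. i \<in> F \<Longrightarrow> real_polynomial_function (p i)"
    "\<And>i x. i \<in> F \<Longrightarrow> x \<in> sphere 0 1 \<Longrightarrow> f i x = p i x"
    using assms(2) unfolding sphere_poly_def by metis
  have "real_polynomial_function (\<lambda>x. \<Sum>i\<in>F. c i * p i x)"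
    using p(1) assms(1) by (intro real_polynomial_function_sum rpf_mult rpf_const) auto
  then show ?thesis
    unfolding sphere_poly_def by (intro exI[of _ "\<lambda>x. \<Sum>i\<in>F. c i * p i x"]) (simp add: p(2))
qed

lemma integral_sphere_poly_orthogonal:
  fixes f :: "'a::euclidean_space \<Rightarrow> real"
  assumes f: "sphere_poly f" and g: "orthogonal_transformation (g :: 'a \<Rightarrow> 'a)"
  shows "(\<integral>x. f (g x) \<partial>sphere_measure) = (\<integral>x. f x \<partial>sphere_measure)"
proof -
  obtain p where p: "real_polynomial_function p" "\<And>x. x \<in> sphere 0 1 \<Longrightarrow> f x = p x"
    using f unfolding sphere_poly_def by blast
  have gs: "g x \<in> sphere 0 1" if "x \<in> sphere 0 1" for x
    using that orthogonal_transformation_norm[OF g] by simp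
  have "(\<integral>x. f (g x) \<partial>sphere_measure) = (\<integral>x. p (g x) \<partial>sphere_measure)"
    by (intro integral_sphere_cong p(2) gs)
  also have "\<dots> = (\<integral>x. p x \<partial>sphere_measure)"
    by (rule integral_sphere_measure_orthogonal[OF g borel_measurable_continuous_onI[OF continuous_on_rpf[OF p(1)]]])
  also have "\<dots> = (\<integral>x. f x \<partial>sphere_measure)"
    by (intro integral_sphere_cong p(2)[symmetric])
  finally show ?thesis .
qed

lemma integral_sphere_sum_mult:
  assumes "finite F" "\<And>i. i \<in> F \<Longrightarrow> sphere_poly (f i)" "sphere_poly g"
  shows "(\<integral>x. (\<Sum>i\<in>F. c i * f i x) * g x \<partial>sphere_measure) = (\<Sum>i\<in>F. c i * (\<integral>x. f i x * g x \<partial>sphere_measure))"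
proof -
  have "(\<integral>x. (\<Sum>i\<in>F. c i * f i x) * g x \<partial>sphere_measure) = (\<integral>x. (\<Sum>i\<in>F. c i * (f i x * g x)) \<partial>sphere_measure)"
    by (simp only: sum_distrib_right mult.assoc)
  also have "\<dots> = (\<Sum>i\<in>F. (\<integral>x. c i * (f i x * g x) \<partial>sphere_measure))"
    by (intro Bochner_Integration.integral_sum integrable_mult_right integrable_sphere_poly sphere_poly_mult assms)
  finally show ?thesis by simp
qed

lemma spherical_harmonicE:
  assumes "spherical_harmonic j f"
  obtains p where "real_polynomial_function p" "\<And>c x. p (c *\<^sub>R x) = c ^ j * p x" "homog j p"
    "\<And>x. laplacian p x = 0" "\<And>x. x \<in> sphere 0 1 \<Longrightarrow> f x = p x"
  using assms unfolding spherical_harmonic_def homog_def by blast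

lemma spherical_harmonic_imp_sphere_poly: "spherical_harmonic j f \<Longrightarrow> sphere_poly f"
  unfolding spherical_harmonic_def sphere_poly_def by blast

lemma spherical_harmonic_sum:
  assumes "finite F" "\<And>i. i \<in> F \<Longrightarrow> spherical_harmonic j (f i)"
  shows "spherical_harmonic j (\<lambda>x. \<Sum>i\<in>F. c i * f i x)"
proof -
  obtain p where p: "\<And>i. i \<in> F \<Longrightarrow> real_polynomial_function (p i)"
    "\<And>i c x. i \<in> F \<Longrightarrow> p i (c *\<^sub>R x) = c ^ j * p i x"
    "\<And>i x. i \<in> F \<Longrightarrow> laplacian (p i) x = 0"
    "\<And>i x. i \<in> F \<Longrightarrow> x \<in> sphere 0 1 \<Longrightarrow> f i x = p i x"
    using assms(2) unfolding spherical_harmonic_def by metis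
  have "real_polynomial_function (\<lambda>x. \<Sum>i\<in>F. c i * p i x)"
    using p(1) assms(1) by (intro real_polynomial_function_sum rpf_mult rpf_const) auto
  moreover have "(\<Sum>i\<in>F. c i * p i (r *\<^sub>R x)) = r ^ j * (\<Sum>i\<in>F. c i * p i x)" for r x
    by (simp add: p(2) sum_distrib_left mult_ac)
  moreover have "laplacian (\<lambda>x. \<Sum>i\<in>F. c i * p i x) x = 0" for x
    by (subst laplacian_sum[OF assms(1) p(1)]) (simp_all add: p(3))
  ultimately show ?thesis
    unfolding spherical_harmonic_def by (intro exI[of _ "\<lambda>x. \<Sum>i\<in>F. c i * p i x"]) (simp add: p(4))
qed

lemma spherical_harmonic_diff_cmult:
  assumes f: "spherical_harmonic j f" and g: "spherical_harmonic j g"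
  shows "spherical_harmonic j (\<lambda>x. f x - c * g x)"
proof -
  have "spherical_harmonic j (\<lambda>x. \<Sum>b\<in>UNIV. (if b then 1 else - c) * (if b then f else g) x)"
    by (rule spherical_harmonic_sum) (simp_all add: f g)
  then show ?thesis by (simp add: UNIV_bool)
qed

lemma spherical_harmonic_orthogonal_comp:
  fixes f :: "'a::euclidean_space \<Rightarrow> real" and g :: "'a \<Rightarrow> 'a"
  assumes f: "spherical_harmonic j f" and g: "orthogonal_transformation g"
  shows "spherical_harmonic j (\<lambda>x. f (g x))"
proof -
  obtain p where p: "real_polynomial_function p" "\<And>c x. p (c *\<^sub>R x) = c ^ j * p x" "homog j p"
    "\<And>x. laplacian p x = 0" "\<And>x. x \<in> sphere 0 1 \<Longrightarrow> f x = p x"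
    using spherical_harmonicE[OF f] by blast
  have lin: "linear g" using g by (rule orthogonal_transformation_linear)
  have "real_polynomial_function (\<lambda>x. p (g x))" by (rule rpf_linear_comp[OF p(1) lin])
  moreover have "p (g (c *\<^sub>R x)) = c ^ j * p (g x)" for c x
    by (simp only: linear_scale[OF lin] p(2))
  moreover have "laplacian (\<lambda>x. p (g x)) x = 0" for x
    by (simp only: laplacian_orthogonal_comp[OF p(1) g] p(4))
  moreover have "f (g x) = p (g x)" if "x \<in> sphere 0 1" for x
    using that orthogonal_transformation_norm[OF g] by (intro p(5)) simp
  ultimately show ?thesis
    unfolding spherical_harmonic_def by (intro exI[of _ "\<lambda>x. p (g x)"]) simp
qed

lemma spherical_harmonics_orthogonal:
  fixes f g :: "'a::euclidean_space \<Rightarrow> real"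
  assumes f: "spherical_harmonic i f" and g: "spherical_harmonic j g" and "i \<noteq> j" and dim: "2 \<le> DIM('a)"
  shows "(\<integral>x. f x * g x \<partial>sphere_measure) = 0"
proof -
  obtain p where p: "real_polynomial_function p" "\<And>c x. p (c *\<^sub>R x) = c ^ i * p x" "homog i p"
    "\<And>x. laplacian p x = 0" "\<And>x. x \<in> sphere 0 1 \<Longrightarrow> f x = p x"
    using spherical_harmonicE[OF f] by blast
  obtain q where q: "real_polynomial_function q" "\<And>c x. q (c *\<^sub>R x) = c ^ j * q x" "homog j q"
    "\<And>x. laplacian q x = 0" "\<And>x. x \<in> sphere 0 1 \<Longrightarrow> g x = q x"
    using spherical_harmonicE[OF g] by blast
  have "i + j \<ge> 1" using \<open>i \<noteq> j\<close> by linarith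
  then have "DIM('a) + i + j \<noteq> 2" using dim by linarith
  then have "real (DIM('a) + i + j) \<noteq> 2" by linarith
  then have "real DIM('a) + i + j - 2 \<noteq> 0" by simp
  moreover have "real j - real i \<noteq> 0" using \<open>i \<noteq> j\<close> by simp
  moreover have "(real DIM('a) + i + j - 2) * (real j - real i) * (\<integral>x. p x * q x \<partial>sphere_measure) = 0"
    using integral_sphere_second_green[OF p(1,3) q(1,3)] by (simp add: p(4) q(4))
  ultimately have "(\<integral>x. p x * q x \<partial>sphere_measure) = 0" by (simp only: mult_eq_0_iff simp_thms)
  moreover have "(\<integral>x. f x * g x \<partial>sphere_measure) = (\<integral>x. p x * q x \<partial>sphere_measure)"
    by (rule integral_sphere_cong) (simp only: p(5) q(5))
  ultimately show ?thesis by (simp only:)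
qed

lemma spherical_harmonic_square_0:
  fixes f :: "'a::euclidean_space \<Rightarrow> real"
  assumes f: "spherical_harmonic j f" and 0: "(\<integral>x. (f x)\<^sup>2 \<partial>sphere_measure) = 0" and x: "x \<in> sphere 0 1"
  shows "f x = 0"
proof -
  obtain p where p: "real_polynomial_function p" "\<And>c x. p (c *\<^sub>R x) = c ^ j * p x" "homog j p"
    "\<And>x. laplacian p x = 0" "\<And>x. x \<in> sphere 0 1 \<Longrightarrow> f x = p x"
    using spherical_harmonicE[OF f] by blast
  have "(\<integral>x. (p x)\<^sup>2 \<partial>sphere_measure) = (\<integral>x. (f x)\<^sup>2 \<partial>sphere_measure)"
    by (rule integral_sphere_cong) (simp only: p(5))
  then show ?thesis
    using integral_square_sphere_eq_0D[OF continuous_on_rpf[OF p(1)] _ x] 0 p(5)[OF x] by simp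
qed

text \<open>The version of the uniqueness theorem in which the symmetry is known on the sphere only; homogeneity
  carries it over to all vectors of equal length.\<close>

lemma spherical_harmonic_zonal_0:
  fixes f :: "'a::euclidean_space \<Rightarrow> real"
  assumes f: "spherical_harmonic (2 * i) f" and e: "e \<in> sphere 0 1" and dim: "2 \<le> DIM('a)"
    and zonal: "\<And>x y. x \<in> sphere 0 1 \<Longrightarrow> y \<in> sphere 0 1 \<Longrightarrow> x \<bullet> e = y \<bullet> e \<Longrightarrow> f x = f y"
    and fe: "f e = 0" and x: "x \<in> sphere 0 1"
  shows "f x = 0"
proof -
  obtain p where p: "real_polynomial_function p" "\<And>c x. p (c *\<^sub>R x) = c ^ (2 * i) * p x" "homog (2 * i) p"
    "\<And>x. laplacian p x = 0" "\<And>x. x \<in> sphere 0 1 \<Longrightarrow> f x = p x"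
    using spherical_harmonicE[OF f] by blast
  have "p u = p v" if nm: "norm u = norm v" and ie: "u \<bullet> e = v \<bullet> e" for u v
  proof (cases "v = 0")
    case False
    define r where "r = norm v"
    have r: "r > 0" using False by (simp add: r_def)
    define a b where "a = inverse r *\<^sub>R u" and "b = inverse r *\<^sub>R v"
    have "a \<in> sphere 0 1" "b \<in> sphere 0 1" using r nm by (simp_all add: a_def b_def r_def)
    moreover have "a \<bullet> e = b \<bullet> e" by (simp add: a_def b_def ie)
    ultimately have "p a = p b" using zonal p(5) by metis
    moreover have "u = r *\<^sub>R a" "v = r *\<^sub>R b" using r by (simp_all add: a_def b_def)
    ultimately show ?thesis by (simp only: p(2))
  qed (use nm in simp)
  moreover have "norm e = 1" using e by simp
  moreover have "p e = 0" using fe p(5)[OF e] by simp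
  ultimately have "p x = 0"
    using zonal_harmonic_eq_0[OF dim _ p(1) p(2) p(4)] by blast
  then show ?thesis using p(5)[OF x] by simp
qed

text \<open>The reflection in the hyperplane orthogonal to \<open>x - y\<close>. It provides transitivity on the sphere and,
  by the last property, transitivity of the stabilizer of \<open>e\<close> on each parallel.\<close>

lemma orthogonal_reflection_exists:
  fixes x y :: "'a::euclidean_space"
  assumes "norm x = norm y"
  obtains g where "orthogonal_transformation (g :: 'a \<Rightarrow> 'a)" "g x = y" "\<And>e. x \<bullet> e = y \<bullet> e \<Longrightarrow> g e = e"
proof (cases "x = y")
  case True
  show ?thesis by (rule that[of "\<lambda>z. z"]) (simp_all add: True)
next
  case False
  define w where "w = sgn (x - y)"
  have ww: "w \<bullet> w = 1" using False by (simp add: w_def norm_eq_1[symmetric] norm_sgn)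
  define g where "g z = z - (2 * (z \<bullet> w)) *\<^sub>R w" for z
  show ?thesis
  proof (rule that[of g])
    have "g u \<bullet> g v = u \<bullet> v" for u v
      by (simp add: g_def inner_diff_left inner_diff_right ww inner_commute[of w v])
    moreover have "linear g"
      by (rule linearI) (simp_all add: g_def inner_add_left distrib_left scaleR_add_left scaleR_diff_right)
    ultimately show "orthogonal_transformation g"
      unfolding orthogonal_transformation_def by blast
    have xw: "w = inverse (norm (x - y)) *\<^sub>R (x - y)" by (simp add: w_def sgn_div_norm)
    have n0: "norm (x - y) \<noteq> 0" using False by simp
    have "(norm (x - y))\<^sup>2 = 2 * (x \<bullet> (x - y))"
    proof -
      have "x \<bullet> x = y \<bullet> y" using assms by (simp only: norm_eq_sqrt_inner real_sqrt_eq_iff)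
      then show ?thesis
        unfolding power2_norm_eq_inner by (simp only: inner_diff_left inner_diff_right inner_commute[of y x]) simp
    qed
    then have "2 * (inverse (norm (x - y)) * (x \<bullet> (x - y))) * inverse (norm (x - y)) = 1"
    proof -
      assume "(norm (x - y))\<^sup>2 = 2 * (x \<bullet> (x - y))"
      then have "2 * (inverse (norm (x - y)) * (x \<bullet> (x - y))) * inverse (norm (x - y))
          = (norm (x - y))\<^sup>2 * (inverse (norm (x - y)) * inverse (norm (x - y)))"
        by (simp only: mult_ac)
      also have "\<dots> = (norm (x - y) * inverse (norm (x - y))) * (norm (x - y) * inverse (norm (x - y)))"
        by (simp only: power2_eq_square mult_ac)
      also have "\<dots> = 1" by (simp only: right_inverse[OF n0] mult_1)
      finally show ?thesis .
    qed
    then have "(2 * (x \<bullet> w)) *\<^sub>R w = x - y"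
      unfolding xw inner_scaleR_right scaleR_scaleR by simp
    then show "g x = y" by (simp add: g_def)
    fix e assume "x \<bullet> e = y \<bullet> e"
    then have "e \<bullet> w = 0" by (simp add: xw inner_diff_right inner_commute)
    then show "g e = e" by (simp add: g_def)
  qed
qed

section \<open>The reproducing kernel and invariant kernels\<close>

text \<open>An orthonormal basis of \<open>L\<^sup>2\<close> of the sphere that consists of harmonics, with the finite index set \<open>L j\<close> in
  degree \<open>j\<close>. That the members of degree \<open>j\<close> span all harmonics of degree \<open>j\<close> is a consequence of completeness.\<close>

locale harmonic_basis =
  fixes L :: "nat \<Rightarrow> nat set" and Y :: "nat \<Rightarrow> nat \<Rightarrow> 'a::euclidean_space \<Rightarrow> real"
  assumes dim: "2 \<le> DIM('a)"
    and finite_L: "finite (L j)"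
    and harmonic_Y: "l \<in> L j \<Longrightarrow> spherical_harmonic j (Y j l)"
    and basis_Y: "orthonormal_basis sphere_measure {(j, l). l \<in> L j} (\<lambda>(j, l). Y j l)"
begin

lemma sphere_poly_Y: "l \<in> L j \<Longrightarrow> sphere_poly (Y j l)"
  by (rule spherical_harmonic_imp_sphere_poly[OF harmonic_Y])

lemma integral_YY:
  assumes "l \<in> L j" "l' \<in> L j'"
  shows "(\<integral>x. Y j l x * Y j' l' x \<partial>sphere_measure) = (if j = j' \<and> l = l' then 1 else 0)"
proof -
  have "\<forall>i\<in>{(j, l). l \<in> L j}. \<forall>i'\<in>{(j, l). l \<in> L j}.
      (\<integral>x. (case i of (j, l) \<Rightarrow> Y j l) x * (case i' of (j, l) \<Rightarrow> Y j l) x \<partial>sphere_measure) = (if i = i' then 1 else 0)"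
    using basis_Y unfolding orthonormal_basis_def orthonormal_family_def by (rule conjunct2[OF conjunct1])
  from bspec[OF bspec[OF this, of "(j, l)"], of "(j', l')"] assms show ?thesis by simp
qed

text \<open>Such a harmonic is orthogonal to the whole basis, because different degrees are orthogonal. Subtracting
  a combination of basis elements can therefore only increase its norm, so completeness forces the norm of
  \<open>w\<close> to vanish.\<close>

lemma harmonic_orthogonal_to_basis_0:
  assumes w: "spherical_harmonic j w" and 0: "\<And>l. l \<in> L j \<Longrightarrow> (\<integral>x. w x * Y j l x \<partial>sphere_measure) = 0"
    and x: "x \<in> sphere 0 1"
  shows "w x = 0"
proof (rule spherical_harmonic_square_0[OF w _ x])
  have spw: "sphere_poly w" by (rule spherical_harmonic_imp_sphere_poly[OF w])
  have orth0: "(\<integral>x. w x * Y j' l x \<partial>sphere_measure) = 0" if "l \<in> L j'" for j' l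
  proof (cases "j = j'")
    case True
    then show ?thesis using 0 that by blast
  next
    case False
    show ?thesis by (rule spherical_harmonics_orthogonal[OF w harmonic_Y[OF that] False dim])
  qed
  have w2: "sphere_poly (\<lambda>x. w x * w x)" by (rule sphere_poly_mult[OF spw spw])
  have iw: "integrable sphere_measure (\<lambda>x. (w x)\<^sup>2)"
    unfolding power2_eq_square by (rule integrable_sphere_poly[OF w2])
  have sq: "square_integrable sphere_measure w"
    unfolding square_integrable_def using iw borel_measurable_integrable[OF integrable_sphere_poly[OF spw]] by blast
  have le: "(\<integral>x. (w x)\<^sup>2 \<partial>sphere_measure) < \<epsilon>" if "\<epsilon> > 0" for \<epsilon>
  proof -
    obtain F c where F: "finite F" "F \<subseteq> {(j, l). l \<in> L j}"
      and c: "(\<integral>x. (w x - (\<Sum>i\<in>F. c i * (case i of (j, l) \<Rightarrow> Y j l) x))\<^sup>2 \<partial>sphere_measure) < \<epsilon>"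
      using basis_Y sq \<open>\<epsilon> > 0\<close> unfolding orthonormal_basis_def by blast
    define e where "e i = (case i of (j, l) \<Rightarrow> Y j l)" for i :: "nat \<times> nat"
    have e: "sphere_poly (e i)" if "i \<in> F" for i
      using F(2) that sphere_poly_Y unfolding e_def by (cases i) auto
    define S where "S x = (\<Sum>i\<in>F. c i * e i x)" for x
    have S: "sphere_poly S" unfolding S_def[abs_def] by (rule sphere_poly_sum[OF F(1) e])
    have "(\<integral>x. S x * w x \<partial>sphere_measure) = (\<Sum>i\<in>F. c i * (\<integral>x. e i x * w x \<partial>sphere_measure))"
      unfolding S_def by (rule integral_sphere_sum_mult[OF F(1) e spw])
    also have "\<dots> = 0"
    proof (intro sum.neutral ballI)
      fix i assume i: "i \<in> F"
      then obtain j' l where jl: "i = (j', l)" "l \<in> L j'" using F(2) by auto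
      have "(\<integral>x. e i x * w x \<partial>sphere_measure) = 0"
        using orth0[OF jl(2)] by (simp add: e_def jl(1) mult.commute)
      then show "c i * (\<integral>x. e i x * w x \<partial>sphere_measure) = 0" by simp
    qed
    finally have Sw: "(\<integral>x. S x * w x \<partial>sphere_measure) = 0" .
    have int: "integrable sphere_measure (\<lambda>x. S x * w x)" "integrable sphere_measure (\<lambda>x. S x * S x)"
      by (intro integrable_sphere_poly sphere_poly_mult S spw)+
    have "(\<integral>x. (w x - S x)\<^sup>2 \<partial>sphere_measure) = (\<integral>x. (w x)\<^sup>2 + (S x * S x - 2 * (S x * w x)) \<partial>sphere_measure)"
      by (intro Bochner_Integration.integral_cong refl) (simp add: power2_eq_square algebra_simps)
    also have "\<dots> = (\<integral>x. (w x)\<^sup>2 \<partial>sphere_measure) + ((\<integral>x. S x * S x \<partial>sphere_measure) - 2 * (\<integral>x. S x * w x \<partial>sphere_measure))"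
      using iw int by simp
    also have "\<dots> \<ge> (\<integral>x. (w x)\<^sup>2 \<partial>sphere_measure)"
    proof -
      have "0 \<le> (\<integral>x. S x * S x \<partial>sphere_measure)" by (rule Bochner_Integration.integral_nonneg) simp
      then show ?thesis unfolding Sw by simp
    qed
    finally show ?thesis using c unfolding S_def e_def by linarith
  qed
  have "0 \<le> (\<integral>x. (w x)\<^sup>2 \<partial>sphere_measure)" by (rule Bochner_Integration.integral_nonneg) simp
  then show "(\<integral>x. (w x)\<^sup>2 \<partial>sphere_measure) = 0"
    using le[of "\<integral>x. (w x)\<^sup>2 \<partial>sphere_measure"] by linarith
qed

lemma harmonic_expansion:
  assumes h: "spherical_harmonic j h" and x: "x \<in> sphere 0 1"
  shows "h x = (\<Sum>l\<in>L j. (\<integral>x. h x * Y j l x \<partial>sphere_measure) * Y j l x)"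
proof -
  define d where "d l = (\<integral>x. h x * Y j l x \<partial>sphere_measure)" for l
  define S where "S x = (\<Sum>l\<in>L j. d l * Y j l x)" for x
  have S: "spherical_harmonic j S"
    unfolding S_def[abs_def] by (rule spherical_harmonic_sum[OF finite_L harmonic_Y])
  have w: "spherical_harmonic j (\<lambda>x. h x - 1 * S x)" by (rule spherical_harmonic_diff_cmult[OF h S])
  have "h x - 1 * S x = 0"
  proof (rule harmonic_orthogonal_to_basis_0[OF w _ x])
    fix l assume l: "l \<in> L j"
    note sp = spherical_harmonic_imp_sphere_poly[OF h] spherical_harmonic_imp_sphere_poly[OF S] sphere_poly_Y[OF l]
    have "(\<integral>x. S x * Y j l x \<partial>sphere_measure) = (\<Sum>l'\<in>L j. d l' * (\<integral>x. Y j l' x * Y j l x \<partial>sphere_measure))"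
      unfolding S_def by (rule integral_sphere_sum_mult[OF finite_L sphere_poly_Y sp(3)])
    also have "\<dots> = (\<Sum>l'\<in>L j. if l' = l then d l else 0)"
      by (intro sum.cong refl) (simp add: integral_YY l)
    also have "\<dots> = d l" using l finite_L by simp
    finally have "(\<integral>x. S x * Y j l x \<partial>sphere_measure) = d l" .
    moreover have "(\<integral>x. (h x - 1 * S x) * Y j l x \<partial>sphere_measure)
        = (\<integral>x. h x * Y j l x \<partial>sphere_measure) - (\<integral>x. S x * Y j l x \<partial>sphere_measure)"
      unfolding left_diff_distrib mult_1
      by (intro Bochner_Integration.integral_diff integrable_sphere_poly sphere_poly_mult sp)
    ultimately show "(\<integral>x. (h x - 1 * S x) * Y j l x \<partial>sphere_measure) = 0" by (simp add: d_def)
  qed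
  then show ?thesis unfolding S_def d_def by simp
qed

text \<open>The reproducing kernel of the space of harmonics of degree \<open>j\<close>, the zonal kernel.\<close>

definition Z :: "nat \<Rightarrow> 'a \<Rightarrow> 'a \<Rightarrow> real" where
  "Z j x y = (\<Sum>l\<in>L j. Y j l x * Y j l y)"

lemma harmonic_Z: "spherical_harmonic j (\<lambda>x. Z j x y)"
proof -
  have "spherical_harmonic j (\<lambda>x. \<Sum>l\<in>L j. Y j l y * Y j l x)"
    by (rule spherical_harmonic_sum[OF finite_L harmonic_Y])
  then show ?thesis by (simp add: Z_def mult.commute)
qed

lemma Z_reproducing:
  assumes h: "spherical_harmonic j h" and y: "y \<in> sphere 0 1"
  shows "(\<integral>x. Z j x y * h x \<partial>sphere_measure) = h y"
proof -
  have "(\<integral>x. Z j x y * h x \<partial>sphere_measure) = (\<integral>x. (\<Sum>l\<in>L j. Y j l y * Y j l x) * h x \<partial>sphere_measure)"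
    by (simp add: Z_def mult.commute)
  also have "\<dots> = (\<Sum>l\<in>L j. Y j l y * (\<integral>x. Y j l x * h x \<partial>sphere_measure))"
    by (rule integral_sphere_sum_mult[OF finite_L sphere_poly_Y spherical_harmonic_imp_sphere_poly[OF h]])
  also have "\<dots> = h y"
    unfolding harmonic_expansion[OF h y] by (simp add: mult.commute)
  finally show ?thesis .
qed

text \<open>Invariance does not follow termwise. Both sides are harmonics in \<open>x\<close>, and their coefficients are
  compared by means of the reproducing property and the rotation invariance of the measure.\<close>

lemma Z_orthogonal_invariant:
  assumes g: "orthogonal_transformation (g :: 'a \<Rightarrow> 'a)" and x: "x \<in> sphere 0 1" and y: "y \<in> sphere 0 1"
  shows "Z j (g x) (g y) = Z j x y"
proof -
  define h where "h = inv g"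
  have h: "orthogonal_transformation h" and hg: "h (g z) = z" for z
    unfolding h_def using g by (simp_all add: orthogonal_transformation_inv orthogonal_transformation_inj inv_f_f)
  have gy: "g y \<in> sphere 0 1" using y orthogonal_transformation_norm[OF g] by simp
  have W: "spherical_harmonic j (\<lambda>x. Z j (g x) (g y))"
    by (rule spherical_harmonic_orthogonal_comp[OF harmonic_Z g])
  have coef: "(\<integral>x. Z j (g x) (g y) * Y j l x \<partial>sphere_measure) = Y j l y" if l: "l \<in> L j" for l
  proof -
    have Yh: "spherical_harmonic j (\<lambda>x. Y j l (h x))"
      by (rule spherical_harmonic_orthogonal_comp[OF harmonic_Y[OF l] h])
    have sp: "sphere_poly (\<lambda>x. Z j x (g y) * Y j l (h x))"
      by (intro sphere_poly_mult spherical_harmonic_imp_sphere_poly[of j] harmonic_Z Yh)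
    have "(\<integral>x. Z j (g x) (g y) * Y j l x \<partial>sphere_measure) = (\<integral>x. Z j (g x) (g y) * Y j l (h (g x)) \<partial>sphere_measure)"
      by (simp only: hg)
    also have "\<dots> = (\<integral>x. Z j x (g y) * Y j l (h x) \<partial>sphere_measure)"
      by (rule integral_sphere_poly_orthogonal[OF sp g])
    also have "\<dots> = Y j l (h (g y))" by (rule Z_reproducing[OF Yh gy])
    finally show ?thesis by (simp only: hg)
  qed
  have "Z j (g x) (g y) = (\<Sum>l\<in>L j. (\<integral>x. Z j (g x) (g y) * Y j l x \<partial>sphere_measure) * Y j l x)"
    by (rule harmonic_expansion[OF W x])
  also have "\<dots> = (\<Sum>l\<in>L j. Y j l y * Y j l x)"
    by (intro sum.cong refl) (simp only: coef)
  also have "\<dots> = Z j x y" by (simp only: Z_def mult.commute)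
  finally show ?thesis .
qed

text \<open>The diagonal is constant by transitivity of the orthogonal group, and its integral is the trace.\<close>

lemma Z_diagonal:
  assumes y: "y \<in> sphere 0 1"
  shows "Z j y y = card (L j)"
proof -
  interpret prob_space "sphere_measure :: 'a measure" by (rule prob_space_sphere_measure)
  have const: "Z j x x = Z j y y" if x: "x \<in> sphere 0 1" for x
  proof -
    obtain g where "orthogonal_transformation (g :: 'a \<Rightarrow> 'a)" "g x = y"
      using orthogonal_reflection_exists[of x y] x y by auto
    then show ?thesis using Z_orthogonal_invariant[OF _ x x] by metis
  qed
  have "Z j y y = (\<integral>x. Z j y y \<partial>(sphere_measure :: 'a measure))"
    using prob_space by simp
  also have "\<dots> = (\<integral>x. Z j x x \<partial>sphere_measure)"
    by (rule integral_sphere_cong) (simp only: const)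
  also have "\<dots> = (\<Sum>l\<in>L j. (\<integral>x. Y j l x * Y j l x \<partial>sphere_measure))"
    unfolding Z_def
    by (intro Bochner_Integration.integral_sum integrable_sphere_poly sphere_poly_mult sphere_poly_Y)
  also have "\<dots> = (\<Sum>l\<in>L j. 1)" by (intro sum.cong refl) (simp add: integral_YY)
  finally show ?thesis by simp
qed

text \<open>Schur's lemma for the harmonics of even degree, in coordinates. For fixed \<open>y\<close>, the difference of \<open>G\<close> and
  the multiple of \<open>Z\<close> with the same diagonal value is a zonal harmonic about \<open>y\<close> that vanishes at \<open>y\<close>, hence
  it is zero. Comparing coefficients of \<open>G = c Z\<close> gives the claim, also for \<open>j \<noteq> j'\<close>, since then the basis
  functions in \<open>x\<close> and in \<open>y\<close> are orthogonal.\<close>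

theorem invariant_kernel_coefficients:
  assumes even: "even j" and ne: "L j \<noteq> {}"
    and G: "\<And>x y. G x y = (\<Sum>a\<in>L j. \<Sum>b\<in>L j'. M a b * Y j a x * Y j' b y)"
    and inv: "\<And>g x y. orthogonal_transformation g \<Longrightarrow> x \<in> sphere 0 1 \<Longrightarrow> y \<in> sphere 0 1 \<Longrightarrow> G (g x) (g y) = G x y"
  obtains c where "\<And>a b. a \<in> L j \<Longrightarrow> b \<in> L j' \<Longrightarrow> M a b = (if j = j' \<and> a = b then c else 0)"
proof -
  obtain i where i: "j = 2 * i" using even by blast
  have card: "real (card (L j)) \<noteq> 0" using ne finite_L by simp
  obtain e :: 'a where e: "e \<in> sphere 0 1"
    using vector_choose_size[of 1] by auto
  \<comment> \<open>The multiple of the reproducing kernel with the same value on the diagonal.\<close>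
  define c where "c = G e e / card (L j)"
  have Geq: "G x y = c * Z j x y" if x: "x \<in> sphere 0 1" and y: "y \<in> sphere 0 1" for x y
  proof -
    have diag: "G y y = G e e"
    proof -
      obtain g where "orthogonal_transformation (g :: 'a \<Rightarrow> 'a)" "g y = e"
        using orthogonal_reflection_exists[of y e] e y by auto
      then show ?thesis using inv[OF _ y y] by metis
    qed
    have hG: "spherical_harmonic j (\<lambda>x. G x y)"
    proof -
      have "spherical_harmonic j (\<lambda>x. \<Sum>a\<in>L j. (\<Sum>b\<in>L j'. M a b * Y j' b y) * Y j a x)"
        by (rule spherical_harmonic_sum[OF finite_L harmonic_Y])
      then show ?thesis unfolding G by (simp add: sum_distrib_left sum_distrib_right mult_ac)
    qed
    have "G x y - c * Z j x y = 0"
    proof (rule spherical_harmonic_zonal_0[OF _ y dim _ _ x])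
      show "spherical_harmonic (2 * i) (\<lambda>x. G x y - c * Z j x y)"
        using spherical_harmonic_diff_cmult[OF hG harmonic_Z] unfolding i .
      show "G y y - c * Z j y y = 0"
        unfolding diag Z_diagonal[OF y] c_def using card by simp
      fix u v :: 'a assume u: "u \<in> sphere 0 1" and v: "v \<in> sphere 0 1" and uv: "u \<bullet> y = v \<bullet> y"
      have "norm u = norm v" using u v by simp
      then obtain g where g: "orthogonal_transformation (g :: 'a \<Rightarrow> 'a)" "g u = v" "g y = y"
        using orthogonal_reflection_exists[of u v] uv by metis
      show "G u y - c * Z j u y = G v y - c * Z j v y"
        using inv[OF g(1) u y] Z_orthogonal_invariant[OF g(1) u y] unfolding g(2,3) by simp
    qed
    then show ?thesis by simp
  qed
  show ?thesis
  proof (rule that[of c])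
    fix a b assume a: "a \<in> L j" and b: "b \<in> L j'"
    have row: "(\<Sum>b\<in>L j'. M a b * Y j' b y) = c * Y j a y" if y: "y \<in> sphere 0 1" for y
    proof -
      have "(\<integral>x. G x y * Y j a x \<partial>sphere_measure)
        = (\<integral>x. (\<Sum>a'\<in>L j. (\<Sum>b\<in>L j'. M a' b * Y j' b y) * Y j a' x) * Y j a x \<partial>sphere_measure)"
        unfolding G by (simp add: sum_distrib_left sum_distrib_right mult_ac)
      also have "\<dots> = (\<Sum>a'\<in>L j. (\<Sum>b\<in>L j'. M a' b * Y j' b y) * (\<integral>x. Y j a' x * Y j a x \<partial>sphere_measure))"
        by (rule integral_sphere_sum_mult[OF finite_L sphere_poly_Y sphere_poly_Y[OF a]])
      also have "\<dots> = (\<Sum>a'\<in>L j. if a' = a then (\<Sum>b\<in>L j'. M a b * Y j' b y) else 0)"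
        by (intro sum.cong refl) (simp add: integral_YY a)
      also have "\<dots> = (\<Sum>b\<in>L j'. M a b * Y j' b y)" using a finite_L by simp
      finally have 1: "(\<integral>x. G x y * Y j a x \<partial>sphere_measure) = (\<Sum>b\<in>L j'. M a b * Y j' b y)" .
      have "(\<integral>x. G x y * Y j a x \<partial>sphere_measure) = (\<integral>x. c * (Z j x y * Y j a x) \<partial>sphere_measure)"
        by (rule integral_sphere_cong) (simp add: Geq[OF _ y])
      also have "\<dots> = c * Y j a y" by (simp add: Z_reproducing[OF harmonic_Y[OF a] y])
      finally show ?thesis using 1 by simp
    qed
    have "(\<integral>y. (\<Sum>b'\<in>L j'. M a b' * Y j' b' y) * Y j' b y \<partial>sphere_measure)
        = (\<Sum>b'\<in>L j'. M a b' * (\<integral>y. Y j' b' y * Y j' b y \<partial>sphere_measure))"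
      by (rule integral_sphere_sum_mult[OF finite_L sphere_poly_Y sphere_poly_Y[OF b]])
    also have "\<dots> = (\<Sum>b'\<in>L j'. if b' = b then M a b else 0)"
      by (intro sum.cong refl) (simp add: integral_YY b)
    also have "\<dots> = M a b" using b finite_L by simp
    finally have "M a b = (\<integral>y. (\<Sum>b'\<in>L j'. M a b' * Y j' b' y) * Y j' b y \<partial>sphere_measure)" by simp
    also have "\<dots> = (\<integral>y. c * (Y j a y * Y j' b y) \<partial>sphere_measure)"
      by (rule integral_sphere_cong) (simp add: row)
    also have "\<dots> = c * (if j = j' \<and> a = b then 1 else 0)"
      by (simp add: integral_YY[OF a b])
    finally show "M a b = (if j = j' \<and> a = b then c else 0)" by simp
  qed
qed

end

section \<open>The dimension and the normalizing constant\<close>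

text \<open>The closed formula is a sum of two binomial coefficients. Integrality matters because the basis in
  degree \<open>j\<close> is indexed by the positive integers up to it, and the trace counts these indices.\<close>

lemma harm_dim_eq_nat:
  assumes "n \<ge> 2"
  obtains d :: nat where "harm_dim n j = real d" "d > 0"
proof -
  obtain m where n: "n = Suc (Suc m)" using assms by (metis add_2_eq_Suc le_Suc_ex)
  define D where "D = (fact j * fact (Suc m) :: real)"
  have D: "D \<noteq> 0" by (simp add: D_def)
  have G1: "Gamma (real n + real j - 1) = fact (m + j)"
    using Gamma_fact[of "m + j", where 'a = real] by (simp add: n add_ac)
  have G2: "Gamma (real j + 1) = fact j"
    using Gamma_fact[of j, where 'a = real] by (simp add: add_ac)
  have G3: "Gamma (real n) = fact (Suc m)"
    using Gamma_fact[of "Suc m", where 'a = real] by (simp add: n add_ac)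
  have hd: "harm_dim n j = (real m + 1 + 2 * real j) * fact (m + j) / D"
    unfolding harm_dim_def G1 G2 G3 D_def by (simp add: n add_ac)
  define d where "d = (Suc m + j choose j) + (case j of 0 \<Rightarrow> 0 | Suc i \<Rightarrow> m + j choose i)"
  have c1: "real (Suc m + j choose j) = (real m + 1 + real j) * fact (m + j) / D"
    using binomial_fact[of j "Suc m + j", where 'a = real]
    by (simp add: D_def del: fact_Suc) (simp add: algebra_simps)
  have c2: "real (case j of 0 \<Rightarrow> 0 | Suc i \<Rightarrow> m + j choose i) = real j * fact (m + j) / D"
  proof (cases j)
    case (Suc i)
    have "m + j - i = Suc m" using Suc by simp
    then have "real (m + j choose i) = fact (m + j) / (fact i * fact (Suc m))"
      using binomial_fact[of i "m + j", where 'a = real] Suc by simp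
    also have "\<dots> = real j * fact (m + j) / D"
      unfolding D_def Suc fact_Suc[of i] by simp
    finally show ?thesis by (simp add: Suc)
  qed simp
  have "harm_dim n j = real d"
    unfolding hd d_def of_nat_add c1 c2 add_divide_distrib[symmetric] by (simp add: algebra_simps)
  moreover have "d > 0" by (simp add: d_def)
  ultimately show ?thesis by (rule that)
qed

lemma jacobi_poly_at_1: "jacobi_poly \<alpha> \<beta> i 1 = (real i + \<alpha>) gchoose i"
proof -
  have "jacobi_poly \<alpha> \<beta> i 1 = (\<Sum>s\<le>i. if s = 0 then (real i + \<alpha>) gchoose i else 0)"
    unfolding jacobi_poly_def by (intro sum.cong refl) auto
  then show ?thesis by simp
qed

text \<open>The constant is the reciprocal of the squared norm of the normalized Jacobi polynomial with respect to
  the distribution of \<open>|x\<^sup>T v|\<^sup>2\<close>. The second factor on the left is that squared norm, as it results from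
  the lemma \<open>integral_jacobi_harmonic_square\<close>; everything is rewritten in terms of values of the Gamma function.\<close>

lemma varkappa_square:
  fixes n k i :: nat
  assumes "n \<ge> 2" "1 \<le> k" "k \<le> n - 1"
  defines "\<alpha> \<equiv> (real k - 1) / 2" and "\<beta> \<equiv> (real n - real k) / 2 - 1"
  shows "(varkappa n k (2 * i))\<^sup>2 *
      (((2 * real i + \<alpha> + \<beta>) gchoose i) * (pochhammer (\<alpha> + 1) i * pochhammer (\<beta> + 1) i)
        / pochhammer (\<alpha> + \<beta> + 2) (2 * i) / (jacobi_poly \<alpha> \<beta> i 1)\<^sup>2) = 1"
proof -
  define a b s t where "a = (real k + 1) / 2" and "b = (real n - real k) / 2" and "s = (real n + 1) / 2"
    and "t = 2 * real i + s - 1"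
  have k: "k < n" using assms(1-3) by linarith
  have s1: "s > 1" using assms(1) by (simp add: s_def)
  have pos: "a > 0" "b > 0" "s - 1 > 0" "s > 0" using k s1 by (simp_all add: a_def b_def)
  have pos: "a > 0" "b > 0" "s - 1 > 0" "s > 0" "t > 0"
    using pos s1 by (simp_all add: t_def)
  have ab: "\<alpha> + 1 = a" "\<beta> + 1 = b" "\<alpha> + \<beta> + 2 = s" "a + b = s"
    by (simp_all add: \<alpha>_def \<beta>_def a_def b_def s_def field_simps)
  define f A A' B B' S W V where "f = Gamma (real i + 1)" and "A = Gamma a" and "A' = Gamma (real i + a)"
    and "B = Gamma b" and "B' = Gamma (real i + b)" and "S = Gamma s"
    and "W = Gamma (real i + s - 1)" and "V = Gamma t"
  have gpos: "f > 0" "A > 0" "A' > 0" "B > 0" "B' > 0" "S > 0" "W > 0" "V > 0"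
    unfolding f_def A_def A'_def B_def B'_def S_def W_def V_def using pos
    by (auto intro!: Gamma_real_pos add_nonneg_pos)
  have f: "f = fact i" unfolding f_def using Gamma_fact[of i, where 'a = real] by (simp add: add_ac)
  have nonint: "z \<notin> \<int>\<^sub>\<le>\<^sub>0" if "z > 0" for z :: real
    using that by (auto elim!: nonpos_Ints_cases)
  have pa: "pochhammer a i = A' / A" "pochhammer b i = B' / B"
    using pochhammer_Gamma[OF nonint[OF pos(1)], of i] pochhammer_Gamma[OF nonint[OF pos(2)], of i]
    by (simp_all add: A_def A'_def B_def B'_def add_ac)
  have ps: "pochhammer s (2 * i) = t * V / S"
  proof -
    have "pochhammer s (2 * i) = Gamma (t + 1) / S"
      using pochhammer_Gamma[OF nonint[OF pos(4)], of "2 * i"] by (simp add: S_def t_def add_ac)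
    also have "Gamma (t + 1) = t * V"
      using Gamma_plus1[OF nonint[OF pos(5)]] by (simp add: V_def)
    finally show ?thesis .
  qed
  have g1: "(2 * real i + \<alpha> + \<beta>) gchoose i = V / (W * f)"
  proof -
    have p: "real i + s - 1 > 0" using pos by simp
    have arg: "2 * real i + \<alpha> + \<beta> - real i + 1 = real i + s - 1" using ab(3) by simp
    have val: "pochhammer (real i + s - 1) i = V / W"
    proof -
      have e: "real i + s - 1 + real i = t" by (simp add: t_def)
      show ?thesis
        using pochhammer_Gamma[OF nonint[OF p], of i] unfolding e V_def W_def .
    qed
    show ?thesis unfolding gbinomial_pochhammer' arg val f by simp
  qed
  have g2: "jacobi_poly \<alpha> \<beta> i 1 = A' / (A * f)"
  proof -
    have "real i + \<alpha> - real i + 1 = a" using ab(1) by simp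
    then show ?thesis unfolding jacobi_poly_at_1 by (simp add: gbinomial_pochhammer' f pa)
  qed
  have sa: "sphere_area n / (sphere_area (n - k - 1) * sphere_area k) = A * B / (2 * S)"
  proof -
    have e: "(real (n - k - 1) + 1) / 2 = b" using k by (simp add: b_def of_nat_diff)
    have e1: "sphere_area n = 2 * (pi powr a * pi powr b) / S"
    proof -
      have "pi powr s = pi powr a * pi powr b" by (simp only: ab(4)[symmetric] powr_add)
      then show ?thesis unfolding sphere_area_def s_def[symmetric] S_def[symmetric] by (simp only:)
    qed
    have e2: "sphere_area (n - k - 1) = 2 * pi powr b / B"
      unfolding sphere_area_def e B_def ..
    have e3: "sphere_area k = 2 * pi powr a / A"
      unfolding sphere_area_def a_def[symmetric] A_def[symmetric] ..
    have "pi powr a > 0" "pi powr b > 0" by simp_all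
    then show ?thesis unfolding e1 e2 e3 using gpos by (simp add: field_simps)
  qed
  define X where "X = (sphere_area n / (sphere_area (n - k - 1) * sphere_area k)) * (2 * t) * A' * W / (A\<^sup>2 * f * B')"
  have X: "X = (A * B / (2 * S)) * (2 * t) * A' * W / (A\<^sup>2 * f * B')"
    unfolding X_def sa ..
  have Xpos: "X \<ge> 0" unfolding X using gpos pos by simp
  have "varkappa n k (2 * i) = sqrt X"
  proof -
    have e: "(real (2 * i) + real k + 1) / 2 = real i + a" "(real (2 * i) + real n - 1) / 2 = real i + s - 1"
      "real (2 * i) / 2 + 1 = real i + 1" "(real (2 * i) + real n - real k) / 2 = real i + b"
      "2 * real (2 * i) + real n - 1 = 2 * t" "(real k + 1) / 2 = a"
      by (simp_all add: a_def b_def s_def t_def field_simps)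
    show ?thesis unfolding varkappa_def e X_def f_def[symmetric] A_def[symmetric] A'_def[symmetric]
        B'_def[symmetric] W_def[symmetric] by (simp add: mult_ac)
  qed
  then have vk: "(varkappa n k (2 * i))\<^sup>2 = X" using Xpos by simp
  show ?thesis
    unfolding vk X g1 g2 ab ps pa using gpos pos by (simp add: field_simps power2_eq_square)
qed

section \<open>The kernel on the Stiefel manifold\<close>

context orth_projection
begin

lemma p_le_norm: "p x \<le> (norm x)\<^sup>2"
proof -
  have "q x = (x - A x) \<bullet> (x - A x)"
    by (simp add: q_def inner_diff_left inner_diff_right selfadjoint idem)
  then have "q x \<ge> 0" by simp
  then show ?thesis by (simp add: p_def q_def inner_diff_right power2_norm_eq_inner[symmetric])
qed

lemma spherical_harmonic_jacobi_harmonic: "spherical_harmonic (2 * i) (jacobi_harmonic i)"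
proof -
  have "jacobi_harmonic i (c *\<^sub>R x) = c ^ (2 * i) * jacobi_harmonic i x" for c x
  proof -
    have "p (c *\<^sub>R x) ^ (i - s) * q (c *\<^sub>R x) ^ s = c ^ (2 * i) * (p x ^ (i - s) * q x ^ s)" if "s \<le> i" for s
    proof -
      have "c ^ (2 * i) = (c\<^sup>2) ^ (i - s) * (c\<^sup>2) ^ s"
        using that by (simp add: power_mult power_add[symmetric])
      then show ?thesis by (simp only: p_scale q_scale power_mult_distrib mult_ac)
    qed
    then show ?thesis
      unfolding jacobi_harmonic_def sum_distrib_left by (intro sum.cong refl) simp
  qed
  then show ?thesis
    unfolding spherical_harmonic_def
    by (intro exI[of _ "jacobi_harmonic i"]) (simp add: rpf_jacobi_harmonic laplacian_jacobi_harmonic)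
qed

end

text \<open>The projection onto the column space of \<open>v\<close> is \<open>v v\<^sup>T\<close>; its trace is the sum of the squared lengths of
  the columns.\<close>

lemma orth_projection_stiefel:
  fixes v :: "real^'m^'p"
  assumes v: "v \<in> stiefel"
    and \<beta>: "real CARD('m) = 2 * (\<beta> + 1)" and \<alpha>: "real CARD('p) = 2 * (\<alpha> + 1) + 2 * (\<beta> + 1)"
  shows "orth_projection (\<lambda>x. v *v (x v* v)) \<alpha> \<beta>"
proof -
  have vv: "transpose v ** v = mat 1" using v by (simp add: stiefel_def)
  have adj: "(v *v a) \<bullet> y = a \<bullet> (y v* v)" for a y
    using dot_lmul_matrix[of y v a] by (simp add: inner_commute)
  have vx: "(v *v a) v* v = a" for a
    using vv by (simp add: transpose_matrix_vector[symmetric] matrix_vector_mul_assoc)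
  have "(\<lambda>x. v *v (x v* v)) = (*v) (v ** transpose v)"
    by (simp add: fun_eq_iff matrix_vector_mul_assoc[symmetric])
  then have lin: "linear (\<lambda>x. v *v (x v* v))" by simp
  have sa: "(v *v (x v* v)) \<bullet> y = x \<bullet> (v *v (y v* v))" for x y
    using adj[of "x v* v" y] adj[of "y v* v" x] by (simp add: inner_commute)
  have comp: "(x v* v) $ j = x \<bullet> column j v" for x j
    by (simp add: vector_matrix_mult_def inner_vec_def column_def mult.commute)
  have "(\<Sum>b\<in>Basis. (v *v (b v* v)) \<bullet> b) = (\<Sum>b\<in>Basis. \<Sum>j\<in>UNIV. (column j v \<bullet> b) * (column j v \<bullet> b))"
  proof (intro sum.cong refl)
    fix b
    have "(v *v (b v* v)) \<bullet> b = (\<Sum>j\<in>UNIV. (b v* v) $ j * (b v* v) $ j)"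
      unfolding adj by (simp add: inner_vec_def[of "b v* v" "b v* v"])
    then show "(v *v (b v* v)) \<bullet> b = (\<Sum>j\<in>UNIV. (column j v \<bullet> b) * (column j v \<bullet> b))"
      unfolding comp by (simp only: inner_commute)
  qed
  also have "\<dots> = (\<Sum>j\<in>UNIV. column j v \<bullet> column j v)"
    by (subst sum.swap) (simp only: euclidean_inner[symmetric])
  also have "\<dots> = (\<Sum>j\<in>(UNIV :: 'm set). 1)"
  proof (intro sum.cong refl)
    fix j
    have "column j v \<bullet> column j v = (transpose v ** v) $ j $ j"
      by (simp add: inner_vec_def column_def matrix_matrix_mult_def transpose_def)
    then show "column j v \<bullet> column j v = 1" by (simp add: vv mat_def)
  qed
  finally have tr: "(\<Sum>b\<in>Basis. (v *v (b v* v)) \<bullet> b) = 2 * (\<beta> + 1)" using \<beta> by simp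
  show ?thesis
    by (rule orth_projection.intro[OF lin sa _ tr]) (simp_all add: vx \<alpha>)
qed

lemma stiefel_projection_inner:
  fixes v :: "real^'m^'p"
  shows "x \<bullet> (v *v (x v* v)) = (norm (x v* v))\<^sup>2"
  unfolding power2_norm_eq_inner by (rule dot_lmul_matrix[symmetric])

definition stiefel_kernel :: "real \<Rightarrow> real \<Rightarrow> nat \<Rightarrow> real^'p \<Rightarrow> real^'m^'p \<Rightarrow> real" where
  "stiefel_kernel \<alpha> \<beta> i x v = jacobi_normalized \<alpha> \<beta> i (2 * (norm (x v* v))\<^sup>2 - 1)"

lemma continuous_jacobi_normalized: "continuous_on UNIV (jacobi_normalized \<alpha> \<beta> i)"
  unfolding jacobi_normalized_def[abs_def] jacobi_poly_def divide_inverse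
  by (intro continuous_intros)

context
  fixes \<alpha> \<beta> :: real and v :: "real^'m^'p"
  assumes v: "v \<in> stiefel"
    and \<beta>: "real CARD('m) = 2 * (\<beta> + 1)" and \<alpha>: "real CARD('p) = 2 * (\<alpha> + 1) + 2 * (\<beta> + 1)"
begin

interpretation orth_projection "\<lambda>x. v *v (x v* v)" \<alpha> \<beta>
  by (rule orth_projection_stiefel[OF v \<beta> \<alpha>])

lemma stiefel_kernel_eq_jacobi_harmonic:
  assumes "x \<in> sphere 0 1"
  shows "stiefel_kernel \<alpha> \<beta> i x v = jacobi_harmonic i x / jacobi_poly \<alpha> \<beta> i 1"
  using jacobi_harmonic_eq_jacobi_poly[of x i] assms
  by (simp add: stiefel_kernel_def jacobi_normalized_def p_def stiefel_projection_inner)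

text \<open>This is what links Jacobi polynomials to harmonics: the kernel with a fixed Stiefel matrix is itself
  a spherical harmonic, so that the transform is a scalar product with a harmonic of the same degree.\<close>

lemma spherical_harmonic_stiefel_kernel: "spherical_harmonic (2 * i) (\<lambda>x. stiefel_kernel \<alpha> \<beta> i x v)"
proof -
  have "spherical_harmonic (2 * i) (\<lambda>x. \<Sum>s\<in>{()}. (1 / jacobi_poly \<alpha> \<beta> i 1) * jacobi_harmonic i x)"
    by (rule spherical_harmonic_sum) (simp_all add: spherical_harmonic_jacobi_harmonic)
  then have "spherical_harmonic (2 * i) (\<lambda>x. jacobi_harmonic i x / jacobi_poly \<alpha> \<beta> i 1)"
    by simp
  then show ?thesis
    unfolding spherical_harmonic_def by (simp add: stiefel_kernel_eq_jacobi_harmonic)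
qed

lemma integral_stiefel_kernel_square:
  "(\<integral>x. (stiefel_kernel \<alpha> \<beta> i x v)\<^sup>2 \<partial>sphere_measure) =
     ((2 * real i + \<alpha> + \<beta>) gchoose i) * (pochhammer (\<alpha> + 1) i * pochhammer (\<beta> + 1) i)
        / pochhammer (\<alpha> + \<beta> + 2) (2 * i) / (jacobi_poly \<alpha> \<beta> i 1)\<^sup>2"
proof -
  have "(\<integral>x. (stiefel_kernel \<alpha> \<beta> i x v)\<^sup>2 \<partial>sphere_measure)
      = (\<integral>x. (jacobi_harmonic i x)\<^sup>2 / (jacobi_poly \<alpha> \<beta> i 1)\<^sup>2 \<partial>sphere_measure)"
    by (rule integral_sphere_cong) (simp add: stiefel_kernel_eq_jacobi_harmonic power_divide)
  then show ?thesis by (simp add: integral_jacobi_harmonic_square)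
qed

lemma stiefel_norm_le: "norm (x v* v) \<le> norm x"
  using p_le_norm[of x] unfolding p_def stiefel_projection_inner by (rule power2_le_imp_le) simp

end

lemma continuous_vector_matrix_mult:
  "continuous_on UNIV (\<lambda>z :: (real^'m^'p) \<times> (real^'p). snd z v* fst z)"
  unfolding vector_matrix_mult_def
  by (intro continuous_on_vec_lambda continuous_intros)

lemma continuous_stiefel_kernel:
  "continuous_on UNIV (\<lambda>z :: (real^'m^'p) \<times> (real^'p). stiefel_kernel \<alpha> \<beta> i (snd z) (fst z))"
  unfolding stiefel_kernel_def
  by (intro continuous_on_compose2[OF continuous_jacobi_normalized] continuous_intros continuous_vector_matrix_mult) auto

text \<open>A rotation of \<open>x\<close> can be moved to the Stiefel matrix, where the invariant measure ignores it.\<close>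

lemma stiefel_kernel_orthogonal:
  fixes g :: "real^'p \<Rightarrow> real^'p" and v :: "real^'m^'p"
  assumes "orthogonal_transformation g"
  shows "stiefel_kernel \<alpha> \<beta> i (g x) v = stiefel_kernel \<alpha> \<beta> i x (transpose (matrix g) ** v)"
proof -
  have "g x = x v* transpose (matrix g)"
    using assms transpose_matrix_vector[of "transpose (matrix g)" x]
    by (simp add: orthogonal_transformation_linear matrix_works)
  then have "(g x) v* v = x v* (transpose (matrix g) ** v)"
    by (simp only: vector_matrix_mul_assoc)
  then show ?thesis by (simp add: stiefel_kernel_def)
qed

section \<open>The transform and its inner products\<close>

lemma jacobi_normalized_bounded:
  obtains C where "\<And>t. - 1 \<le> t \<Longrightarrow> t \<le> 1 \<Longrightarrow> \<bar>jacobi_normalized \<alpha> \<beta> i t\<bar> \<le> C"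
proof -
  have "compact (jacobi_normalized \<alpha> \<beta> i ` {-1..1})"
    by (intro compact_continuous_image continuous_on_subset[OF continuous_jacobi_normalized]) auto
  then have "bounded (jacobi_normalized \<alpha> \<beta> i ` {-1..1})" by (rule compact_imp_bounded)
  then obtain C where "\<forall>t\<in>{-1..1}. \<bar>jacobi_normalized \<alpha> \<beta> i t\<bar> \<le> C"
    by (auto simp: bounded_iff)
  then show ?thesis by (intro that[of C]) simp
qed

locale invariant_stiefel_measure = prob_space \<mu> for \<mu> :: "(real^'m^'p) measure" +
  fixes \<alpha> \<beta> :: real
  assumes inv_\<mu>: "stiefel_invariant_prob \<mu>"
    and card_m: "real CARD('m) = 2 * (\<beta> + 1)" and card_p: "real CARD('p) = 2 * (\<alpha> + 1) + 2 * (\<beta> + 1)"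
begin

lemma space_\<mu>: "space \<mu> = stiefel" and sets_\<mu>: "sets \<mu> = sets (restrict_space borel stiefel)"
  using inv_\<mu> unfolding stiefel_invariant_prob_def by blast+

lemma continuous_measurable_\<mu>:
  fixes f :: "real^'m^'p \<Rightarrow> 'b::topological_space"
  assumes "continuous_on UNIV f"
  shows "f \<in> borel_measurable \<mu>"
  by (subst measurable_cong_sets[OF sets_\<mu> refl])
    (rule measurable_restrict_space1[OF borel_measurable_continuous_onI[OF assms]])

lemma integral_\<mu>_orthogonal:
  fixes f :: "real^'m^'p \<Rightarrow> real"
  assumes T: "orthogonal_matrix T" and f: "continuous_on UNIV f"
  shows "(\<integral>v. f (T ** v) \<partial>\<mu>) = (\<integral>v. f v \<partial>\<mu>)"
proof -
  have TT: "transpose T ** T = mat 1" using T by (simp add: orthogonal_matrix_def)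
  have "T ** v \<in> stiefel" if "v \<in> stiefel" for v :: "real^'m^'p"
  proof -
    have "transpose (T ** v) ** (T ** v) = transpose v ** (transpose T ** T) ** v"
      by (simp only: matrix_transpose_mul matrix_mul_assoc)
    then show ?thesis using that by (simp add: TT stiefel_def)
  qed
  moreover have "continuous_on UNIV (\<lambda>v :: real^'m^'p. T ** v)"
    unfolding matrix_matrix_mult_def by (intro continuous_on_vec_lambda continuous_intros)
  ultimately have "(\<lambda>v. T ** v) \<in> measurable \<mu> (restrict_space borel stiefel)"
    by (intro measurable_restrict_space2 continuous_measurable_\<mu>) (auto simp: space_\<mu>)
  then have "(\<lambda>v. T ** v) \<in> measurable \<mu> \<mu>"
    by (subst measurable_cong_sets[OF refl sets_\<mu>])
  from integral_distr[OF this continuous_measurable_\<mu>[OF f]]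
  have "(\<integral>v. f v \<partial>distr \<mu> \<mu> (\<lambda>v. T ** v)) = (\<integral>v. f (T ** v) \<partial>\<mu>)" .
  moreover have "distr \<mu> \<mu> (\<lambda>v. T ** v) = \<mu>"
    using inv_\<mu> T unfolding stiefel_invariant_prob_def by blast
  ultimately show ?thesis by simp
qed

abbreviation K where "K \<equiv> stiefel_kernel \<alpha> \<beta>"

lemma kernel_bounded:
  obtains C where "\<And>x v. x \<in> sphere 0 1 \<Longrightarrow> v \<in> stiefel \<Longrightarrow> \<bar>K i x (v :: real^'m^'p)\<bar> \<le> C"
proof -
  obtain C where C: "\<And>t. - 1 \<le> t \<Longrightarrow> t \<le> 1 \<Longrightarrow> \<bar>jacobi_normalized \<alpha> \<beta> i t\<bar> \<le> C"
    using jacobi_normalized_bounded[of \<alpha> \<beta> i] by blast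
  show ?thesis
  proof (rule that)
    fix x :: "real^'p" and v :: "real^'m^'p" assume x: "x \<in> sphere 0 1" and v: "v \<in> stiefel"
    have "norm (x v* v) \<le> 1" using stiefel_norm_le[OF v card_m card_p, of x] x by simp
    then have "(norm (x v* v))\<^sup>2 \<le> 1" by (simp add: power_le_one)
    then show "\<bar>K i x v\<bar> \<le> C"
      unfolding stiefel_kernel_def by (intro C) simp_all
  qed
qed

text \<open>The transformed function up to the normalizing factor.\<close>

definition transform :: "nat \<Rightarrow> (real^'p \<Rightarrow> real) \<Rightarrow> real^'m^'p \<Rightarrow> real" where
  "transform i f v = (\<integral>x. f x * K i x v \<partial>sphere_measure)"

lemma transform_measurable:
  assumes f: "f \<in> borel_measurable sphere_measure"
  shows "transform i f \<in> borel_measurable \<mu>"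
proof -
  interpret S: prob_space "sphere_measure :: (real^'p) measure" by (rule prob_space_sphere_measure)
  have id1: "(\<lambda>v. v) \<in> borel_measurable \<mu>" by (rule continuous_measurable_\<mu>) (rule continuous_on_id)
  have id2: "(\<lambda>x. x) \<in> borel_measurable (sphere_measure :: (real^'p) measure)"
    by (subst measurable_cong_sets[OF sets_sphere_measure refl]) (rule measurable_restrict_space1, simp)
  have "(\<lambda>z. fst z) \<in> borel_measurable (\<mu> \<Otimes>\<^sub>M (sphere_measure :: (real^'p) measure))"
    by (rule measurable_compose[OF measurable_fst id1])
  moreover have "(\<lambda>z. snd z) \<in> borel_measurable (\<mu> \<Otimes>\<^sub>M (sphere_measure :: (real^'p) measure))"
    by (rule measurable_compose[OF measurable_snd id2])
  ultimately have "(\<lambda>z. (fst z, snd z)) \<in> borel_measurable (\<mu> \<Otimes>\<^sub>M (sphere_measure :: (real^'p) measure))"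
    by (rule borel_measurable_Pair)
  then have "(\<lambda>z. K i (snd z) (fst z)) \<in> borel_measurable (\<mu> \<Otimes>\<^sub>M sphere_measure)"
    using measurable_compose[OF _ borel_measurable_continuous_onI[OF continuous_stiefel_kernel[of \<alpha> \<beta> i]],
        of "\<lambda>z. (fst z, snd z)"] by simp
  moreover have "(\<lambda>z. f (snd z)) \<in> borel_measurable (\<mu> \<Otimes>\<^sub>M sphere_measure)"
    by (rule measurable_compose[OF measurable_snd f])
  ultimately have "(\<lambda>z. f (snd z) * K i (snd z) (fst z)) \<in> borel_measurable (\<mu> \<Otimes>\<^sub>M sphere_measure)"
    by (intro borel_measurable_times)
  then have "case_prod (\<lambda>v x. f x * K i x v) \<in> borel_measurable (\<mu> \<Otimes>\<^sub>M sphere_measure)"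
    by (simp add: case_prod_beta')
  from S.borel_measurable_lebesgue_integral[OF this] show ?thesis
    unfolding transform_def[abs_def] .
qed

lemma kernel_harmonic:
  fixes v :: "real^'m^'p"
  shows "v \<in> stiefel \<Longrightarrow> spherical_harmonic (2 * i) (\<lambda>x. K i x v)"
  by (rule spherical_harmonic_stiefel_kernel[OF _ card_m card_p])

lemma transform_bounded:
  assumes f: "sphere_poly f"
  obtains B where "\<And>v. v \<in> stiefel \<Longrightarrow> \<bar>transform i f v\<bar> \<le> B"
proof -
  obtain C where C: "\<And>x v. x \<in> sphere 0 1 \<Longrightarrow> v \<in> stiefel \<Longrightarrow> \<bar>K i x (v :: real^'m^'p)\<bar> \<le> C"
    using kernel_bounded[of i] by blast
  show ?thesis
  proof (rule that)
    fix v :: "real^'m^'p" assume v: "v \<in> stiefel"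
    have 1: "integrable sphere_measure (\<lambda>x. f x * K i x v)"
      by (intro integrable_sphere_poly sphere_poly_mult f
          spherical_harmonic_imp_sphere_poly[OF kernel_harmonic[OF v]])
    have 2: "integrable sphere_measure (\<lambda>x. \<bar>f x\<bar> * C)"
      by (intro integrable_mult_left integrable_abs integrable_sphere_poly f)
    show "\<bar>transform i f v\<bar> \<le> (\<integral>x. \<bar>f x\<bar> * C \<partial>sphere_measure)"
      unfolding transform_def real_norm_def[symmetric]
    proof (rule Bochner_Integration.integral_norm_bound_integral[OF 1])
      show "integrable sphere_measure (\<lambda>x. norm (f x) * C)" using 2 by simp
      fix x :: "real^'p" assume "x \<in> space sphere_measure"
      then show "norm (f x * K i x v) \<le> norm (f x) * C"
        unfolding norm_mult using C[OF _ v, of x] by (intro mult_left_mono) simp_all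
    qed
  qed
qed

lemma integrable_transform_mult:
  assumes f: "sphere_poly f" and g: "sphere_poly g"
  shows "integrable \<mu> (\<lambda>v. transform i f v * transform i' g v)"
proof -
  obtain B where B: "\<And>v. v \<in> stiefel \<Longrightarrow> \<bar>transform i f v\<bar> \<le> B"
    using transform_bounded[OF f, of i] by blast
  obtain B' where B': "\<And>v. v \<in> stiefel \<Longrightarrow> \<bar>transform i' g v\<bar> \<le> B'"
    using transform_bounded[OF g, of i'] by blast
  show ?thesis
  proof (rule integrable_const_bound)
    show "AE v in \<mu>. norm (transform i f v * transform i' g v) \<le> B * B'"
    proof (rule AE_I2)
      fix v assume "v \<in> space \<mu>"
      then have v: "v \<in> stiefel" by (simp only: space_\<mu>)
      have "0 \<le> B" using B[OF v] by linarith
      then show "norm (transform i f v * transform i' g v) \<le> B * B'"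
        unfolding real_norm_def abs_mult by (intro mult_mono B[OF v] B'[OF v]) simp_all
    qed
    show "(\<lambda>v. transform i f v * transform i' g v) \<in> borel_measurable \<mu>"
      by (intro borel_measurable_times transform_measurable borel_measurable_integrable
          integrable_sphere_poly f g)
  qed
qed

lemma kernel_pair_integral_invariant:
  assumes g: "orthogonal_transformation (g :: real^'p \<Rightarrow> real^'p)"
  shows "(\<integral>v. K i (g x) v * K i' (g y) v \<partial>\<mu>) = (\<integral>v. K i x v * K i' y v \<partial>\<mu>)"
proof -
  have cK: "continuous_on UNIV (\<lambda>v :: real^'m^'p. K i x v)" for i x
    using continuous_on_compose2[OF continuous_stiefel_kernel[of \<alpha> \<beta> i], of UNIV "\<lambda>v. (v, x)"]
    by (simp add: continuous_on_Pair continuous_on_id continuous_on_const)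
  have T: "orthogonal_matrix (transpose (matrix g))"
    using g by (simp add: orthogonal_transformation_matrix orthogonal_matrix_transpose)
  have "(\<integral>v. K i (g x) v * K i' (g y) v \<partial>\<mu>)
      = (\<integral>v. K i x (transpose (matrix g) ** v) * K i' y (transpose (matrix g) ** v) \<partial>\<mu>)"
    by (simp only: stiefel_kernel_orthogonal[OF g])
  also have "\<dots> = (\<integral>v. K i x v * K i' y v \<partial>\<mu>)"
    by (rule integral_\<mu>_orthogonal[OF T, of "\<lambda>v. K i x v * K i' y v"]) (intro continuous_on_mult cK)
  finally show ?thesis .
qed

definition kernel_norm2 :: "nat \<Rightarrow> real" where
  "kernel_norm2 i = ((2 * real i + \<alpha> + \<beta>) gchoose i) * (pochhammer (\<alpha> + 1) i * pochhammer (\<beta> + 1) i)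
        / pochhammer (\<alpha> + \<beta> + 2) (2 * i) / (jacobi_poly \<alpha> \<beta> i 1)\<^sup>2"

text \<open>The transforms of the basis functions are the coefficients of the kernel in the basis. Hence their
  matrix of inner products is the coefficient matrix of \<open>\<integral> K(x,v) K(y,v) dv\<close>, which is invariant
  under simultaneous rotations. By the theorem \<open>invariant_kernel_coefficients\<close> it is scalar, and its trace is
  the squared norm of the kernel, by Parseval's identity.\<close>

theorem transform_inner_products:
  assumes hb: "harmonic_basis L Y" and a: "a \<in> L (2 * i)" and b: "b \<in> L (2 * i')"
  shows "(\<integral>v. transform i (Y (2 * i) a) v * transform i' (Y (2 * i') b) v \<partial>\<mu>)
    = (if i = i' \<and> a = b then kernel_norm2 i / card (L (2 * i)) else 0)"
proof -
  interpret harmonic_basis L Y by (rule hb)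
  define co where "co i l v = transform i (Y (2 * i) l) v" for i l v
  have expansion: "K i x v = (\<Sum>l\<in>L (2 * i). co i l v * Y (2 * i) l x)"
    if v: "v \<in> stiefel" and x: "x \<in> sphere 0 1" for i x v
    unfolding co_def transform_def using harmonic_expansion[OF kernel_harmonic[OF v] x]
    by (simp only: mult.commute)
  have int_co: "integrable \<mu> (\<lambda>v. co i l v * co i' l' v)" if "l \<in> L (2 * i)" "l' \<in> L (2 * i')" for i i' l l'
    unfolding co_def by (rule integrable_transform_mult[OF sphere_poly_Y[OF that(1)] sphere_poly_Y[OF that(2)]])
  define M where "M l l' = (\<integral>v. co i l v * co i' l' v \<partial>\<mu>)" for l l'
  define G where "G x y = (\<Sum>l\<in>L (2 * i). \<Sum>l'\<in>L (2 * i'). M l l' * Y (2 * i) l x * Y (2 * i') l' y)" for x y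
  have G: "G x y = (\<integral>v. K i x v * K i' y v \<partial>\<mu>)" if x: "x \<in> sphere 0 1" and y: "y \<in> sphere 0 1" for x y
  proof -
    have "(\<integral>v. K i x v * K i' y v \<partial>\<mu>) = (\<integral>v. (\<Sum>l\<in>L (2 * i). \<Sum>l'\<in>L (2 * i').
        (co i l v * co i' l' v) * (Y (2 * i) l x * Y (2 * i') l' y)) \<partial>\<mu>)"
    proof (intro Bochner_Integration.integral_cong refl)
      fix v assume "v \<in> space \<mu>"
      then have v: "v \<in> stiefel" by (simp only: space_\<mu>)
      show "K i x v * K i' y v = (\<Sum>l\<in>L (2 * i). \<Sum>l'\<in>L (2 * i').
        (co i l v * co i' l' v) * (Y (2 * i) l x * Y (2 * i') l' y))"
        unfolding expansion[OF v x] expansion[OF v y] sum_product by (simp only: mult_ac)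
    qed
    also have "\<dots> = (\<Sum>l\<in>L (2 * i). (\<integral>v. (\<Sum>l'\<in>L (2 * i').
        (co i l v * co i' l' v) * (Y (2 * i) l x * Y (2 * i') l' y)) \<partial>\<mu>))"
      by (intro Bochner_Integration.integral_sum Bochner_Integration.integrable_sum integrable_mult_left int_co)
    also have "\<dots> = (\<Sum>l\<in>L (2 * i). \<Sum>l'\<in>L (2 * i').
        (\<integral>v. (co i l v * co i' l' v) * (Y (2 * i) l x * Y (2 * i') l' y) \<partial>\<mu>))"
      by (intro sum.cong refl Bochner_Integration.integral_sum integrable_mult_left int_co)
    also have "\<dots> = G x y"
      unfolding G_def M_def by (intro sum.cong refl) (unfold integral_mult_left_zero, rule mult.assoc[symmetric])
    finally show ?thesis by simp
  qed
  have ne: "L (2 * i) \<noteq> {}" using a by blast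
  have inv: "G (g x) (g y) = G x y"
    if g: "orthogonal_transformation g" and x: "x \<in> sphere 0 1" and y: "y \<in> sphere 0 1" for g x y
  proof -
    have "g x \<in> sphere 0 1" "g y \<in> sphere 0 1"
      using x y orthogonal_transformation_norm[OF g] by simp_all
    then show ?thesis using kernel_pair_integral_invariant[OF g] x y by (simp only: G)
  qed
  obtain c where c: "\<And>l l'. l \<in> L (2 * i) \<Longrightarrow> l' \<in> L (2 * i') \<Longrightarrow> M l l' = (if 2 * i = 2 * i' \<and> l = l' then c else 0)"
    using invariant_kernel_coefficients[OF _ ne G_def inv] by auto
  \<comment> \<open>The trace of M is c times the dimension, and by Parseval it is the squared norm of K.\<close>
  have c_eq: "c = kernel_norm2 i / card (L (2 * i))" if "i = i'"
  proof -
    have "real (card (L (2 * i))) * c = (\<Sum>l\<in>L (2 * i). M l l)"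
      using c that by simp
    also have "\<dots> = (\<integral>v. (\<Sum>l\<in>L (2 * i). co i l v * co i l v) \<partial>\<mu>)"
      unfolding M_def that[symmetric]
      by (intro Bochner_Integration.integral_sum[symmetric] int_co)
    also have "\<dots> = (\<integral>v. kernel_norm2 i \<partial>\<mu>)"
    proof (intro Bochner_Integration.integral_cong refl)
      fix v assume "v \<in> space \<mu>"
      then have v: "v \<in> stiefel" by (simp only: space_\<mu>)
      have spK: "sphere_poly (\<lambda>x. K i x v)"
        by (rule spherical_harmonic_imp_sphere_poly[OF kernel_harmonic[OF v]])
      have "kernel_norm2 i = (\<integral>x. (K i x v)\<^sup>2 \<partial>sphere_measure)"
        unfolding kernel_norm2_def by (rule integral_stiefel_kernel_square[OF v card_m card_p, symmetric])
      also have "\<dots> = (\<integral>x. (\<Sum>l\<in>L (2 * i). co i l v * Y (2 * i) l x) * K i x v \<partial>sphere_measure)"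
        by (rule integral_sphere_cong) (simp only: expansion[OF v, symmetric] power2_eq_square)
      also have "\<dots> = (\<Sum>l\<in>L (2 * i). co i l v * (\<integral>x. Y (2 * i) l x * K i x v \<partial>sphere_measure))"
        by (rule integral_sphere_sum_mult[OF finite_L sphere_poly_Y spK])
      finally show "(\<Sum>l\<in>L (2 * i). co i l v * co i l v) = kernel_norm2 i"
        by (simp add: co_def transform_def)
    qed
    also have "\<dots> = kernel_norm2 i" by (simp add: prob_space)
    finally have "real (card (L (2 * i))) * c = kernel_norm2 i" .
    moreover have "real (card (L (2 * i))) \<noteq> 0" using ne finite_L by simp
    ultimately show ?thesis by (simp add: field_simps)
  qed
  have "(\<integral>v. transform i (Y (2 * i) a) v * transform i' (Y (2 * i') b) v \<partial>\<mu>) = M a b"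
    by (simp add: M_def co_def)
  also have "\<dots> = (if i = i' \<and> a = b then c else 0)" using c[OF a b] by simp
  finally show ?thesis using c_eq by simp
qed

end

section \<open>Orthonormality of the transformed harmonics\<close>

text \<open>The normalization is \<open>\<kappa>\<^sub>j\<^sup>2 d\<^sub>n(j) \<cdot> |K|\<^sup>2 / d\<^sub>n(j) = 1\<close>: the factor \<open>d\<^sub>n(j)\<close> cancels the number of
  basis functions, and \<open>\<kappa>\<^sub>j\<close> the norm of the kernel.\<close>

theorem lemma3p8:
  fixes n k :: nat
    and Y :: "nat \<Rightarrow> nat \<Rightarrow> real^'p \<Rightarrow> real"
    and \<mu> :: "(real^'m^'p) measure"
  assumes "n \<ge> 2" and "1 \<le> k" and "k \<le> n - 1"
    and "CARD('p) = n + 1" and "CARD('m) = n - k"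
    and "stiefel_invariant_prob \<mu>"
    and "orthonormal_basis sphere_measure (harm_index n) (\<lambda>(j, l). Y j l)"
    and "\<And>j l. (j, l) \<in> harm_index n \<Longrightarrow> spherical_harmonic j (Y j l)"
  shows "orthonormal_family \<mu> {(j, l) \<in> harm_index n. even j} (\<lambda>(j, l). Y_hat n k j (Y j l))"
proof -
  define \<alpha> \<beta> where "\<alpha> = (real k - 1) / 2" and "\<beta> = (real n - real k) / 2 - 1"
  define L where "L j = {l. 1 \<le> l \<and> real l \<le> harm_dim n j}" for j
  have L: "finite (L j)" "real (card (L j)) = harm_dim n j" "harm_dim n j > 0" for j
  proof -
    obtain d where d: "harm_dim n j = real d" "d > 0" using harm_dim_eq_nat[OF assms(1)] .
    have "L j = {1..d}" by (auto simp: L_def d(1))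
    then show "finite (L j)" "real (card (L j)) = harm_dim n j" "harm_dim n j > 0"
      using d by simp_all
  qed
  have index: "harm_index n = {(j, l). l \<in> L j}" by (simp add: harm_index_def L_def)
  have hb: "harmonic_basis L Y"
  proof
    show "2 \<le> DIM(real^'p)" using assms(1,4) by simp
    show "finite (L j)" for j by (rule L)
    show "spherical_harmonic j (Y j l)" if "l \<in> L j" for j l
      using assms(8) that by (simp add: index)
    show "orthonormal_basis sphere_measure {(j, l). l \<in> L j} (\<lambda>(j, l). Y j l)"
      using assms(7) unfolding index .
  qed
  interpret harmonic_basis L Y by (rule hb)
  have kn: "k < n" using assms(1-3) by linarith
  interpret prob_space \<mu> using assms(6) by (simp add: stiefel_invariant_prob_def)
  interpret invariant_stiefel_measure \<mu> \<alpha> \<beta>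
  proof
    show "stiefel_invariant_prob \<mu>" by (rule assms(6))
    show "real CARD('m) = 2 * (\<beta> + 1)" using assms(5) kn by (simp add: \<beta>_def of_nat_diff)
    show "real CARD('p) = 2 * (\<alpha> + 1) + 2 * (\<beta> + 1)" using assms(4) by (simp add: \<alpha>_def \<beta>_def field_simps)
  qed
  define r where "r i = varkappa n k (2 * i) * sqrt (harm_dim n (2 * i))" for i
  have Yhat: "Y_hat n k (2 * i) (Y (2 * i) l) v = r i * transform i (Y (2 * i) l) v" for i l v
    unfolding Y_hat_def r_def transform_def stiefel_kernel_def \<alpha>_def[symmetric] \<beta>_def[symmetric] by simp
  have scale: "(r i)\<^sup>2 * (kernel_norm2 i / card (L (2 * i))) = 1" for i
  proof -
    have "(varkappa n k (2 * i))\<^sup>2 * kernel_norm2 i = 1"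
      unfolding kernel_norm2_def by (rule varkappa_square[OF assms(1-3), folded \<alpha>_def \<beta>_def])
    moreover have "(r i)\<^sup>2 = (varkappa n k (2 * i))\<^sup>2 * harm_dim n (2 * i)"
      using L(3)[of "2 * i"] by (simp add: r_def power_mult_distrib)
    ultimately show ?thesis using L(2,3)[of "2 * i"] by simp
  qed
  have sq: "square_integrable \<mu> (Y_hat n k (2 * i) (Y (2 * i) l))" if l: "l \<in> L (2 * i)" for i l
    unfolding square_integrable_def
  proof
    have "transform i (Y (2 * i) l) \<in> borel_measurable \<mu>"
      by (rule transform_measurable[OF borel_measurable_integrable[OF integrable_sphere_poly[OF sphere_poly_Y[OF l]]]])
    then show "Y_hat n k (2 * i) (Y (2 * i) l) \<in> borel_measurable \<mu>"
      by (simp add: Yhat[THEN ext] borel_measurable_times)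
    have "integrable \<mu> (\<lambda>v. (r i)\<^sup>2 * (transform i (Y (2 * i) l) v * transform i (Y (2 * i) l) v))"
      by (intro integrable_mult_right integrable_transform_mult sphere_poly_Y l)
    then show "integrable \<mu> (\<lambda>v. (Y_hat n k (2 * i) (Y (2 * i) l) v)\<^sup>2)"
      unfolding Yhat power_mult_distrib by (simp only: power2_eq_square)
  qed
  have inner: "(\<integral>v. Y_hat n k (2 * i) (Y (2 * i) l) v * Y_hat n k (2 * i') (Y (2 * i') l') v \<partial>\<mu>)
      = (if i = i' \<and> l = l' then 1 else 0)" if l: "l \<in> L (2 * i)" and l': "l' \<in> L (2 * i')" for i i' l l'
  proof -
    have "(\<integral>v. Y_hat n k (2 * i) (Y (2 * i) l) v * Y_hat n k (2 * i') (Y (2 * i') l') v \<partial>\<mu>)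
      = (\<integral>v. (r i * r i') * (transform i (Y (2 * i) l) v * transform i' (Y (2 * i') l') v) \<partial>\<mu>)"
      unfolding Yhat by (simp only: mult_ac)
    also have "\<dots> = (r i * r i') * (if i = i' \<and> l = l' then kernel_norm2 i / card (L (2 * i)) else 0)"
      by (simp only: integral_mult_right_zero transform_inner_products[OF hb l l'])
    also have "\<dots> = (if i = i' \<and> l = l' then 1 else 0)"
    proof (cases "i = i' \<and> l = l'")
      case True
      then have ri: "r i' = r i" by simp
      show ?thesis
        unfolding if_P[OF True] ri power2_eq_square[symmetric] by (rule scale)
    next
      case False
      show ?thesis unfolding if_not_P[OF False] by (rule mult_zero_right)
    qed
    finally show ?thesis .
  qed
  show ?thesis
    unfolding orthonormal_family_def
  proof (intro conjI ballI)
    fix z assume "z \<in> {(j, l) \<in> harm_index n. even j}"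
    then obtain i l where z: "z = (2 * i, l)" "l \<in> L (2 * i)" by (auto simp: index elim!: evenE)
    show "square_integrable \<mu> (case z of (j, l) \<Rightarrow> Y_hat n k j (Y j l))"
      using sq[OF z(2)] by (simp add: z(1))
    fix z' assume "z' \<in> {(j, l) \<in> harm_index n. even j}"
    then obtain i' l' where z': "z' = (2 * i', l')" "l' \<in> L (2 * i')" by (auto simp: index elim!: evenE)
    show "(\<integral>v. (case z of (j, l) \<Rightarrow> Y_hat n k j (Y j l)) v * (case z' of (j, l) \<Rightarrow> Y_hat n k j (Y j l)) v \<partial>\<mu>)
        = (if z = z' then 1 else 0)"
      using inner[OF z(2) z'(2)] by (simp add: z(1) z'(1))
  qed
qed

end
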